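(* Let $X$ be an $S$-scheme and $m,n\ge 1$. For all sections $\alpha$ of $\Omega^{(m)}_{X/S}$ and $\beta$ of $\Omega^{(n)}_{X/S}$, $$\nu_m(\alpha)*\nu_n(\beta)=\nu_{m+n}(\alpha\,\tilde\wedge\,\beta).$$ In other words, the square with horizontal isomorphisms $\nu_m\otimes\nu_n:\Omega^{(m)}_{X/S}\otimes_{\mathcal{O}_X}\Omega^{(n)}_{X/S}\xrightarrow{\sim}\Psi^{(m)}_{X/S}\otimes_{\mathcal{O}_X}\Psi^{(n)}_{X/S}$ and $\nu_{m+n}:\Omega^{(m+n)}_{X/S}\xrightarrow{\sim}\Psi^{(m+n)}_{X/S}$, with left vertical map the canonical product $\alpha\otimes\beta\mapsto\alpha\tilde\wedge\beta$ and right vertical map $f\otimes g\mapsto f*g$, is commutative.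
   Context: All constructions are Zariski local on $X$ and $S$, and $X/S$ is taken to be separated; $\mathcal{O}_X^{\otimes n+1}$ is the tensor power over $\mathcal{O}_S$. For $0\le r,s\le n$, $J_{rs}\subset\mathcal{O}_X^{\otimes n+1}$ is the ideal generated by the elements $d^{r,s}b:=$ (tensor with $b$ in position $s+1$, $1$ elsewhere) $-$ (tensor with $b$ in position $r+1$, $1$ elsewhere), $b\in\mathcal{O}_X$. Put $J^{(2)}_{0n}:=\sum_{r<s}J_{rs}^2$ and $\Delta^{(n)}_{X/S}:=\mathrm{Spec}(\mathcal{O}_X^{\otimes n+1}/J^{(2)}_{0n})\subset X^{n+1}$. $\Psi^{(n)}_{X/S}:=\bigcap_{r<s}\tilde J_{rs}$ with $\tilde J_{rs}$ the image of $J_{rs}$ in $\mathcal{O}_X^{\otimes n+1}/J^{(2)}_{0n}$; its elements are functions $f(x_0,\dots,x_n)$ on $\Delta^{(n)}_{X/S}$ vanishing whenever $x_r=x_s$ for some $r<s$. The product of $f\in\Psi^{(m)}_{X/S}$ and $g\in\Psi^{(n)}_{X/S}$ is the element $f*g\in\Psi^{(m+n)}_{X/S}$ given by $(f*g)(x_0,\dots,x_{m+n}):=f(x_0,\dots,x_m)\,g(x_m,\dots,x_{m+n})$. $\Omega^{(n)}_{X/S}$ is the quotient of $(\Omega^1_{X/S})^{\otimes n}$ by the submodule generated by sums of a pure tensor and the tensor obtained by exchanging two of its factors; the class of $\omega_1\otimes\cdots\otimes\omega_n$ is $\omega_1\tilde\wedge\cdots\tilde\wedge\omega_n$. $\nu_n:\Omega^{(n)}_{X/S}\to\Psi^{(n)}_{X/S}$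 is the $\mathcal{O}_X$-linear isomorphism $db_1\tilde\wedge\cdots\tilde\wedge db_n\mapsto\prod_{i=1}^n d^{0,i}b_i \bmod J^{(2)}_{0n}$. *)

theory Defs
  imports "HOL-Algebra.Algebra" "HOL-Analysis.Abstract_Topology"
begin

section \<open>Linear algebra over a commutative ring\<close>

text \<open>Records of type \<^typ>\<open>('r, 'm) module\<close> inherit the fields \<open>mult\<close> and \<open>one\<close> from rings.
  Modules that are only modules leave these fields \<^const>\<open>undefined\<close>.\<close>

definition free_module :: "('r, 'x) ring_scheme \<Rightarrow> 's set \<Rightarrow> ('r, 's \<Rightarrow> 'r) module" where
  "free_module R S =
    \<lparr>carrier = {f. (\<forall>s. f s \<in> carrier R) \<and> (\<forall>s. s \<notin> S \<longrightarrow> f s = \<zero>\<^bsub>R\<^esub>) \<and> finite {s. f s \<noteq> \<zero>\<^bsub>R\<^esub>}},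
     monoid.mult = undefined, one = undefined,
     ring.zero = (\<lambda>s. \<zero>\<^bsub>R\<^esub>), ring.add = (\<lambda>f g s. f s \<oplus>\<^bsub>R\<^esub> g s),
     smult = (\<lambda>r f s. r \<otimes>\<^bsub>R\<^esub> f s)\<rparr>"

definition free_gen :: "('r, 'x) ring_scheme \<Rightarrow> 's \<Rightarrow> 's \<Rightarrow> 'r" where
  "free_gen R s = (\<lambda>t. if t = s then \<one>\<^bsub>R\<^esub> else \<zero>\<^bsub>R\<^esub>)"

definition gen_submodule ::
  "('r, 'x) ring_scheme \<Rightarrow> ('r, 'm) module \<Rightarrow> 'm set \<Rightarrow> 'm set" where
  "gen_submodule R M G = \<Inter>{N. submodule N R M \<and> G \<subseteq> N}"

definition quot_module :: "('r, 'm) module \<Rightarrow> 'm set \<Rightarrow> ('r, 'm set) module" where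
  "quot_module M N =
    \<lparr>carrier = a_rcosets\<^bsub>M\<^esub> N,
     monoid.mult = undefined, one = undefined,
     ring.zero = N, ring.add = set_add M,
     smult = (\<lambda>r C. \<Union>x\<in>C. N +>\<^bsub>M\<^esub> (r \<odot>\<^bsub>M\<^esub> x))\<rparr>"

text \<open>Maps are extensional on the carrier, so that a map given by its values on generators is
  unique as a function and can be named with \<open>THE\<close>. For \<open>\<sigma>\<close> the identity these are the
  \<open>R\<close>-linear maps.\<close>

definition semilinear ::
  "('r \<Rightarrow> 't) \<Rightarrow> ('r, 'x) ring_scheme \<Rightarrow> ('r, 'm) module \<Rightarrow> ('t, 'n) module \<Rightarrow> ('m \<Rightarrow> 'n) set" where
  "semilinear \<sigma> R M N =
    {h \<in> carrier M \<rightarrow>\<^sub>E carrier N.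
       (\<forall>x\<in>carrier M. \<forall>y\<in>carrier M. h (x \<oplus>\<^bsub>M\<^esub> y) = h x \<oplus>\<^bsub>N\<^esub> h y) \<and>
       (\<forall>r\<in>carrier R. \<forall>x\<in>carrier M. h (r \<odot>\<^bsub>M\<^esub> x) = \<sigma> r \<odot>\<^bsub>N\<^esub> h x)}"

abbreviation linear_maps ::
  "('r, 'x) ring_scheme \<Rightarrow> ('r, 'm) module \<Rightarrow> ('r, 'n) module \<Rightarrow> ('m \<Rightarrow> 'n) set" where
  "linear_maps \<equiv> semilinear (\<lambda>r. r)"

definition bilinear_maps ::
  "('r, 'x) ring_scheme \<Rightarrow> ('r, 'm) module \<Rightarrow> ('r, 'n) module \<Rightarrow> ('r, 'k) module
    \<Rightarrow> ('m \<Rightarrow> 'n \<Rightarrow> 'k) set" where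
  "bilinear_maps R M N P =
    {p \<in> carrier M \<rightarrow>\<^sub>E carrier N \<rightarrow>\<^sub>E carrier P.
       (\<forall>x\<in>carrier M. p x \<in> linear_maps R N P) \<and>
       (\<forall>y\<in>carrier N. (\<lambda>x\<in>carrier M. p x y) \<in> linear_maps R M P)}"

text \<open>The tensor product over \<open>R\<close> of a finite list of modules. Tuples are lists.\<close>

definition tuples :: "('r, 'm) module list \<Rightarrow> 'm list set" where
  "tuples Ms = listset (map carrier Ms)"

definition tensor_rels ::
  "('r, 'x) ring_scheme \<Rightarrow> ('r, 'm) module list \<Rightarrow> ('m list \<Rightarrow> 'r) set" where
  "tensor_rels R Ms = (let F = free_module R (tuples Ms) in
     {free_gen R (xs[i := x \<oplus>\<^bsub>Ms ! i\<^esub> y])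
        \<ominus>\<^bsub>F\<^esub> free_gen R (xs[i := x]) \<ominus>\<^bsub>F\<^esub> free_gen R (xs[i := y]) | xs i x y.
        xs \<in> tuples Ms \<and> i < length Ms \<and> x \<in> carrier (Ms ! i) \<and> y \<in> carrier (Ms ! i)} \<union>
     {free_gen R (xs[i := r \<odot>\<^bsub>Ms ! i\<^esub> x]) \<ominus>\<^bsub>F\<^esub> r \<odot>\<^bsub>F\<^esub> free_gen R (xs[i := x]) | xs i r x.
        xs \<in> tuples Ms \<and> i < length Ms \<and> r \<in> carrier R \<and> x \<in> carrier (Ms ! i)})"

definition tensor_kernel ::
  "('r, 'x) ring_scheme \<Rightarrow> ('r, 'm) module list \<Rightarrow> ('m list \<Rightarrow> 'r) set" where
  "tensor_kernel R Ms = gen_submodule R (free_module R (tuples Ms)) (tensor_rels R Ms)"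

definition tensor ::
  "('r, 'x) ring_scheme \<Rightarrow> ('r, 'm) module list \<Rightarrow> ('r, ('m list \<Rightarrow> 'r) set) module" where
  "tensor R Ms = quot_module (free_module R (tuples Ms)) (tensor_kernel R Ms)"

definition pure_tensor ::
  "('r, 'x) ring_scheme \<Rightarrow> ('r, 'm) module list \<Rightarrow> 'm list \<Rightarrow> ('m list \<Rightarrow> 'r) set" where
  "pure_tensor R Ms xs = tensor_kernel R Ms +>\<^bsub>free_module R (tuples Ms)\<^esub> free_gen R xs"

text \<open>The additive, \<open>\<sigma>\<close>-semilinear map \<open>M \<otimes>\<^sub>R N \<rightarrow> P\<close> with \<open>x \<otimes> y \<mapsto> p x y\<close>.\<close>

definition tensor_lift ::
  "('r \<Rightarrow> 't) \<Rightarrow> ('r, 'x) ring_scheme \<Rightarrow> ('r, 'm) module \<Rightarrow> ('r, 'm) module \<Rightarrow> ('t, 'k) module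
    \<Rightarrow> ('m \<Rightarrow> 'm \<Rightarrow> 'k) \<Rightarrow> ('m list \<Rightarrow> 'r) set \<Rightarrow> 'k" where
  "tensor_lift \<sigma> R M N P p =
    (THE h. h \<in> semilinear \<sigma> R (tensor R [M, N]) P \<and>
       (\<forall>x\<in>carrier M. \<forall>y\<in>carrier N. h (pure_tensor R [M, N] [x, y]) = p x y))"


section \<open>The affine constructions\<close>

record ('c, 'a) ring_map =
  rm_base :: "'c ring"
  rm_ring :: "'a ring"
  rm_map :: "'c \<Rightarrow> 'a"

text \<open>In this section \<open>K\<close> is a homomorphism \<open>A \<rightarrow> B\<close> of commutative rings
  (\<open>A = rm_base K\<close>, \<open>B = rm_ring K\<close>), i.e. \<open>X = Spec B\<close> and \<open>S = Spec A\<close>.\<close>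

subsection \<open>Differential forms\<close>

definition kaehler_rels :: "('c, 'a) ring_map \<Rightarrow> ('a \<Rightarrow> 'a) set" where
  "kaehler_rels K = (let B = rm_ring K; F = free_module B (carrier B) in
     {free_gen B (b \<oplus>\<^bsub>B\<^esub> c) \<ominus>\<^bsub>F\<^esub> free_gen B b \<ominus>\<^bsub>F\<^esub> free_gen B c | b c.
        b \<in> carrier B \<and> c \<in> carrier B} \<union>
     {free_gen B (b \<otimes>\<^bsub>B\<^esub> c) \<ominus>\<^bsub>F\<^esub> b \<odot>\<^bsub>F\<^esub> free_gen B c \<ominus>\<^bsub>F\<^esub> c \<odot>\<^bsub>F\<^esub> free_gen B b | b c.
        b \<in> carrier B \<and> c \<in> carrier B} \<union>
     {free_gen B (rm_map K a) | a. a \<in> carrier (rm_base K)})"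

definition kaehler_kernel :: "('c, 'a) ring_map \<Rightarrow> ('a \<Rightarrow> 'a) set" where
  "kaehler_kernel K = (let B = rm_ring K in
     gen_submodule B (free_module B (carrier B)) (kaehler_rels K))"

definition kaehler :: "('c, 'a) ring_map \<Rightarrow> ('a, ('a \<Rightarrow> 'a) set) module" where
  "kaehler K = (let B = rm_ring K in
     quot_module (free_module B (carrier B)) (kaehler_kernel K))"

definition diff :: "('c, 'a) ring_map \<Rightarrow> 'a \<Rightarrow> ('a \<Rightarrow> 'a) set" where
  "diff K b = (let B = rm_ring K in
     kaehler_kernel K +>\<^bsub>free_module B (carrier B)\<^esub> free_gen B b)"

type_synonym 'a form = "(('a \<Rightarrow> 'a) set list \<Rightarrow> 'a) set set"

definition Omega_kernel :: "('c, 'a) ring_map \<Rightarrow> nat \<Rightarrow> (('a \<Rightarrow> 'a) set list \<Rightarrow> 'a) set set" where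
  "Omega_kernel K n = (let B = rm_ring K; Ms = replicate n (kaehler K); T = tensor B Ms in
     gen_submodule B T
       {pure_tensor B Ms ws \<oplus>\<^bsub>T\<^esub> pure_tensor B Ms (ws[i := ws ! j, j := ws ! i]) | ws i j.
          ws \<in> tuples Ms \<and> i < n \<and> j < n \<and> i \<noteq> j})"

definition Omega :: "('c, 'a) ring_map \<Rightarrow> nat \<Rightarrow> ('a, 'a form) module" where
  "Omega K n =
     quot_module (tensor (rm_ring K) (replicate n (kaehler K))) (Omega_kernel K n)"

definition twedge_list :: "('c, 'a) ring_map \<Rightarrow> nat \<Rightarrow> ('a \<Rightarrow> 'a) set list \<Rightarrow> 'a form" where
  "twedge_list K n ws = (let B = rm_ring K; Ms = replicate n (kaehler K) in
     Omega_kernel K n +>\<^bsub>tensor B Ms\<^esub> pure_tensor B Ms ws)"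

definition twedge :: "('c, 'a) ring_map \<Rightarrow> nat \<Rightarrow> nat \<Rightarrow> 'a form \<Rightarrow> 'a form \<Rightarrow> 'a form" where
  "twedge K m n =
    (THE p. p \<in> bilinear_maps (rm_ring K) (Omega K m) (Omega K n) (Omega K (m + n)) \<and>
       (\<forall>us\<in>tuples (replicate m (kaehler K)). \<forall>vs\<in>tuples (replicate n (kaehler K)).
          p (twedge_list K m us) (twedge_list K n vs) = twedge_list K (m + n) (us @ vs)))"

subsection \<open>Combinatorial forms\<close>

definition base_module :: "('c, 'a) ring_map \<Rightarrow> ('c, 'a) module" where
  "base_module K = (let B = rm_ring K in
    \<lparr>carrier = carrier B, monoid.mult = monoid.mult B, one = \<one>\<^bsub>B\<^esub>,
     ring.zero = \<zero>\<^bsub>B\<^esub>, ring.add = ring.add B,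
     smult = (\<lambda>a b. rm_map K a \<otimes>\<^bsub>B\<^esub> b)\<rparr>)"

text \<open>The ring \<open>B \<otimes>\<^sub>A \<dots> \<otimes>\<^sub>A B\<close> with \<open>n + 1\<close> factors, numbered \<open>0, \<dots>, n\<close>; multiplication is the
  \<open>A\<close>-bilinear map that is factorwise on pure tensors.\<close>

definition tensor_power :: "('c, 'a) ring_map \<Rightarrow> nat \<Rightarrow> (('a list \<Rightarrow> 'c) set) ring" where
  "tensor_power K n =
    (let A = rm_base K; B = rm_ring K; Ms = replicate (n + 1) (base_module K); T = tensor A Ms in
     \<lparr>carrier = carrier T,
      monoid.mult = (THE p. p \<in> bilinear_maps A T T T \<and>
        (\<forall>xs\<in>tuples Ms. \<forall>ys\<in>tuples Ms.
           p (pure_tensor A Ms xs) (pure_tensor A Ms ys) =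
             pure_tensor A Ms (map2 (\<lambda>x y. x \<otimes>\<^bsub>B\<^esub> y) xs ys))),
      one = pure_tensor A Ms (replicate (n + 1) \<one>\<^bsub>B\<^esub>),
      ring.zero = \<zero>\<^bsub>T\<^esub>, ring.add = ring.add T\<rparr>)"

text \<open>\<open>1 \<otimes> \<dots> \<otimes> b \<otimes> \<dots> \<otimes> 1\<close> with \<open>b\<close> in factor number \<open>i\<close>, i.e. the function \<open>b(x\<^sub>i)\<close>.\<close>

definition at_factor :: "('c, 'a) ring_map \<Rightarrow> nat \<Rightarrow> nat \<Rightarrow> 'a \<Rightarrow> ('a list \<Rightarrow> 'c) set" where
  "at_factor K n i b = pure_tensor (rm_base K) (replicate (n + 1) (base_module K))
     ((replicate (n + 1) \<one>\<^bsub>rm_ring K\<^esub>)[i := b])"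

definition dd :: "('c, 'a) ring_map \<Rightarrow> nat \<Rightarrow> nat \<Rightarrow> nat \<Rightarrow> 'a \<Rightarrow> ('a list \<Rightarrow> 'c) set" where
  "dd K n r s b = at_factor K n s b \<ominus>\<^bsub>tensor_power K n\<^esub> at_factor K n r b"

definition J :: "('c, 'a) ring_map \<Rightarrow> nat \<Rightarrow> nat \<Rightarrow> nat \<Rightarrow> ('a list \<Rightarrow> 'c) set set" where
  "J K n r s = Idl\<^bsub>tensor_power K n\<^esub> (dd K n r s ` carrier (rm_ring K))"

text \<open>The sum of ideals \<open>\<Sum>\<^bsub>r<s\<^esub> J\<^bsub>rs\<^esub>\<^sup>2\<close>, as the ideal generated by their union.\<close>

definition J2 :: "('c, 'a) ring_map \<Rightarrow> nat \<Rightarrow> ('a list \<Rightarrow> 'c) set set" where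
  "J2 K n = Idl\<^bsub>tensor_power K n\<^esub>
     (\<Union>s\<in>{0..n}. \<Union>r\<in>{0..<s}. J K n r s \<cdot>\<^bsub>tensor_power K n\<^esub> J K n r s)"

type_synonym ('c, 'a) delta_fun = "('a list \<Rightarrow> 'c) set set"

text \<open>The coordinate ring of the affine scheme \<open>\<Delta>\<^bsup>(n)\<^esup>\<close>.\<close>

definition Delta_ring :: "('c, 'a) ring_map \<Rightarrow> nat \<Rightarrow> ('c, 'a) delta_fun ring" where
  "Delta_ring K n = tensor_power K n Quot J2 K n"

definition Delta_class ::
  "('c, 'a) ring_map \<Rightarrow> nat \<Rightarrow> ('a list \<Rightarrow> 'c) set \<Rightarrow> ('c, 'a) delta_fun" where
  "Delta_class K n x = J2 K n +>\<^bsub>tensor_power K n\<^esub> x"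

text \<open>\<open>\<Psi>\<^bsup>(n)\<^esup>\<close> as a \<open>B\<close>-module via the factor number \<open>0\<close>. Any other factor gives the same module
  structure, since \<open>\<Psi>\<^bsup>(n)\<^esup> \<subseteq> J\<^bsub>rs\<^esub>\<close> modulo \<open>J\<^bsup>(2)\<^esup>\<close> is annihilated by \<open>J\<^bsub>rs\<^esub>\<close>.\<close>

definition Psi :: "('c, 'a) ring_map \<Rightarrow> nat \<Rightarrow> ('a, ('c, 'a) delta_fun) module" where
  "Psi K n = (let D = Delta_ring K n in
    \<lparr>carrier = {f \<in> carrier D. \<forall>r s. r < s \<and> s \<le> n \<longrightarrow> f \<in> Delta_class K n ` J K n r s},
     monoid.mult = undefined, one = undefined, ring.zero = \<zero>\<^bsub>D\<^esub>, ring.add = ring.add D,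
     smult = (\<lambda>b f. Delta_class K n (at_factor K n 0 b) \<otimes>\<^bsub>D\<^esub> f)\<rparr>)"

text \<open>A ring homomorphism between coordinate rings is determined by its values on the functions
  \<open>b(x\<^sub>i)\<close>. \<open>Delta_shift K m N k\<close> is \<open>f \<mapsto> f(x\<^sub>k, \<dots>, x\<^bsub>k+m\<^esub>)\<close>, from functions on \<open>\<Delta>\<^bsup>(m)\<^esup>\<close> to functions
  on \<open>\<Delta>\<^bsup>(N)\<^esup>\<close>.\<close>

definition Delta_shift ::
  "('c, 'a) ring_map \<Rightarrow> nat \<Rightarrow> nat \<Rightarrow> nat \<Rightarrow> ('c, 'a) delta_fun \<Rightarrow> ('c, 'a) delta_fun" where
  "Delta_shift K m N k =
    (THE h. h \<in> ring_hom (Delta_ring K m) (Delta_ring K N) \<inter> extensional (carrier (Delta_ring K m)) \<and>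
       (\<forall>i\<le>m. \<forall>b\<in>carrier (rm_ring K).
          h (Delta_class K m (at_factor K m i b)) = Delta_class K N (at_factor K N (k + i) b)))"

definition star ::
  "('c, 'a) ring_map \<Rightarrow> nat \<Rightarrow> nat \<Rightarrow> ('c, 'a) delta_fun \<Rightarrow> ('c, 'a) delta_fun
    \<Rightarrow> ('c, 'a) delta_fun" where
  "star K m n f g =
     Delta_shift K m (m + n) 0 f \<otimes>\<^bsub>Delta_ring K (m + n)\<^esub> Delta_shift K n (m + n) m g"

text \<open>\<open>\<nu>\<^sub>n\<close> is the only \<open>B\<close>-linear map with the prescribed values, because the elements
  \<open>db\<^sub>1 \<and> \<dots> \<and> db\<^sub>n\<close> generate \<open>\<Omega>\<^bsup>(n)\<^esup>\<close>. The list position of \<open>b\<^sub>i\<close> is \<open>i - 1\<close>.\<close>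

definition nu :: "('c, 'a) ring_map \<Rightarrow> nat \<Rightarrow> 'a form \<Rightarrow> ('c, 'a) delta_fun" where
  "nu K n =
    (THE h. h \<in> linear_maps (rm_ring K) (Omega K n) (Psi K n) \<and>
       (\<forall>bs. length bs = n \<and> set bs \<subseteq> carrier (rm_ring K) \<longrightarrow>
          h (twedge_list K n (map (diff K) bs)) =
            Delta_class K n (\<Otimes>\<^bsub>tensor_power K n\<^esub> i\<in>{1..n}. dd K n 0 i (bs ! (i - 1)))))"

subsection \<open>The four maps of the square\<close>

definition twedge_tensor ::
  "('c, 'a) ring_map \<Rightarrow> nat \<Rightarrow> nat \<Rightarrow> ('a form list \<Rightarrow> 'a) set \<Rightarrow> 'a form" where
  "twedge_tensor K m n =
     tensor_lift (\<lambda>b. b) (rm_ring K) (Omega K m) (Omega K n) (Omega K (m + n)) (twedge K m n)"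

definition star_tensor ::
  "('c, 'a) ring_map \<Rightarrow> nat \<Rightarrow> nat \<Rightarrow> (('c, 'a) delta_fun list \<Rightarrow> 'a) set \<Rightarrow> ('c, 'a) delta_fun" where
  "star_tensor K m n =
     tensor_lift (\<lambda>b. b) (rm_ring K) (Psi K m) (Psi K n) (Psi K (m + n)) (star K m n)"

definition nu_tensor ::
  "('c, 'a) ring_map \<Rightarrow> nat \<Rightarrow> nat \<Rightarrow> ('a form list \<Rightarrow> 'a) set
    \<Rightarrow> (('c, 'a) delta_fun list \<Rightarrow> 'a) set" where
  "nu_tensor K m n =
     tensor_lift (\<lambda>b. b) (rm_ring K) (Omega K m) (Omega K n) (tensor (rm_ring K) [Psi K m, Psi K n])
       (\<lambda>\<alpha> \<beta>. pure_tensor (rm_ring K) [Psi K m, Psi K n] [nu K m \<alpha>, nu K n \<beta>])"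

subsection \<open>Functoriality\<close>

text \<open>The maps induced by a morphism \<open>K \<rightarrow> L\<close> of ring maps whose component on the top rings
  is \<open>\<sigma>\<close>.\<close>

definition Omega_map ::
  "('a \<Rightarrow> 'a) \<Rightarrow> ('c, 'a) ring_map \<Rightarrow> ('c, 'a) ring_map \<Rightarrow> nat \<Rightarrow> 'a form \<Rightarrow> 'a form" where
  "Omega_map \<sigma> K L n =
    (THE h. h \<in> semilinear \<sigma> (rm_ring K) (Omega K n) (Omega L n) \<and>
       (\<forall>bs. length bs = n \<and> set bs \<subseteq> carrier (rm_ring K) \<longrightarrow>
          h (twedge_list K n (map (diff K) bs)) = twedge_list L n (map (diff L) (map \<sigma> bs))))"

definition Omega_tensor_map ::
  "('a \<Rightarrow> 'a) \<Rightarrow> ('c, 'a) ring_map \<Rightarrow> ('c, 'a) ring_map \<Rightarrow> nat \<Rightarrow> nat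
    \<Rightarrow> ('a form list \<Rightarrow> 'a) set \<Rightarrow> ('a form list \<Rightarrow> 'a) set" where
  "Omega_tensor_map \<sigma> K L m n =
     tensor_lift \<sigma> (rm_ring K) (Omega K m) (Omega K n) (tensor (rm_ring L) [Omega L m, Omega L n])
       (\<lambda>\<alpha> \<beta>. pure_tensor (rm_ring L) [Omega L m, Omega L n]
          [Omega_map \<sigma> K L m \<alpha>, Omega_map \<sigma> K L n \<beta>])"


section \<open>Schemes\<close>

record ('p, 'a) ringed_space =
  rtop :: "'p topology"
  sec :: "'p set \<Rightarrow> 'a ring"
  res :: "'p set \<Rightarrow> 'p set \<Rightarrow> 'a \<Rightarrow> 'a"

text \<open>\<open>res Z U V\<close> is the restriction from \<open>U\<close> to \<open>V \<subseteq> U\<close>.\<close>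

definition presheaf_of_rings :: "('p, 'a) ringed_space \<Rightarrow> bool" where
  "presheaf_of_rings Z \<longleftrightarrow>
     (\<forall>U. openin (rtop Z) U \<longrightarrow> cring (sec Z U)) \<and>
     (\<forall>U V. openin (rtop Z) U \<and> openin (rtop Z) V \<and> V \<subseteq> U \<longrightarrow>
        res Z U V \<in> ring_hom (sec Z U) (sec Z V)) \<and>
     (\<forall>U. openin (rtop Z) U \<longrightarrow> (\<forall>s\<in>carrier (sec Z U). res Z U U s = s)) \<and>
     (\<forall>U V W. openin (rtop Z) U \<and> openin (rtop Z) V \<and> openin (rtop Z) W \<and> W \<subseteq> V \<and> V \<subseteq> U \<longrightarrow>
        (\<forall>s\<in>carrier (sec Z U). res Z V W (res Z U V s) = res Z U W s))"

definition sheaf_of_rings :: "('p, 'a) ringed_space \<Rightarrow> bool" where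
  "sheaf_of_rings Z \<longleftrightarrow> presheaf_of_rings Z \<and>
     (\<forall>\<C> s. (\<forall>U\<in>\<C>. openin (rtop Z) U \<and> s U \<in> carrier (sec Z U)) \<and>
        (\<forall>U\<in>\<C>. \<forall>V\<in>\<C>. res Z U (U \<inter> V) (s U) = res Z V (U \<inter> V) (s V)) \<longrightarrow>
        (\<exists>!t. t \<in> carrier (sec Z (\<Union>\<C>)) \<and> (\<forall>U\<in>\<C>. res Z (\<Union>\<C>) U t = s U)))"

definition open_subspace :: "('p, 'a) ringed_space \<Rightarrow> 'p set \<Rightarrow> ('p, 'a) ringed_space" where
  "open_subspace Z U = Z\<lparr>rtop := subtopology (rtop Z) U\<rparr>"

definition ringed_iso :: "('p, 'a) ringed_space \<Rightarrow> ('q, 'b) ringed_space \<Rightarrow> bool" where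
  "ringed_iso Z Y \<longleftrightarrow>
     (\<exists>h k. homeomorphic_map (rtop Z) (rtop Y) h \<and>
        (\<forall>V. openin (rtop Y) V \<longrightarrow>
           k V \<in> ring_iso (sec Y V) (sec Z {x \<in> topspace (rtop Z). h x \<in> V})) \<and>
        (\<forall>V W. openin (rtop Y) V \<and> openin (rtop Y) W \<and> W \<subseteq> V \<longrightarrow>
           (\<forall>s\<in>carrier (sec Y V).
              k W (res Y V W s) =
                res Z {x \<in> topspace (rtop Z). h x \<in> V} {x \<in> topspace (rtop Z). h x \<in> W} (k V s))))"

text \<open>An element of the localization \<open>A\<^sub>p\<close> is the set of all pairs (numerator, denominator) that
  represent it.\<close>

definition loc_frac :: "'a ring \<Rightarrow> 'a set \<Rightarrow> 'a \<Rightarrow> 'a \<Rightarrow> ('a \<times> 'a) set" where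
  "loc_frac A p a f =
    {(b, g). b \<in> carrier A \<and> g \<in> carrier A - p \<and>
       (\<exists>u\<in>carrier A - p. u \<otimes>\<^bsub>A\<^esub> (a \<otimes>\<^bsub>A\<^esub> g \<ominus>\<^bsub>A\<^esub> b \<otimes>\<^bsub>A\<^esub> f) = \<zero>\<^bsub>A\<^esub>)}"

definition loc_add :: "'a ring \<Rightarrow> 'a set \<Rightarrow> ('a \<times> 'a) set \<Rightarrow> ('a \<times> 'a) set \<Rightarrow> ('a \<times> 'a) set" where
  "loc_add A p x y =
    (\<Union>(a, f)\<in>x. \<Union>(b, g)\<in>y. loc_frac A p (a \<otimes>\<^bsub>A\<^esub> g \<oplus>\<^bsub>A\<^esub> b \<otimes>\<^bsub>A\<^esub> f) (f \<otimes>\<^bsub>A\<^esub> g))"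

definition loc_mult :: "'a ring \<Rightarrow> 'a set \<Rightarrow> ('a \<times> 'a) set \<Rightarrow> ('a \<times> 'a) set \<Rightarrow> ('a \<times> 'a) set" where
  "loc_mult A p x y = (\<Union>(a, f)\<in>x. \<Union>(b, g)\<in>y. loc_frac A p (a \<otimes>\<^bsub>A\<^esub> b) (f \<otimes>\<^bsub>A\<^esub> g))"

definition spec_top :: "'a ring \<Rightarrow> 'a set topology" where
  "spec_top A = topology_generated_by ((\<lambda>f. {p. primeideal p A \<and> f \<notin> p}) ` carrier A)"

definition spec_sec :: "'a ring \<Rightarrow> 'a set set \<Rightarrow> ('a set \<Rightarrow> ('a \<times> 'a) set) ring" where
  "spec_sec A U =
    \<lparr>carrier = {s \<in> extensional U. \<forall>p\<in>U. \<exists>V. openin (spec_top A) V \<and> p \<in> V \<and> V \<subseteq> U \<and>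
        (\<exists>a\<in>carrier A. \<exists>f\<in>carrier A. \<forall>q\<in>V. f \<notin> q \<and> s q = loc_frac A q a f)},
     monoid.mult = (\<lambda>s t. \<lambda>p\<in>U. loc_mult A p (s p) (t p)),
     one = (\<lambda>p\<in>U. loc_frac A p \<one>\<^bsub>A\<^esub> \<one>\<^bsub>A\<^esub>),
     ring.zero = (\<lambda>p\<in>U. loc_frac A p \<zero>\<^bsub>A\<^esub> \<one>\<^bsub>A\<^esub>),
     ring.add = (\<lambda>s t. \<lambda>p\<in>U. loc_add A p (s p) (t p))\<rparr>"

definition Spec :: "'a ring \<Rightarrow> ('a set, 'a set \<Rightarrow> ('a \<times> 'a) set) ringed_space" where
  "Spec A = \<lparr>rtop = spec_top A, sec = spec_sec A, res = (\<lambda>U V s. restrict s V)\<rparr>"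

text \<open>If an open subspace is isomorphic to the spectrum of some ring, then that ring is isomorphic
  to its ring of sections; naming the latter avoids quantifying over a type of rings. Isomorphisms
  of ringed spaces are local on stalks.\<close>

definition affine_open :: "('p, 'a) ringed_space \<Rightarrow> 'p set \<Rightarrow> bool" where
  "affine_open Z U \<longleftrightarrow> openin (rtop Z) U \<and> ringed_iso (open_subspace Z U) (Spec (sec Z U))"

definition scheme :: "('p, 'a) ringed_space \<Rightarrow> bool" where
  "scheme Z \<longleftrightarrow> sheaf_of_rings Z \<and> (\<forall>x\<in>topspace (rtop Z). \<exists>U. affine_open Z U \<and> x \<in> U)"

text \<open>A relative scheme \<open>X/S\<close>: the data of a morphism of ringed spaces, with \<open>comorphism F V\<close>
  from \<open>\<O>\<^sub>S(V)\<close> to the sections of \<open>\<O>\<^sub>X\<close> over the preimage of \<open>V\<close>.\<close>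

record ('p, 'a, 'q, 'c) rel_space =
  src :: "('p, 'a) ringed_space"
  tgt :: "('q, 'c) ringed_space"
  point_map :: "'p \<Rightarrow> 'q"
  comorphism :: "'q set \<Rightarrow> 'c \<Rightarrow> 'a"

definition preim :: "('p, 'a, 'q, 'c) rel_space \<Rightarrow> 'q set \<Rightarrow> 'p set" where
  "preim F V = {x \<in> topspace (rtop (src F)). point_map F x \<in> V}"

definition morphism_of_ringed_spaces :: "('p, 'a, 'q, 'c) rel_space \<Rightarrow> bool" where
  "morphism_of_ringed_spaces F \<longleftrightarrow>
     continuous_map (rtop (src F)) (rtop (tgt F)) (point_map F) \<and>
     (\<forall>V. openin (rtop (tgt F)) V \<longrightarrow>
        comorphism F V \<in> ring_hom (sec (tgt F) V) (sec (src F) (preim F V))) \<and>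
     (\<forall>V W. openin (rtop (tgt F)) V \<and> openin (rtop (tgt F)) W \<and> W \<subseteq> V \<longrightarrow>
        (\<forall>s\<in>carrier (sec (tgt F) V).
           comorphism F W (res (tgt F) V W s) =
             res (src F) (preim F V) (preim F W) (comorphism F V s)))"

text \<open>A homomorphism of local rings is local iff it reflects units; a germ is a unit iff some
  restriction of a section representing it is a unit.\<close>

definition unit_at :: "('p, 'a) ringed_space \<Rightarrow> 'p set \<Rightarrow> 'a \<Rightarrow> 'p \<Rightarrow> bool" where
  "unit_at Z U s x \<longleftrightarrow>
     (\<exists>V. openin (rtop Z) V \<and> x \<in> V \<and> V \<subseteq> U \<and> res Z U V s \<in> Units (sec Z V))"

definition local_on_stalks :: "('p, 'a, 'q, 'c) rel_space \<Rightarrow> bool" where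
  "local_on_stalks F \<longleftrightarrow>
     (\<forall>V. \<forall>s\<in>carrier (sec (tgt F) V). \<forall>x\<in>preim F V. openin (rtop (tgt F)) V \<longrightarrow>
        unit_at (src F) (preim F V) (comorphism F V s) x \<longrightarrow> unit_at (tgt F) V s (point_map F x))"

definition rel_scheme :: "('p, 'a, 'q, 'c) rel_space \<Rightarrow> bool" where
  "rel_scheme F \<longleftrightarrow> scheme (src F) \<and> scheme (tgt F) \<and>
     morphism_of_ringed_spaces F \<and> local_on_stalks F"

text \<open>Charts of \<open>X/S\<close> over an open \<open>W \<subseteq> X\<close>: affine opens \<open>U \<subseteq> W\<close> and \<open>V \<subseteq> S\<close> such that
  \<open>U\<close> maps into \<open>V\<close>.\<close>

definition charts :: "('p, 'a, 'q, 'c) rel_space \<Rightarrow> 'p set \<Rightarrow> ('p set \<times> 'q set) set" where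
  "charts F W =
    {(U, V). affine_open (src F) U \<and> U \<subseteq> W \<and> affine_open (tgt F) V \<and> U \<subseteq> preim F V}"

definition chart_ring :: "('p, 'a, 'q, 'c) rel_space \<Rightarrow> 'p set \<times> 'q set \<Rightarrow> ('c, 'a) ring_map" where
  "chart_ring F = (\<lambda>(U, V).
    \<lparr>rm_base = sec (tgt F) V, rm_ring = sec (src F) U,
     rm_map = (\<lambda>a. res (src F) (preim F V) U (comorphism F V a))\<rparr>)"

text \<open>The diagonal \<open>X \<rightarrow> X \<times>\<^sub>S X\<close> is a closed immersion: the products \<open>U \<times>\<^sub>V U'\<close> over charts \<open>(U, V)\<close>
  and \<open>(U', V)\<close> form an affine open cover of \<open>X \<times>\<^sub>S X\<close>, and the preimage \<open>U \<inter> U'\<close> of each of them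
  must be affine, with surjective \<open>\<O>(U) \<otimes> \<O>(U') \<rightarrow> \<O>(U \<inter> U')\<close>.\<close>

definition separated :: "('p, 'a, 'q, 'c) rel_space \<Rightarrow> bool" where
  "separated F \<longleftrightarrow>
     (\<forall>U U' V. (U, V) \<in> charts F (topspace (rtop (src F))) \<and>
        (U', V) \<in> charts F (topspace (rtop (src F))) \<longrightarrow>
        affine_open (src F) (U \<inter> U') \<and>
        generate_ring (sec (src F) (U \<inter> U'))
          (res (src F) U (U \<inter> U') ` carrier (sec (src F) U) \<union>
           res (src F) U' (U \<inter> U') ` carrier (sec (src F) U')) = carrier (sec (src F) (U \<inter> U')))"


section \<open>Sections over an open subset\<close>

text \<open>The sheaves in question are quasi-coherent and given on a chart \<open>(Spec B, Spec A)\<close> by the affine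
  constructions for \<open>A \<rightarrow> B\<close>. As the opens \<open>U\<close> of charts form a basis of the topology, a section over
  \<open>W\<close> is a family indexed by the charts over \<open>W\<close> that is compatible with restriction, and a
  morphism of sheaves acts chart by chart.\<close>

definition glued_sections ::
  "('p, 'a, 'q, 'c) rel_space \<Rightarrow> 'p set \<Rightarrow> ('p set \<times> 'q set \<Rightarrow> ('a, 'm) module)
    \<Rightarrow> ('p set \<times> 'q set \<Rightarrow> 'p set \<times> 'q set \<Rightarrow> 'm \<Rightarrow> 'm) \<Rightarrow> ('p set \<times> 'q set \<Rightarrow> 'm) set" where
  "glued_sections F W M \<rho> =
    {s \<in> (\<Pi>\<^sub>E c\<in>charts F W. carrier (M c)).
       \<forall>c\<in>charts F W. \<forall>c'\<in>charts F W. fst c' \<subseteq> fst c \<and> snd c' \<subseteq> snd c \<longrightarrow> \<rho> c c' (s c) = s c'}"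

definition Omega_sections ::
  "('p, 'a, 'q, 'c) rel_space \<Rightarrow> 'p set \<Rightarrow> nat \<Rightarrow> ('p set \<times> 'q set \<Rightarrow> 'a form) set" where
  "Omega_sections F W n = glued_sections F W (\<lambda>c. Omega (chart_ring F c) n)
     (\<lambda>c c'. Omega_map (res (src F) (fst c) (fst c')) (chart_ring F c) (chart_ring F c') n)"

definition Omega_tensor_sections ::
  "('p, 'a, 'q, 'c) rel_space \<Rightarrow> 'p set \<Rightarrow> nat \<Rightarrow> nat
    \<Rightarrow> ('p set \<times> 'q set \<Rightarrow> ('a form list \<Rightarrow> 'a) set) set" where
  "Omega_tensor_sections F W m n = glued_sections F W
     (\<lambda>c. tensor (rm_ring (chart_ring F c)) [Omega (chart_ring F c) m, Omega (chart_ring F c) n])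
     (\<lambda>c c'. Omega_tensor_map (res (src F) (fst c) (fst c')) (chart_ring F c) (chart_ring F c') m n)"

definition on_charts ::
  "('p, 'a, 'q, 'c) rel_space \<Rightarrow> 'p set \<Rightarrow> (('c, 'a) ring_map \<Rightarrow> 'm \<Rightarrow> 'n)
    \<Rightarrow> ('p set \<times> 'q set \<Rightarrow> 'm) \<Rightarrow> 'p set \<times> 'q set \<Rightarrow> 'n" where
  "on_charts F W \<phi> s = (\<lambda>c\<in>charts F W. \<phi> (chart_ring F c) (s c))"

definition on_charts2 ::
  "('p, 'a, 'q, 'c) rel_space \<Rightarrow> 'p set \<Rightarrow> (('c, 'a) ring_map \<Rightarrow> 'm \<Rightarrow> 'n \<Rightarrow> 'k)
    \<Rightarrow> ('p set \<times> 'q set \<Rightarrow> 'm) \<Rightarrow> ('p set \<times> 'q set \<Rightarrow> 'n) \<Rightarrow> 'p set \<times> 'q set \<Rightarrow> 'k" where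
  "on_charts2 F W \<phi> s t = (\<lambda>c\<in>charts F W. \<phi> (chart_ring F c) (s c) (t c))"

end

theory Submission
  imports Defs
begin

text \<open>
  Sections are families indexed by charts and all maps act chart by chart, so it suffices to treat a
  homomorphism \<open>A \<rightarrow> B\<close> of commutative rings. Write \<open>b(x\<^sub>i)\<close> for \<open>b\<close> placed in factor \<open>i\<close>, so that
  \<open>d\<^bsup>r,s\<^esup>b = b(x\<^sub>s) - b(x\<^sub>r)\<close> and \<open>d\<^bsup>p,s\<^esup>b = d\<^bsup>p,r\<^esup>b + d\<^bsup>r,s\<^esup>b\<close>. On \<open>\<Delta>\<^bsup>(n)\<^esup>\<close> all products
  \<open>d\<^bsup>r,s\<^esup>b \<cdot> d\<^bsup>r,s\<^esup>c\<close> vanish.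

  Both sides of \<open>\<nu>(\<alpha>) * \<nu>(\<beta>) = \<nu>(\<alpha> \<and> \<beta>)\<close> are \<open>B\<close>-bilinear, so only exact forms matter
  (\<open>exact_forms_span\<close>). For \<open>\<alpha> = db\<^sub>1 \<and> \<dots> \<and> db\<^sub>m\<close> and \<open>\<beta> = dc\<^sub>1 \<and> \<dots> \<and> dc\<^sub>n\<close> the left side is
  \<open>\<Prod> d\<^bsup>0,i\<^esup>b\<^sub>i \<cdot> \<Prod> d\<^bsup>m,m+j\<^esup>c\<^sub>j\<close> and the right side is \<open>\<Prod> d\<^bsup>0,i\<^esup>b\<^sub>i \<cdot> \<Prod> d\<^bsup>0,m+j\<^esup>c\<^sub>j\<close>. Since
  \<open>d\<^bsup>0,m+j\<^esup>c = d\<^bsup>0,m\<^esup>c + d\<^bsup>m,m+j\<^esup>c\<close>, each factor may be replaced in turn: \<open>d\<^bsup>0,m\<^esup>c\<close> is killed by the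
  factor \<open>d\<^bsup>0,m\<^esup>b\<^sub>m\<close>, which is present as \<open>m \<ge> 1\<close> (\<open>star_nu_value\<close>). That \<open>*\<close> is bilinear also in its second
  argument holds for the same reason: \<open>\<Psi>\<^bsup>(m)\<^esup>\<close> is killed by \<open>J\<^bsub>0m\<^esub>\<close>, so that functions of \<open>x\<^sub>0\<close> and of
  \<open>x\<^sub>m\<close> act on it in the same way (\<open>star_linear_right\<close>). The square of tensor products commutes because
  it does so on pure tensors.

  The maps involved are definite descriptions, so their existence and uniqueness carry the bulk of the
  proof. Uniqueness follows from spanning sets. Existence follows from the universal properties of
  tensor products, of \<open>\<Omega>\<^sup>1\<close>, of \<open>\<Omega>\<^bsup>(n)\<^esup>\<close>, of the tensor power of an algebra, and of its quotient, the
  coordinate ring of \<open>\<Delta>\<^bsup>(n)\<^esup>\<close> (\<open>tensor_universal\<close>, \<open>kaehler_universal\<close>, \<open>Omega_universal\<close>,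
  \<open>tensor_power_universal\<close>, \<open>Delta_universal\<close>). For \<open>\<nu>\<^sub>n\<close>, the relation \<open>J\<^bsub>0s\<^esub>\<^sup>2 = 0\<close> makes \<open>d\<^bsup>0,s\<^esup>\<close> a
  derivation (\<open>del_derivation\<close>), and \<open>J\<^bsub>rs\<^esub>\<^sup>2 = 0\<close> makes the products \<open>d\<^bsup>0,r\<^esup>b \<cdot> d\<^bsup>0,s\<^esup>c\<close> antisymmetric in
  \<open>b\<close> and \<open>c\<close> (\<open>del_anti\<close>).
\<close>

section \<open>Linear maps, spanning sets and quotients\<close>

text \<open>A linear map, regardless of its values outside the carrier.\<close>

definition linear_on ::
  "('r, 'x) ring_scheme \<Rightarrow> ('r, 'm) module \<Rightarrow> ('r, 'n) module \<Rightarrow> ('m \<Rightarrow> 'n) \<Rightarrow> bool" where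
  "linear_on R M N h \<longleftrightarrow>
     (\<forall>x\<in>carrier M. h x \<in> carrier N) \<and>
     (\<forall>x\<in>carrier M. \<forall>y\<in>carrier M. h (x \<oplus>\<^bsub>M\<^esub> y) = h x \<oplus>\<^bsub>N\<^esub> h y) \<and>
     (\<forall>r\<in>carrier R. \<forall>x\<in>carrier M. h (r \<odot>\<^bsub>M\<^esub> x) = r \<odot>\<^bsub>N\<^esub> h x)"

text \<open>\<open>G\<close> generates the module \<open>M\<close>: no proper submodule contains it.\<close>

definition spans :: "('r, 'x) ring_scheme \<Rightarrow> ('r, 'm) module \<Rightarrow> 'm set \<Rightarrow> bool" where
  "spans R M G \<longleftrightarrow> G \<subseteq> carrier M \<and> (\<forall>N. submodule N R M \<and> G \<subseteq> N \<longrightarrow> carrier M \<subseteq> N)"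

lemma linear_maps_iff:
  "h \<in> linear_maps R M N \<longleftrightarrow> h \<in> extensional (carrier M) \<and> linear_on R M N h"
  unfolding semilinear_def linear_on_def PiE_def by auto

lemma linear_onI:
  assumes "\<And>x. x \<in> carrier M \<Longrightarrow> h x \<in> carrier N"
    and "\<And>x y. \<lbrakk>x \<in> carrier M; y \<in> carrier M\<rbrakk> \<Longrightarrow> h (x \<oplus>\<^bsub>M\<^esub> y) = h x \<oplus>\<^bsub>N\<^esub> h y"
    and "\<And>r x. \<lbrakk>r \<in> carrier R; x \<in> carrier M\<rbrakk> \<Longrightarrow> h (r \<odot>\<^bsub>M\<^esub> x) = r \<odot>\<^bsub>N\<^esub> h x"
  shows "linear_on R M N h"
  using assms unfolding linear_on_def by auto

lemma linear_onD:
  assumes "linear_on R M N h"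
  shows "x \<in> carrier M \<Longrightarrow> h x \<in> carrier N"
    and "\<lbrakk>x \<in> carrier M; y \<in> carrier M\<rbrakk> \<Longrightarrow> h (x \<oplus>\<^bsub>M\<^esub> y) = h x \<oplus>\<^bsub>N\<^esub> h y"
    and "\<lbrakk>r \<in> carrier R; x \<in> carrier M\<rbrakk> \<Longrightarrow> h (r \<odot>\<^bsub>M\<^esub> x) = r \<odot>\<^bsub>N\<^esub> h x"
  using assms unfolding linear_on_def by auto

lemma linear_on_cong:
  assumes "module R M" and "linear_on R M N h" and eq: "\<And>x. x \<in> carrier M \<Longrightarrow> h' x = h x"
  shows "linear_on R M N h'"
proof -
  interpret m: module R M by fact
  show ?thesis
    by (rule linear_onI) (simp_all add: eq linear_onD[OF assms(2)])
qed

lemma linear_on_restrict: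
  assumes "module R M" and "linear_on R M N h"
  shows "(\<lambda>x\<in>carrier M. h x) \<in> linear_maps R M N"
  unfolding linear_maps_iff
  using linear_on_cong[OF assms, of "\<lambda>x\<in>carrier M. h x"] by simp

lemma linear_on_comp:
  assumes "linear_on R M N g" and "linear_on R N P h"
  shows "linear_on R M P (\<lambda>x. h (g x))"
  by (rule linear_onI) (simp_all add: linear_onD[OF assms(1)] linear_onD[OF assms(2)])

lemma linear_on_zero_map:
  assumes "module R N"
  shows "linear_on R M N (\<lambda>_. \<zero>\<^bsub>N\<^esub>)"
proof -
  interpret n: module R N by fact
  show ?thesis by (rule linear_onI) simp_all
qed

lemma linear_on_add:
  assumes "module R N" and "linear_on R M N h" and "linear_on R M N k"
  shows "linear_on R M N (\<lambda>x. h x \<oplus>\<^bsub>N\<^esub> k x)"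
proof -
  interpret n: module R N by fact
  note D = linear_onD[OF assms(2)] linear_onD[OF assms(3)]
  show ?thesis
    by (rule linear_onI) (simp_all add: D n.smult_r_distr n.M.add.m_ac)
qed

lemma linear_on_smult:
  assumes "module R N" and "linear_on R M N h" and "r \<in> carrier R"
  shows "linear_on R M N (\<lambda>x. r \<odot>\<^bsub>N\<^esub> h x)"
proof -
  interpret n: module R N by fact
  note D = linear_onD[OF assms(2)]
  have "r \<odot>\<^bsub>N\<^esub> (s \<odot>\<^bsub>N\<^esub> x) = s \<odot>\<^bsub>N\<^esub> (r \<odot>\<^bsub>N\<^esub> x)" if "s \<in> carrier R" "x \<in> carrier N" for s x
    using that assms(3) n.smult_assoc1[of r s x] n.smult_assoc1[of s r x] n.m_comm[of r s] by simp
  then show ?thesis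
    by (intro linear_onI) (simp_all add: D n.smult_r_distr assms(3))
qed

lemma linear_on_0:
  assumes "module R M" and "module R N" and "linear_on R M N h"
  shows "h \<zero>\<^bsub>M\<^esub> = \<zero>\<^bsub>N\<^esub>"
proof -
  interpret m: module R M by fact
  interpret n: module R N by fact
  have "h (\<zero>\<^bsub>R\<^esub> \<odot>\<^bsub>M\<^esub> \<zero>\<^bsub>M\<^esub>) = \<zero>\<^bsub>R\<^esub> \<odot>\<^bsub>N\<^esub> h \<zero>\<^bsub>M\<^esub>"
    by (rule linear_onD(3)[OF assms(3)]) simp_all
  then show ?thesis
    using linear_onD(1)[OF assms(3), of "\<zero>\<^bsub>M\<^esub>"] by simp
qed

lemma linear_on_minus:
  assumes "module R M" and "module R N" and "linear_on R M N h"
    and "x \<in> carrier M" and "y \<in> carrier M"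
  shows "h (x \<ominus>\<^bsub>M\<^esub> y) = h x \<ominus>\<^bsub>N\<^esub> h y"
proof -
  interpret m: module R M by fact
  interpret n: module R N by fact
  have neg: "\<ominus>\<^bsub>M\<^esub> y = (\<ominus>\<^bsub>R\<^esub> \<one>\<^bsub>R\<^esub>) \<odot>\<^bsub>M\<^esub> y" "\<ominus>\<^bsub>N\<^esub> h y = (\<ominus>\<^bsub>R\<^esub> \<one>\<^bsub>R\<^esub>) \<odot>\<^bsub>N\<^esub> h y"
    using assms(5) linear_onD(1)[OF assms(3,5)] by (simp_all add: m.smult_l_minus n.smult_l_minus)
  show ?thesis
    using assms(4,5) unfolding a_minus_def neg
    by (simp add: linear_onD[OF assms(3)])
qed

text \<open>Closure under negation comes for free, because scalars include \<open>-1\<close>.\<close>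

lemma submodule_intro:
  assumes "module R M" and "N \<subseteq> carrier M" and "\<zero>\<^bsub>M\<^esub> \<in> N"
    and "\<And>x y. \<lbrakk>x \<in> N; y \<in> N\<rbrakk> \<Longrightarrow> x \<oplus>\<^bsub>M\<^esub> y \<in> N"
    and "\<And>r x. \<lbrakk>r \<in> carrier R; x \<in> N\<rbrakk> \<Longrightarrow> r \<odot>\<^bsub>M\<^esub> x \<in> N"
  shows "submodule N R M"
proof -
  interpret m: module R M by fact
  have "\<ominus>\<^bsub>M\<^esub> x \<in> N" if "x \<in> N" for x
    using assms(5)[of "\<ominus>\<^bsub>R\<^esub> \<one>\<^bsub>R\<^esub>" x] that assms(2) by (auto simp: m.smult_l_minus)
  then show ?thesis
    using assms by (intro m.submoduleI) auto
qed

lemma submoduleD: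
  assumes "module R M" and "submodule N R M"
  shows "N \<subseteq> carrier M" and "\<zero>\<^bsub>M\<^esub> \<in> N"
    and "\<lbrakk>x \<in> N; y \<in> N\<rbrakk> \<Longrightarrow> x \<oplus>\<^bsub>M\<^esub> y \<in> N"
    and "\<lbrakk>r \<in> carrier R; x \<in> N\<rbrakk> \<Longrightarrow> r \<odot>\<^bsub>M\<^esub> x \<in> N"
    and "\<lbrakk>x \<in> N; y \<in> N\<rbrakk> \<Longrightarrow> x \<ominus>\<^bsub>M\<^esub> y \<in> N"
proof -
  interpret m: module R M by fact
  note e = m.submoduleE[OF assms(2)]
  show "N \<subseteq> carrier M" by (rule e)
  show "\<zero>\<^bsub>M\<^esub> \<in> N" using subgroup.one_closed[OF submodule.axioms(1)[OF assms(2)]] by simp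
  show "\<lbrakk>x \<in> N; y \<in> N\<rbrakk> \<Longrightarrow> x \<oplus>\<^bsub>M\<^esub> y \<in> N" by (rule e)
  show "\<lbrakk>r \<in> carrier R; x \<in> N\<rbrakk> \<Longrightarrow> r \<odot>\<^bsub>M\<^esub> x \<in> N" by (rule e)
  show "\<lbrakk>x \<in> N; y \<in> N\<rbrakk> \<Longrightarrow> x \<ominus>\<^bsub>M\<^esub> y \<in> N" unfolding a_minus_def by (intro e)
qed

lemma spans_closed: "\<lbrakk>spans R M G; g \<in> G\<rbrakk> \<Longrightarrow> g \<in> carrier M"
  unfolding spans_def by auto

lemma spans_minimal: "\<lbrakk>spans R M G; submodule N R M; G \<subseteq> N; x \<in> carrier M\<rbrakk> \<Longrightarrow> x \<in> N"
  unfolding spans_def by auto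

lemma spans_induct [consumes 3, case_names gen zero add smult]:
  assumes "module R M" and "spans R M G" and "x \<in> carrier M"
    and "\<And>g. g \<in> G \<Longrightarrow> P g" and "P \<zero>\<^bsub>M\<^esub>"
    and "\<And>x y. \<lbrakk>x \<in> carrier M; y \<in> carrier M; P x; P y\<rbrakk> \<Longrightarrow> P (x \<oplus>\<^bsub>M\<^esub> y)"
    and "\<And>r x. \<lbrakk>r \<in> carrier R; x \<in> carrier M; P x\<rbrakk> \<Longrightarrow> P (r \<odot>\<^bsub>M\<^esub> x)"
  shows "P x"
proof -
  interpret m: module R M by fact
  have "submodule {x \<in> carrier M. P x} R M"
    using assms(5-7) by (intro submodule_intro assms(1)) auto
  then show ?thesis
    using assms(2-4) unfolding spans_def by blast
qed

lemma linear_on_eq_on_spans: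
  assumes "module R M" and "module R N" and "spans R M G"
    and "linear_on R M N h" and "linear_on R M N k"
    and "\<And>g. g \<in> G \<Longrightarrow> h g = k g" and "x \<in> carrier M"
  shows "h x = k x"
  using assms(1,3,7)
  by (induction rule: spans_induct)
     (simp_all add: assms(6) linear_onD[OF assms(4)] linear_onD[OF assms(5)]
       linear_on_0[OF assms(1,2,4)] linear_on_0[OF assms(1,2,5)])

lemma gen_submodule_submodule:
  assumes "module R M" and "G \<subseteq> carrier M"
  shows "submodule (gen_submodule R M G) R M"
proof (rule submodule_intro[OF assms(1)])
  interpret m: module R M by fact
  show "gen_submodule R M G \<subseteq> carrier M"
    unfolding gen_submodule_def using m.carrier_is_submodule assms(2) by blast
qed (auto simp: gen_submodule_def submoduleD[OF assms(1)])

lemma gen_submodule_incl: "G \<subseteq> gen_submodule R M G"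
  unfolding gen_submodule_def by blast

lemma gen_submodule_minimal: "\<lbrakk>submodule N R M; G \<subseteq> N\<rbrakk> \<Longrightarrow> gen_submodule R M G \<subseteq> N"
  unfolding gen_submodule_def by blast

lemma linear_on_vimage:
  assumes "module R M" and "module R N" and "linear_on R M N h" and "submodule L R N"
  shows "submodule {x \<in> carrier M. h x \<in> L} R M"
proof -
  interpret m: module R M by fact
  show ?thesis
    by (rule submodule_intro[OF assms(1)])
       (auto simp: linear_onD[OF assms(3)] linear_on_0[OF assms(1-3)] submoduleD[OF assms(2,4)])
qed

lemma zero_submodule:
  assumes "module R M"
  shows "submodule {\<zero>\<^bsub>M\<^esub>} R M"
proof -
  interpret m: module R M by fact
  show ?thesis by (rule submodule_intro[OF assms]) auto
qed

subsection \<open>Quotients\<close>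

lemma submodule_abelian_subgroup:
  assumes "module R M" and "submodule N R M"
  shows "abelian_subgroup N M"
proof -
  interpret m: module R M by fact
  show ?thesis
    by (rule abelian_subgroupI3)
       (auto intro: additive_subgroupI submodule.axioms(1)[OF assms(2)] m.M.abelian_group_axioms)
qed

lemma coset_eq_iff:
  assumes "module R M" and "submodule N R M" and "x \<in> carrier M" and "y \<in> carrier M"
  shows "N +>\<^bsub>M\<^esub> x = N +>\<^bsub>M\<^esub> y \<longleftrightarrow> x \<ominus>\<^bsub>M\<^esub> y \<in> N"
proof -
  interpret m: module R M by fact
  interpret s: abelian_subgroup N M by (rule submodule_abelian_subgroup[OF assms(1,2)])
  show ?thesis
    using assms(3,4) s.a_rcos_module[OF assms(4,3)] s.a_repr_independence' s.a_repr_independenceD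
    unfolding a_minus_def by metis
qed

lemma quot_module_carrier: "carrier (quot_module M N) = (\<lambda>x. N +>\<^bsub>M\<^esub> x) ` carrier M"
  unfolding quot_module_def A_RCOSETS_def' by auto

lemma quot_module_zero: "\<zero>\<^bsub>quot_module M N\<^esub> = N"
  unfolding quot_module_def by simp

lemma quot_module_add:
  assumes "module R M" and "submodule N R M" and "x \<in> carrier M" and "y \<in> carrier M"
  shows "(N +>\<^bsub>M\<^esub> x) \<oplus>\<^bsub>quot_module M N\<^esub> (N +>\<^bsub>M\<^esub> y) = N +>\<^bsub>M\<^esub> (x \<oplus>\<^bsub>M\<^esub> y)"
proof -
  interpret s: abelian_subgroup N M by (rule submodule_abelian_subgroup[OF assms(1,2)])
  show ?thesis
    unfolding quot_module_def using s.a_rcos_sum[OF assms(3,4)] by simp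
qed

lemma quot_module_smult:
  assumes "module R M" and "submodule N R M" and "r \<in> carrier R" and "x \<in> carrier M"
  shows "r \<odot>\<^bsub>quot_module M N\<^esub> (N +>\<^bsub>M\<^esub> x) = N +>\<^bsub>M\<^esub> (r \<odot>\<^bsub>M\<^esub> x)"
proof -
  interpret m: module R M by fact
  interpret s: abelian_subgroup N M by (rule submodule_abelian_subgroup[OF assms(1,2)])
  have self: "x \<in> N +>\<^bsub>M\<^esub> x" using s.a_rcos_self assms(4) by blast
  have "N +>\<^bsub>M\<^esub> (r \<odot>\<^bsub>M\<^esub> y) = N +>\<^bsub>M\<^esub> (r \<odot>\<^bsub>M\<^esub> x)" if y: "y \<in> N +>\<^bsub>M\<^esub> x" for y
  proof -
    have yM: "y \<in> carrier M"
      using y assms(4) s.a_elemrcos_carrier by blast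
    have "y \<ominus>\<^bsub>M\<^esub> x \<in> N"
      using coset_eq_iff[OF assms(1,2) yM assms(4)] s.a_repr_independence'[OF y assms(4)] by simp
    then have "r \<odot>\<^bsub>M\<^esub> (y \<ominus>\<^bsub>M\<^esub> x) \<in> N"
      using submoduleD(4)[OF assms(1,2,3)] by blast
    then have "r \<odot>\<^bsub>M\<^esub> y \<ominus>\<^bsub>M\<^esub> r \<odot>\<^bsub>M\<^esub> x \<in> N"
      using assms(3,4) yM by (simp add: a_minus_def m.smult_r_distr m.smult_r_minus)
    then show ?thesis
      using coset_eq_iff[OF assms(1,2)] assms(3,4) yM by simp
  qed
  then have all: "\<forall>y\<in>N +>\<^bsub>M\<^esub> x. N +>\<^bsub>M\<^esub> (r \<odot>\<^bsub>M\<^esub> y) = N +>\<^bsub>M\<^esub> (r \<odot>\<^bsub>M\<^esub> x)"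
    by blast
  have "(\<Union>y\<in>N +>\<^bsub>M\<^esub> x. N +>\<^bsub>M\<^esub> (r \<odot>\<^bsub>M\<^esub> y)) = N +>\<^bsub>M\<^esub> (r \<odot>\<^bsub>M\<^esub> x)"
    using self all by blast
  then show ?thesis
    unfolding quot_module_def by simp
qed

lemma quot_module_module:
  assumes "module R M" and "submodule N R M"
  shows "module R (quot_module M N)"
proof -
  interpret m: module R M by fact
  have 0: "N = N +>\<^bsub>M\<^esub> \<zero>\<^bsub>M\<^esub>"
    using submoduleD(1)[OF assms] by simp
  note qa = quot_module_add[OF assms] and qs = quot_module_smult[OF assms]
  let ?Q = "quot_module M N"
  have z: "\<zero>\<^bsub>?Q\<^esub> = N +>\<^bsub>M\<^esub> \<zero>\<^bsub>M\<^esub>" unfolding quot_module_zero by (rule 0)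
  show ?thesis
  proof (rule moduleI)
    show "cring R" ..
    show "abelian_group ?Q"
    proof (rule abelian_groupI, unfold quot_module_carrier z)
      show "\<exists>y\<in>(+>\<^bsub>M\<^esub>) N ` carrier M. y \<oplus>\<^bsub>?Q\<^esub> x = N +>\<^bsub>M\<^esub> \<zero>\<^bsub>M\<^esub>"
        if "x \<in> (+>\<^bsub>M\<^esub>) N ` carrier M" for x
      proof -
        from that obtain x' where x': "x' \<in> carrier M" "x = N +>\<^bsub>M\<^esub> x'" by blast
        then show ?thesis
          by (intro bexI[of _ "N +>\<^bsub>M\<^esub> (\<ominus>\<^bsub>M\<^esub> x')"]) (simp_all add: qa m.M.l_neg del: m.M.a_coset_add_zero)
      qed
    next
      show "N +>\<^bsub>M\<^esub> \<zero>\<^bsub>M\<^esub> \<in> (+>\<^bsub>M\<^esub>) N ` carrier M" by blast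
    next
      fix x assume "x \<in> (+>\<^bsub>M\<^esub>) N ` carrier M"
      then show "(N +>\<^bsub>M\<^esub> \<zero>\<^bsub>M\<^esub>) \<oplus>\<^bsub>?Q\<^esub> x = x"
        by (auto simp: qa simp del: m.M.a_coset_add_zero)
    qed (auto simp: qa m.M.add.m_ac)
  qed (auto simp: quot_module_carrier qa qs m.smult_l_distr m.smult_r_distr m.smult_assoc1)
qed

lemma quot_proj_linear:
  assumes "module R M" and "submodule N R M"
  shows "linear_on R M (quot_module M N) (\<lambda>x. N +>\<^bsub>M\<^esub> x)"
  by (rule linear_onI)
     (auto simp: quot_module_carrier quot_module_add[OF assms] quot_module_smult[OF assms])

lemma quot_proj_spans:
  assumes "module R M" and "submodule N R M" and "spans R M G"
  shows "spans R (quot_module M N) ((\<lambda>x. N +>\<^bsub>M\<^esub> x) ` G)"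
  unfolding spans_def
proof (intro conjI allI impI)
  show "(+>\<^bsub>M\<^esub>) N ` G \<subseteq> carrier (quot_module M N)"
    using spans_closed[OF assms(3)] by (auto simp: quot_module_carrier)
  fix L assume L: "submodule L R (quot_module M N) \<and> (+>\<^bsub>M\<^esub>) N ` G \<subseteq> L"
  have "submodule {x \<in> carrier M. N +>\<^bsub>M\<^esub> x \<in> L} R M"
    using L quot_module_module[OF assms(1,2)] quot_proj_linear[OF assms(1,2)]
    by (intro linear_on_vimage[OF assms(1)]) auto
  then show "carrier (quot_module M N) \<subseteq> L"
    using assms(3) L unfolding spans_def quot_module_carrier by blast
qed

text \<open>A linear map on \<open>M\<close> that kills a set \<open>G\<close> of relations factors through the quotient of \<open>M\<close> by
  the submodule that \<open>G\<close> generates.\<close>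

lemma quot_gen_lift:
  assumes "module R M" and "module R P" and "G \<subseteq> carrier M" and "linear_on R M P h"
    and "\<And>g. g \<in> G \<Longrightarrow> h g = \<zero>\<^bsub>P\<^esub>"
  shows "\<exists>h'. linear_on R (quot_module M (gen_submodule R M G)) P h' \<and>
           (\<forall>x\<in>carrier M. h' (gen_submodule R M G +>\<^bsub>M\<^esub> x) = h x)"
proof -
  interpret m: module R M by fact
  interpret p: module R P by fact
  let ?N = "gen_submodule R M G"
  note sub = gen_submodule_submodule[OF assms(1,3)]
  have "submodule {x \<in> carrier M. h x \<in> {\<zero>\<^bsub>P\<^esub>}} R M"
    by (rule linear_on_vimage[OF assms(1,2,4) zero_submodule[OF assms(2)]])
  then have ker: "?N \<subseteq> {x \<in> carrier M. h x \<in> {\<zero>\<^bsub>P\<^esub>}}"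
    by (rule gen_submodule_minimal) (use assms(3,5) in auto)
  have eq: "h x = h y" if "x \<in> carrier M" "y \<in> carrier M" "?N +>\<^bsub>M\<^esub> x = ?N +>\<^bsub>M\<^esub> y" for x y
  proof -
    have "h (x \<ominus>\<^bsub>M\<^esub> y) = \<zero>\<^bsub>P\<^esub>"
      using ker coset_eq_iff[OF assms(1) sub] that by blast
    then have "h x \<ominus>\<^bsub>P\<^esub> h y = \<zero>\<^bsub>P\<^esub>"
      using that linear_on_minus[OF assms(1,2,4)] by simp
    then show ?thesis
      using that linear_onD(1)[OF assms(4)] p.M.add.inv_equality[of "h x" "\<ominus>\<^bsub>P\<^esub> h y"]
      by (simp add: a_minus_def)
  qed
  \<comment> \<open>\<open>h'\<close> evaluates \<open>h\<close> on a representative; \<open>eq\<close> makes the choice irrelevant.\<close>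
  define h' where "h' C = h (SOME x. x \<in> carrier M \<and> ?N +>\<^bsub>M\<^esub> x = C)" for C
  have h': "h' (?N +>\<^bsub>M\<^esub> x) = h x" if "x \<in> carrier M" for x
    unfolding h'_def
  proof (rule someI2[of _ x])
    show "x \<in> carrier M \<and> ?N +>\<^bsub>M\<^esub> x = ?N +>\<^bsub>M\<^esub> x" using that by simp
    show "h y = h x" if "y \<in> carrier M \<and> ?N +>\<^bsub>M\<^esub> y = ?N +>\<^bsub>M\<^esub> x" for y
      using that \<open>x \<in> carrier M\<close> eq by blast
  qed
  have "linear_on R (quot_module M ?N) P h'"
    by (rule linear_onI)
       (auto simp: quot_module_carrier quot_module_add[OF assms(1) sub]
         quot_module_smult[OF assms(1) sub] h' linear_onD[OF assms(4)])
  with h' show ?thesis by blast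
qed

lemma quot_gen_rel:
  assumes "module R M" and "G \<subseteq> carrier M" and "g \<in> G"
  shows "gen_submodule R M G +>\<^bsub>M\<^esub> g = \<zero>\<^bsub>quot_module M (gen_submodule R M G)\<^esub>"
proof -
  interpret m: module R M by fact
  interpret s: abelian_subgroup "gen_submodule R M G" M
    by (rule submodule_abelian_subgroup[OF assms(1) gen_submodule_submodule[OF assms(1,2)]])
  show ?thesis
    using assms(3) gen_submodule_incl[of G R M] unfolding quot_module_zero
    by (intro s.a_rcos_const) blast
qed

subsection \<open>Free modules\<close>

lemma free_module_module:
  fixes R :: "('r, 'x) ring_scheme" and S :: "'s set"
  assumes "cring R"
  shows "module R (free_module R S)"
proof -
  interpret cring R by fact
  have fin: "finite {s. f s \<oplus>\<^bsub>R\<^esub> g s \<noteq> \<zero>\<^bsub>R\<^esub>}"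
    if "finite {s. f s \<noteq> \<zero>\<^bsub>R\<^esub>}" "finite {s. g s \<noteq> \<zero>\<^bsub>R\<^esub>}" for f g :: "'s \<Rightarrow> 'r"
    by (rule finite_subset[OF _ finite_UnI[OF that]]) auto
  have fin': "finite {s. r \<otimes>\<^bsub>R\<^esub> f s \<noteq> \<zero>\<^bsub>R\<^esub>}"
    if "r \<in> carrier R" "finite {s. f s \<noteq> \<zero>\<^bsub>R\<^esub>}" for r and f :: "'s \<Rightarrow> 'r"
    by (rule finite_subset[OF _ that(2)]) (use that(1) in auto)
  show ?thesis
  proof (rule moduleI)
    show "abelian_group (free_module R S)"
    proof (rule abelian_groupI)
      fix f assume f: "f \<in> carrier (free_module R S)"
      have "{s. \<ominus>\<^bsub>R\<^esub> f s \<noteq> \<zero>\<^bsub>R\<^esub>} \<subseteq> {s. f s \<noteq> \<zero>\<^bsub>R\<^esub>}" by auto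
      then have "(\<lambda>s. \<ominus>\<^bsub>R\<^esub> f s) \<in> carrier (free_module R S)"
        using f by (auto simp: free_module_def intro: finite_subset)
      then show "\<exists>g\<in>carrier (free_module R S). g \<oplus>\<^bsub>free_module R S\<^esub> f = \<zero>\<^bsub>free_module R S\<^esub>"
        by (rule bexI[rotated]) (use f in \<open>auto simp: free_module_def l_neg\<close>)
    qed (auto simp: free_module_def fin add.m_ac intro!: ext)
  qed (auto simp: free_module_def fin' assms l_distr r_distr m_assoc intro!: ext)
qed

lemma free_gen_closed: "\<lbrakk>cring R; s \<in> S\<rbrakk> \<Longrightarrow> free_gen R s \<in> carrier (free_module R S)"
  unfolding free_gen_def free_module_def
  using finite_subset[of _ "{s}"] by (auto simp: cring.cring_simprules)

lemma free_gen_spans: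
  assumes "cring R"
  shows "spans R (free_module R S) (free_gen R ` S)"
  unfolding spans_def
proof (intro conjI allI impI)
  interpret cring R by fact
  show "free_gen R ` S \<subseteq> carrier (free_module R S)"
    using free_gen_closed[OF assms] by auto
  fix N assume N: "submodule N R (free_module R S) \<and> free_gen R ` S \<subseteq> N"
  note sD = submoduleD[OF free_module_module[OF assms], of N]
  have "f \<in> N" if "finite A" "f \<in> carrier (free_module R S)" "{s. f s \<noteq> \<zero>\<^bsub>R\<^esub>} \<subseteq> A" for A f
    using that
  proof (induction A arbitrary: f rule: finite_induct)
    case empty
    then have "f = \<zero>\<^bsub>free_module R S\<^esub>" by (auto simp: free_module_def)
    then show ?case using sD(2) N by simp
  next
    case (insert a A)
    show ?case
    proof (cases "a \<in> S")
      case False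
      then have "f a = \<zero>\<^bsub>R\<^esub>" using insert.prems by (auto simp: free_module_def)
      then show ?thesis using insert by blast
    next
      case True
      have fc: "\<And>s. f s \<in> carrier R" "\<And>s. s \<notin> S \<Longrightarrow> f s = \<zero>\<^bsub>R\<^esub>" "finite {s. f s \<noteq> \<zero>\<^bsub>R\<^esub>}"
        using insert.prems by (auto simp: free_module_def)
      define g where "g = f(a := \<zero>\<^bsub>R\<^esub>)"
      have "{s. g s \<noteq> \<zero>\<^bsub>R\<^esub>} \<subseteq> {s. f s \<noteq> \<zero>\<^bsub>R\<^esub>}" by (auto simp: g_def)
      then have "g \<in> carrier (free_module R S)"
        using fc by (auto simp: free_module_def g_def intro: finite_subset)
      moreover have "{s. g s \<noteq> \<zero>\<^bsub>R\<^esub>} \<subseteq> A" using insert.prems by (auto simp: g_def)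
      ultimately have "g \<in> N" using insert.IH by blast
      moreover have "f a \<odot>\<^bsub>free_module R S\<^esub> free_gen R a \<in> N"
        using N True fc(1) sD(4) by blast
      moreover have "f = g \<oplus>\<^bsub>free_module R S\<^esub> f a \<odot>\<^bsub>free_module R S\<^esub> free_gen R a"
        using fc by (auto simp: free_module_def g_def free_gen_def intro!: ext)
      ultimately show ?thesis using N sD(3) by metis
    qed
  qed
  then show "carrier (free_module R S) \<subseteq> N" by (auto simp: free_module_def)
qed

lemma free_module_lift:
  fixes R :: "('r, 'x) ring_scheme" and S :: "'s set"
  assumes "module R P" and "\<And>s. s \<in> S \<Longrightarrow> f s \<in> carrier P"
  shows "\<exists>h. linear_on R (free_module R S) P h \<and> (\<forall>s\<in>S. h (free_gen R s) = f s)"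
proof -
  interpret p: module R P by fact
  let ?F = "free_module R S"
  define T where "T x = {s. x s \<noteq> \<zero>\<^bsub>R\<^esub>}" for x :: "'s \<Rightarrow> 'r"
  define h where "h x = finsum P (\<lambda>s. x s \<odot>\<^bsub>P\<^esub> f s) (T x)" for x
  have F: "x s \<in> carrier R" "x s \<noteq> \<zero>\<^bsub>R\<^esub> \<Longrightarrow> s \<in> S" "finite (T x)" if "x \<in> carrier ?F" for x s
    using that by (auto simp: free_module_def T_def)
  have tm: "x s \<odot>\<^bsub>P\<^esub> f s \<in> carrier P" if "x \<in> carrier ?F" "s \<in> S" for x s
    using F[OF that(1)] that(2) assms(2) by auto
  have h_super: "h x = finsum P (\<lambda>s. x s \<odot>\<^bsub>P\<^esub> f s) A"
    if "x \<in> carrier ?F" "finite A" "T x \<subseteq> A" "A \<subseteq> S" for x A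
    unfolding h_def
    by (rule p.M.add.finprod_mono_neutral_cong_left)
       (use that tm F assms(2) in \<open>auto simp: T_def subset_iff\<close>)
  have TS: "T x \<subseteq> S" if "x \<in> carrier ?F" for x
    using F[OF that] by (auto simp: T_def)
  have "linear_on R ?F P h"
  proof (rule linear_onI)
    fix x assume x: "x \<in> carrier ?F"
    show "h x \<in> carrier P"
      unfolding h_def using tm[OF x] TS[OF x] by (intro p.M.finsum_closed) auto
    fix r assume r: "r \<in> carrier R"
    have rx: "r \<odot>\<^bsub>?F\<^esub> x \<in> carrier ?F"
      using module.smult_closed[OF free_module_module[OF p.R.is_cring] r x] .
    have "h (r \<odot>\<^bsub>?F\<^esub> x) = finsum P (\<lambda>s. (r \<odot>\<^bsub>?F\<^esub> x) s \<odot>\<^bsub>P\<^esub> f s) (T x)"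
      by (rule h_super[OF rx]) (use F[OF x] TS[OF x] r in \<open>auto simp: T_def free_module_def\<close>)
    also have "\<dots> = finsum P (\<lambda>s. r \<odot>\<^bsub>P\<^esub> (x s \<odot>\<^bsub>P\<^esub> f s)) (T x)"
      using F[OF x] TS[OF x] r assms(2) tm[OF x]
      by (intro p.M.finsum_cong') (auto simp: free_module_def p.smult_assoc1)
    also have "\<dots> = r \<odot>\<^bsub>P\<^esub> h x"
      unfolding h_def using F[OF x] TS[OF x] r tm[OF x]
      by (intro p.finsum_smult_ldistr[symmetric]) auto
    finally show "h (r \<odot>\<^bsub>?F\<^esub> x) = r \<odot>\<^bsub>P\<^esub> h x" .
  next
    fix x y assume x: "x \<in> carrier ?F" and y: "y \<in> carrier ?F"
    interpret fm: module R ?F by (rule free_module_module[OF p.R.is_cring])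
    have xy: "x \<oplus>\<^bsub>?F\<^esub> y \<in> carrier ?F" using x y by simp
    have "h (x \<oplus>\<^bsub>?F\<^esub> y) = finsum P (\<lambda>s. (x \<oplus>\<^bsub>?F\<^esub> y) s \<odot>\<^bsub>P\<^esub> f s) (T x \<union> T y)"
      by (rule h_super[OF xy]) (use F[OF x] F[OF y] TS[OF x] TS[OF y] in \<open>auto simp: T_def free_module_def\<close>)
    also have "\<dots> = finsum P (\<lambda>s. x s \<odot>\<^bsub>P\<^esub> f s \<oplus>\<^bsub>P\<^esub> y s \<odot>\<^bsub>P\<^esub> f s) (T x \<union> T y)"
      using F[OF x] F[OF y] TS[OF x] TS[OF y] assms(2) tm[OF x] tm[OF y]
      by (intro p.M.finsum_cong') (auto simp: free_module_def p.smult_l_distr)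
    also have "\<dots> = finsum P (\<lambda>s. x s \<odot>\<^bsub>P\<^esub> f s) (T x \<union> T y) \<oplus>\<^bsub>P\<^esub> finsum P (\<lambda>s. y s \<odot>\<^bsub>P\<^esub> f s) (T x \<union> T y)"
      using F[OF x] F[OF y] TS[OF x] TS[OF y] tm[OF x] tm[OF y]
      by (intro p.M.finsum_addf) auto
    also have "\<dots> = h x \<oplus>\<^bsub>P\<^esub> h y"
      using h_super[OF x, of "T x \<union> T y"] h_super[OF y, of "T x \<union> T y"]
        F(3)[OF x] F(3)[OF y] TS[OF x] TS[OF y] by simp
    finally show "h (x \<oplus>\<^bsub>?F\<^esub> y) = h x \<oplus>\<^bsub>P\<^esub> h y" .
  qed
  moreover have "h (free_gen R s) = f s" if s: "s \<in> S" for s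
  proof -
    have "h (free_gen R s) = finsum P (\<lambda>t. free_gen R s t \<odot>\<^bsub>P\<^esub> f t) {s}"
      by (rule h_super[OF free_gen_closed[OF p.R.is_cring s]])
         (use s in \<open>auto simp: T_def free_gen_def split: if_splits\<close>)
    also have "\<dots> = f s"
      using s assms(2) by (simp add: free_gen_def)
    finally show ?thesis .
  qed
  ultimately show ?thesis by blast
qed

subsection \<open>Bilinear maps\<close>

text \<open>A function of two arguments that are generators extends to a bilinear map as soon as it
  extends to a linear map in each argument separately.\<close>

lemma bilinear_lift:
  assumes "module R M" and "module R N" and "module R P"
    and M: "spans R M (u ` S)" and N: "spans R N (v ` T)"
    and left: "\<And>t. t \<in> T \<Longrightarrow> \<exists>h. linear_on R M P h \<and> (\<forall>s\<in>S. h (u s) = f s t)"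
    and right: "\<And>s. s \<in> S \<Longrightarrow> \<exists>h. linear_on R N P h \<and> (\<forall>t\<in>T. h (v t) = f s t)"
  shows "\<exists>!p. p \<in> bilinear_maps R M N P \<and> (\<forall>s\<in>S. \<forall>t\<in>T. p (u s) (v t) = f s t)"
proof -
  interpret m: module R M by fact
  interpret n: module R N by fact
  interpret p: module R P by fact
  obtain L where L: "\<And>t. t \<in> T \<Longrightarrow> linear_on R M P (L t)"
    and Lu: "\<And>t s. \<lbrakk>t \<in> T; s \<in> S\<rbrakk> \<Longrightarrow> L t (u s) = f s t"
    using bchoice[of T "\<lambda>t h. linear_on R M P h \<and> (\<forall>s\<in>S. h (u s) = f s t)"] left by blast
  \<comment> \<open>The functions \<open>T \<rightarrow> P\<close> that extend linearly to \<open>N\<close> are closed under linear combinations, so it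
    suffices to extend \<open>t \<mapsto> L t x\<close> for \<open>x\<close> a generator of \<open>M\<close>.\<close>
  have ex: "\<exists>h. linear_on R N P h \<and> (\<forall>t\<in>T. h (v t) = L t x)" if "x \<in> carrier M" for x
    using assms(1) M that
  proof (induction rule: spans_induct)
    case (gen g)
    then show ?case using right Lu by fastforce
  next
    case zero
    show ?case
      by (rule exI[of _ "\<lambda>_. \<zero>\<^bsub>P\<^esub>"])
         (simp add: linear_on_zero_map[OF assms(3)] linear_on_0[OF assms(1,3) L])
  next
    case (add x y)
    then obtain h k where hk: "linear_on R N P h" "\<forall>t\<in>T. h (v t) = L t x"
      "linear_on R N P k" "\<forall>t\<in>T. k (v t) = L t y" by blast
    then have "linear_on R N P (\<lambda>z. h z \<oplus>\<^bsub>P\<^esub> k z)"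
      by (intro linear_on_add[OF assms(3)])
    moreover have "\<forall>t\<in>T. h (v t) \<oplus>\<^bsub>P\<^esub> k (v t) = L t (x \<oplus>\<^bsub>M\<^esub> y)"
      using hk(2,4) add.hyps by (simp add: linear_onD(2)[OF L])
    ultimately show ?case by blast
  next
    case (smult r x)
    then obtain h where h: "linear_on R N P h" "\<forall>t\<in>T. h (v t) = L t x" by blast
    then have "linear_on R N P (\<lambda>z. r \<odot>\<^bsub>P\<^esub> h z)"
      using smult.hyps(1) by (intro linear_on_smult[OF assms(3)])
    moreover have "\<forall>t\<in>T. r \<odot>\<^bsub>P\<^esub> h (v t) = L t (r \<odot>\<^bsub>M\<^esub> x)"
      using h(2) smult.hyps by (simp add: linear_onD(3)[OF L])
    ultimately show ?case by blast
  qed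
  obtain Q where Q: "\<And>x. x \<in> carrier M \<Longrightarrow> linear_on R N P (Q x)"
    and Qv: "\<And>x t. \<lbrakk>x \<in> carrier M; t \<in> T\<rbrakk> \<Longrightarrow> Q x (v t) = L t x"
    using bchoice[of "carrier M" "\<lambda>x h. linear_on R N P h \<and> (\<forall>t\<in>T. h (v t) = L t x)"] ex by blast
  have vN: "\<And>t. t \<in> T \<Longrightarrow> v t \<in> carrier N" using spans_closed[OF N] by blast
  have uM: "\<And>s. s \<in> S \<Longrightarrow> u s \<in> carrier M" using spans_closed[OF M] by blast
  have Q1: "linear_on R M P (\<lambda>x. Q x y)" if y: "y \<in> carrier N" for y
  proof (rule linear_onI)
    fix x x' assume x: "x \<in> carrier M" "x' \<in> carrier M"
    have lin: "linear_on R N P (\<lambda>z. Q x z \<oplus>\<^bsub>P\<^esub> Q x' z)"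
      using Q[OF x(1)] Q[OF x(2)] by (rule linear_on_add[OF assms(3)])
    show "Q (x \<oplus>\<^bsub>M\<^esub> x') y = Q x y \<oplus>\<^bsub>P\<^esub> Q x' y"
      by (rule linear_on_eq_on_spans[OF assms(2,3) N Q lin _ y])
         (use x in \<open>auto simp: Qv linear_onD(2,3)[OF L]\<close>)
  next
    fix r x assume x: "r \<in> carrier R" "x \<in> carrier M"
    have lin: "linear_on R N P (\<lambda>z. r \<odot>\<^bsub>P\<^esub> Q x z)"
      using Q[OF x(2)] x(1) by (rule linear_on_smult[OF assms(3)])
    show "Q (r \<odot>\<^bsub>M\<^esub> x) y = r \<odot>\<^bsub>P\<^esub> Q x y"
      by (rule linear_on_eq_on_spans[OF assms(2,3) N Q lin _ y])
         (use x in \<open>auto simp: Qv linear_onD(2,3)[OF L]\<close>)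
  qed (use linear_onD(1)[OF Q] y in blast)
  define q where "q = (\<lambda>x\<in>carrier M. \<lambda>y\<in>carrier N. Q x y)"
  have q: "q \<in> bilinear_maps R M N P"
  proof -
    have "(\<lambda>x\<in>carrier M. q x y) = (\<lambda>x\<in>carrier M. Q x y)" if "y \<in> carrier N" for y
      using that unfolding q_def by (intro restrict_ext) simp
    then have "(\<lambda>x\<in>carrier M. q x y) \<in> linear_maps R M P" if "y \<in> carrier N" for y
      using linear_on_restrict[OF assms(1) Q1[OF that]] that by metis
    moreover have "q x \<in> linear_maps R N P" if "x \<in> carrier M" for x
      using linear_on_restrict[OF assms(2) Q[OF that]] that unfolding q_def by simp
    moreover have "q \<in> carrier M \<rightarrow>\<^sub>E carrier N \<rightarrow>\<^sub>E carrier P"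
      unfolding q_def using linear_onD(1)[OF Q] by (intro restrict_PiE_iff[THEN iffD2] ballI) simp
    ultimately show ?thesis
      unfolding bilinear_maps_def by blast
  qed
  show ?thesis
  proof (rule ex1I[of _ q])
    show "q \<in> bilinear_maps R M N P \<and> (\<forall>s\<in>S. \<forall>t\<in>T. q (u s) (v t) = f s t)"
      using q by (simp add: q_def uM vN Qv Lu)
    fix p assume p: "p \<in> bilinear_maps R M N P \<and> (\<forall>s\<in>S. \<forall>t\<in>T. p (u s) (v t) = f s t)"
    have plin: "\<And>x. x \<in> carrier M \<Longrightarrow> linear_on R N P (p x)"
      "\<And>y. y \<in> carrier N \<Longrightarrow> linear_on R M P (\<lambda>x\<in>carrier M. p x y)"
      using p unfolding bilinear_maps_def linear_maps_iff by auto
    have 1: "p (u s) y = Q (u s) y" if "s \<in> S" "y \<in> carrier N" for s y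
    proof (rule linear_on_eq_on_spans[OF assms(2,3) N plin(1)[OF uM] Q[OF uM] _ that(2)])
      fix g assume "g \<in> v ` T"
      then obtain t where t: "t \<in> T" "g = v t" by blast
      then show "p (u s) g = Q (u s) g"
        using that(1) p by (simp add: uM Qv Lu)
    qed (rule that(1))+
    have 2: "p x y = Q x y" if "x \<in> carrier M" "y \<in> carrier N" for x y
    proof -
      have "(\<lambda>x\<in>carrier M. p x y) x = Q x y"
      proof (rule linear_on_eq_on_spans[OF assms(1,3) M plin(2)[OF that(2)] Q1[OF that(2)] _ that(1)])
        fix g assume "g \<in> u ` S"
        then show "(\<lambda>x\<in>carrier M. p x y) g = Q g y"
          using 1[OF _ that(2)] uM by auto
      qed
      then show ?thesis using that by simp
    qed
    have pe: "p \<in> carrier M \<rightarrow>\<^sub>E carrier N \<rightarrow>\<^sub>E carrier P"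
      and qe: "q \<in> carrier M \<rightarrow>\<^sub>E carrier N \<rightarrow>\<^sub>E carrier P"
      using p q unfolding bilinear_maps_def by blast+
    show "p = q"
    proof (rule PiE_ext[OF pe qe])
      fix x assume x: "x \<in> carrier M"
      show "p x = q x"
        by (rule PiE_ext[OF PiE_mem[OF pe x] PiE_mem[OF qe x]]) (simp add: 2 x q_def)
    qed
  qed
qed

lemma bilinear_mapsD:
  assumes "module R M" and "p \<in> bilinear_maps R M N P"
  shows "x \<in> carrier M \<Longrightarrow> linear_on R N P (p x)"
    and "y \<in> carrier N \<Longrightarrow> linear_on R M P (\<lambda>x. p x y)"
proof -
  show "x \<in> carrier M \<Longrightarrow> linear_on R N P (p x)"
    using assms(2) unfolding bilinear_maps_def linear_maps_iff by auto
  assume "y \<in> carrier N"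
  then have "linear_on R M P (\<lambda>x\<in>carrier M. p x y)"
    using assms(2) unfolding bilinear_maps_def linear_maps_iff by auto
  then show "linear_on R M P (\<lambda>x. p x y)"
    by (rule linear_on_cong[OF assms(1)]) simp
qed

section \<open>Tensor products\<close>

lemma tuples_iff:
  "xs \<in> tuples Ms \<longleftrightarrow> length xs = length Ms \<and> (\<forall>i<length Ms. xs ! i \<in> carrier (Ms ! i))"
proof (induction Ms arbitrary: xs)
  case Nil
  then show ?case by (simp add: tuples_def)
next
  case (Cons M Ms)
  have "xs \<in> tuples (M # Ms) \<longleftrightarrow> (\<exists>y ys. xs = y # ys \<and> y \<in> carrier M \<and> ys \<in> tuples Ms)"
    by (simp add: tuples_def set_Cons_def)
  also have "\<dots> \<longleftrightarrow> length xs = length (M # Ms) \<and> (\<forall>i<length (M # Ms). xs ! i \<in> carrier ((M # Ms) ! i))"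
    unfolding Cons.IH by (cases xs) (auto simp: nth_Cons less_Suc_eq_0_disj split: nat.splits)
  finally show ?case .
qed

lemma tuples_update:
  "\<lbrakk>xs \<in> tuples Ms; i < length Ms \<Longrightarrow> x \<in> carrier (Ms ! i)\<rbrakk> \<Longrightarrow> xs[i := x] \<in> tuples Ms"
  unfolding tuples_iff by (cases "i < length Ms") (auto simp: nth_list_update)

lemma tuples_replicate: "xs \<in> tuples (replicate n M) \<longleftrightarrow> length xs = n \<and> set xs \<subseteq> carrier M"
  unfolding tuples_iff by (auto simp: set_conv_nth subset_iff)

text \<open>Multilinearity is linearity in each argument while the others are kept fixed.\<close>

definition multilinear ::
  "('r, 'x) ring_scheme \<Rightarrow> ('r, 'm) module list \<Rightarrow> ('r, 'p) module \<Rightarrow> ('m list \<Rightarrow> 'p) \<Rightarrow> bool" where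
  "multilinear R Ms P f \<longleftrightarrow>
     (\<forall>xs\<in>tuples Ms. f xs \<in> carrier P \<and>
       (\<forall>i<length Ms. linear_on R (Ms ! i) P (\<lambda>x. f (xs[i := x]))))"

lemma multilinearD:
  assumes "multilinear R Ms P f" and "xs \<in> tuples Ms"
  shows "f xs \<in> carrier P" and "i < length Ms \<Longrightarrow> linear_on R (Ms ! i) P (\<lambda>x. f (xs[i := x]))"
  using assms unfolding multilinear_def by auto

lemma multilinear_comp:
  assumes "multilinear R Ms P f" and "linear_on R P Q h"
  shows "multilinear R Ms Q (\<lambda>xs. h (f xs))"
  unfolding multilinear_def
proof (intro ballI conjI allI impI)
  fix xs assume xs: "xs \<in> tuples Ms"
  show "h (f xs) \<in> carrier Q" by (rule linear_onD(1)[OF assms(2) multilinearD(1)[OF assms(1) xs]])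
  fix i assume "i < length Ms"
  then show "linear_on R (Ms ! i) Q (\<lambda>x. h (f (xs[i := x])))"
    by (rule linear_on_comp[OF multilinearD(2)[OF assms(1) xs] assms(2)])
qed

text \<open>A multilinear map takes its values in \<open>L\<close> if it does so on tuples of generators. Arguments are
  freed from being generators one position at a time.\<close>

lemma multilinear_in_submodule:
  assumes mods: "\<And>i. i < length Ms \<Longrightarrow> module R (Ms ! i)" and P: "module R P"
    and f: "multilinear R Ms P f"
    and G: "\<And>i. i < length Ms \<Longrightarrow> spans R (Ms ! i) (G i)" and L: "submodule L R P"
    and gen: "\<And>xs. \<lbrakk>length xs = length Ms; \<And>i. i < length Ms \<Longrightarrow> xs ! i \<in> G i\<rbrakk> \<Longrightarrow> f xs \<in> L"
    and xs: "xs \<in> tuples Ms"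
  shows "f xs \<in> L"
proof -
  \<comment> \<open>The first \<open>k\<close> arguments are arbitrary, the remaining ones are generators.\<close>
  have "f xs \<in> L" if "k \<le> length Ms" "xs \<in> tuples Ms" "\<And>i. \<lbrakk>k \<le> i; i < length Ms\<rbrakk> \<Longrightarrow> xs ! i \<in> G i"
    for k xs
    using that
  proof (induction k arbitrary: xs)
    case 0
    then show ?case using gen by (simp add: tuples_iff)
  next
    case (Suc k)
    have k: "k < length Ms" using Suc.prems(1) by simp
    have "submodule {x \<in> carrier (Ms ! k). f (xs[k := x]) \<in> L} R (Ms ! k)"
      by (rule linear_on_vimage[OF mods[OF k] P multilinearD(2)[OF f Suc.prems(2) k] L])
    moreover have "f (xs[k := g]) \<in> L" if g: "g \<in> G k" for g
    proof (rule Suc.IH)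
      show "xs[k := g] \<in> tuples Ms"
        by (rule tuples_update[OF Suc.prems(2) spans_closed[OF G[OF k] g]])
      show "xs[k := g] ! i \<in> G i" if "k \<le> i" "i < length Ms" for i
        using that g Suc.prems k by (cases "i = k") (auto simp: tuples_iff nth_list_update)
    qed (use k in simp)
    ultimately have "carrier (Ms ! k) \<subseteq> {x \<in> carrier (Ms ! k). f (xs[k := x]) \<in> L}"
      using G[OF k] unfolding spans_def by blast
    moreover have "xs ! k \<in> carrier (Ms ! k)" using Suc.prems(2) k by (simp add: tuples_iff)
    ultimately have "f (xs[k := xs ! k]) \<in> L" by blast
    then show ?case by simp
  qed
  from this[of "length Ms"] show ?thesis using xs by simp
qed

lemma tensor_rels_closed:
  assumes "cring R" and mods: "\<And>i. i < length Ms \<Longrightarrow> module R (Ms ! i)"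
  shows "tensor_rels R Ms \<subseteq> carrier (free_module R (tuples Ms))"
proof
  interpret fm: module R "free_module R (tuples Ms)" by (rule free_module_module[OF assms(1)])
  fix z assume "z \<in> tensor_rels R Ms"
  then consider xs i x y where
      "z = free_gen R (xs[i := x \<oplus>\<^bsub>Ms ! i\<^esub> y])
        \<ominus>\<^bsub>free_module R (tuples Ms)\<^esub> free_gen R (xs[i := x])
        \<ominus>\<^bsub>free_module R (tuples Ms)\<^esub> free_gen R (xs[i := y])"
      "xs \<in> tuples Ms" "i < length Ms" "x \<in> carrier (Ms ! i)" "y \<in> carrier (Ms ! i)"
    | xs i r x where
      "z = free_gen R (xs[i := r \<odot>\<^bsub>Ms ! i\<^esub> x])
        \<ominus>\<^bsub>free_module R (tuples Ms)\<^esub> r \<odot>\<^bsub>free_module R (tuples Ms)\<^esub> free_gen R (xs[i := x])"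
      "xs \<in> tuples Ms" "i < length Ms" "r \<in> carrier R" "x \<in> carrier (Ms ! i)"
    unfolding tensor_rels_def Let_def by blast
  then show "z \<in> carrier (free_module R (tuples Ms))"
  proof cases
    case (1 xs i x y)
    interpret m: module R "Ms ! i" by (rule mods[OF 1(3)])
    show ?thesis
      unfolding 1(1) using 1
      by (intro fm.M.minus_closed free_gen_closed[OF assms(1)] tuples_update) auto
  next
    case (2 xs i r x)
    interpret m: module R "Ms ! i" by (rule mods[OF 2(3)])
    show ?thesis
      unfolding 2(1) using 2
      by (intro fm.M.minus_closed fm.smult_closed free_gen_closed[OF assms(1)] tuples_update) auto
  qed
qed

lemma tensor_module:
  assumes "cring R" and "\<And>i. i < length Ms \<Longrightarrow> module R (Ms ! i)"
  shows "module R (tensor R Ms)"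
  unfolding tensor_def tensor_kernel_def
  by (intro quot_module_module gen_submodule_submodule free_module_module tensor_rels_closed assms)

lemma pure_tensor_spans:
  assumes "cring R" and "\<And>i. i < length Ms \<Longrightarrow> module R (Ms ! i)"
  shows "spans R (tensor R Ms) (pure_tensor R Ms ` tuples Ms)"
proof -
  have "spans R (tensor R Ms)
          ((+>\<^bsub>free_module R (tuples Ms)\<^esub>) (tensor_kernel R Ms) ` free_gen R ` tuples Ms)"
    unfolding tensor_def tensor_kernel_def
    by (intro quot_proj_spans gen_submodule_submodule free_module_module tensor_rels_closed
        free_gen_spans assms)
  then show ?thesis by (simp add: image_image pure_tensor_def)
qed

lemma pure_tensor_closed:
  assumes "cring R" and "\<And>i. i < length Ms \<Longrightarrow> module R (Ms ! i)" and "xs \<in> tuples Ms"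
  shows "pure_tensor R Ms xs \<in> carrier (tensor R Ms)"
  using spans_closed[OF pure_tensor_spans[OF assms(1,2)]] assms(3) by blast

lemma (in module) minus_eq_zero_iff:
  "\<lbrakk>x \<in> carrier M; y \<in> carrier M\<rbrakk> \<Longrightarrow> x \<ominus>\<^bsub>M\<^esub> y = \<zero>\<^bsub>M\<^esub> \<longleftrightarrow> x = y"
  using M.add.inv_equality[of x "\<ominus>\<^bsub>M\<^esub> y"] by (auto simp: a_minus_def M.r_neg)

lemma (in module) minus_minus_eq_zero_iff:
  assumes "x \<in> carrier M" and "y \<in> carrier M" and "z \<in> carrier M"
  shows "x \<ominus>\<^bsub>M\<^esub> y \<ominus>\<^bsub>M\<^esub> z = \<zero>\<^bsub>M\<^esub> \<longleftrightarrow> x = y \<oplus>\<^bsub>M\<^esub> z"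
proof -
  have "x \<ominus>\<^bsub>M\<^esub> y \<ominus>\<^bsub>M\<^esub> z = x \<ominus>\<^bsub>M\<^esub> (y \<oplus>\<^bsub>M\<^esub> z)"
    using assms by (simp add: a_minus_def M.a_assoc M.minus_add)
  then show ?thesis using assms by (simp add: minus_eq_zero_iff)
qed

lemma pure_tensor_multilinear:
  assumes "cring R" and mods: "\<And>i. i < length Ms \<Longrightarrow> module R (Ms ! i)"
  shows "multilinear R Ms (tensor R Ms) (pure_tensor R Ms)"
  unfolding multilinear_def
proof (intro ballI conjI allI impI)
  let ?F = "free_module R (tuples Ms)" and ?T = "tensor R Ms"
  fix xs assume xs: "xs \<in> tuples Ms"
  show "pure_tensor R Ms xs \<in> carrier ?T"
    by (rule pure_tensor_closed[OF assms xs])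
  fix i assume i: "i < length Ms"
  interpret fm: module R ?F by (rule free_module_module[OF assms(1)])
  interpret t: module R ?T by (rule tensor_module[OF assms])
  interpret m: module R "Ms ! i" by (rule mods[OF i])
  let ?p = "\<lambda>z. tensor_kernel R Ms +>\<^bsub>?F\<^esub> z"
  note rels = tensor_rels_closed[OF assms]
  have lin: "linear_on R ?F ?T ?p"
    unfolding tensor_def
    by (intro quot_proj_linear fm.module_axioms gen_submodule_submodule rels, unfold tensor_kernel_def)
       (intro gen_submodule_submodule fm.module_axioms rels)
  have rel: "?p z = \<zero>\<^bsub>?T\<^esub>" if "z \<in> tensor_rels R Ms" for z
    unfolding tensor_def tensor_kernel_def
    by (rule quot_gen_rel[OF fm.module_axioms rels that])
  have gen: "free_gen R (xs[i := x]) \<in> carrier ?F" if "x \<in> carrier (Ms ! i)" for x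
    by (intro free_gen_closed[OF assms(1)] tuples_update xs that)
  have p: "pure_tensor R Ms ys = ?p (free_gen R ys)" for ys
    by (simp add: pure_tensor_def)
  note minus = linear_on_minus[OF fm.module_axioms t.module_axioms lin]
  show "linear_on R (Ms ! i) ?T (\<lambda>x. pure_tensor R Ms (xs[i := x]))"
  proof (rule linear_onI)
    fix x assume x: "x \<in> carrier (Ms ! i)"
    show "pure_tensor R Ms (xs[i := x]) \<in> carrier ?T"
      unfolding p by (rule linear_onD(1)[OF lin gen[OF x]])
    {
      fix y assume y: "y \<in> carrier (Ms ! i)"
      have "?p (free_gen R (xs[i := x \<oplus>\<^bsub>Ms ! i\<^esub> y]) \<ominus>\<^bsub>?F\<^esub> free_gen R (xs[i := x])
              \<ominus>\<^bsub>?F\<^esub> free_gen R (xs[i := y])) = \<zero>\<^bsub>?T\<^esub>"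
        by (rule rel) (unfold tensor_rels_def Let_def, use xs i x y in blast)
      then show "pure_tensor R Ms (xs[i := x \<oplus>\<^bsub>Ms ! i\<^esub> y]) =
          pure_tensor R Ms (xs[i := x]) \<oplus>\<^bsub>?T\<^esub> pure_tensor R Ms (xs[i := y])"
        using x y unfolding p
        by (simp add: minus gen t.minus_minus_eq_zero_iff linear_onD(1)[OF lin])
    next
      fix r assume r: "r \<in> carrier R"
      have "?p (free_gen R (xs[i := r \<odot>\<^bsub>Ms ! i\<^esub> x]) \<ominus>\<^bsub>?F\<^esub> r \<odot>\<^bsub>?F\<^esub> free_gen R (xs[i := x])) = \<zero>\<^bsub>?T\<^esub>"
        by (rule rel) (unfold tensor_rels_def Let_def, use xs i x r in blast)
      then show "pure_tensor R Ms (xs[i := r \<odot>\<^bsub>Ms ! i\<^esub> x]) = r \<odot>\<^bsub>?T\<^esub> pure_tensor R Ms (xs[i := x])"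
        using x r unfolding p
        by (simp add: minus gen t.minus_eq_zero_iff linear_onD(1,3)[OF lin])
    }
  qed
qed

text \<open>Existence in the universal property of the tensor product; uniqueness is
  \<open>pure_tensor_spans\<close>.\<close>

lemma tensor_universal:
  assumes "cring R" and mods: "\<And>i. i < length Ms \<Longrightarrow> module R (Ms ! i)"
    and P: "module R P" and f: "multilinear R Ms P f"
  shows "\<exists>h. linear_on R (tensor R Ms) P h \<and> (\<forall>xs\<in>tuples Ms. h (pure_tensor R Ms xs) = f xs)"
proof -
  let ?F = "free_module R (tuples Ms)"
  interpret fm: module R ?F by (rule free_module_module[OF assms(1)])
  interpret p: module R P by fact
  obtain k where k: "linear_on R ?F P k" "\<And>xs. xs \<in> tuples Ms \<Longrightarrow> k (free_gen R xs) = f xs"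
    using free_module_lift[OF P, of "tuples Ms" f] multilinearD(1)[OF f] by blast
  note minus = linear_on_minus[OF fm.module_axioms P k(1)]
  have gen: "free_gen R (xs[i := x]) \<in> carrier ?F"
    if "xs \<in> tuples Ms" "x \<in> carrier (Ms ! i)" for xs i x
    by (intro free_gen_closed[OF assms(1)] tuples_update that)
  have kgen: "k (free_gen R (xs[i := x])) = f (xs[i := x])"
    if "xs \<in> tuples Ms" "x \<in> carrier (Ms ! i)" for xs i x
    by (intro k(2) tuples_update that)
  have "k z = \<zero>\<^bsub>P\<^esub>" if "z \<in> tensor_rels R Ms" for z
  proof -
    from that consider xs i x y where
        "z = free_gen R (xs[i := x \<oplus>\<^bsub>Ms ! i\<^esub> y])
          \<ominus>\<^bsub>?F\<^esub> free_gen R (xs[i := x]) \<ominus>\<^bsub>?F\<^esub> free_gen R (xs[i := y])"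
        "xs \<in> tuples Ms" "i < length Ms" "x \<in> carrier (Ms ! i)" "y \<in> carrier (Ms ! i)"
      | xs i r x where
        "z = free_gen R (xs[i := r \<odot>\<^bsub>Ms ! i\<^esub> x]) \<ominus>\<^bsub>?F\<^esub> r \<odot>\<^bsub>?F\<^esub> free_gen R (xs[i := x])"
        "xs \<in> tuples Ms" "i < length Ms" "r \<in> carrier R" "x \<in> carrier (Ms ! i)"
      unfolding tensor_rels_def Let_def by blast
    then show ?thesis
    proof cases
      case (1 xs i x y)
      interpret m: module R "Ms ! i" by (rule mods[OF 1(3)])
      note lin = linear_onD[OF multilinearD(2)[OF f 1(2,3)]]
      have "x \<oplus>\<^bsub>Ms ! i\<^esub> y \<in> carrier (Ms ! i)" using 1 by simp
      then show ?thesis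
        unfolding 1(1) using 1(2,4,5)
        by (simp add: minus gen kgen lin p.minus_minus_eq_zero_iff)
    next
      case (2 xs i r x)
      interpret m: module R "Ms ! i" by (rule mods[OF 2(3)])
      note lin = linear_onD[OF multilinearD(2)[OF f 2(2,3)]]
      have "r \<odot>\<^bsub>Ms ! i\<^esub> x \<in> carrier (Ms ! i)" using 2 by simp
      then show ?thesis
        unfolding 2(1) using 2(2,4,5)
        by (simp add: minus gen kgen lin linear_onD(3)[OF k(1)] p.minus_eq_zero_iff)
    qed
  qed
  from quot_gen_lift[OF fm.module_axioms P tensor_rels_closed[OF assms(1,2)] k(1) this]
  obtain h where "linear_on R (quot_module ?F (gen_submodule R ?F (tensor_rels R Ms))) P h"
    "\<forall>x\<in>carrier ?F. h (gen_submodule R ?F (tensor_rels R Ms) +>\<^bsub>?F\<^esub> x) = k x" by blast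
  then show ?thesis
    using k(2) unfolding tensor_def tensor_kernel_def pure_tensor_def
    by (intro exI[of _ h] conjI ballI) (auto simp: free_gen_closed[OF assms(1)])
qed

text \<open>With at least one factor, scalars can be absorbed into a factor, so that every tensor is a sum
  of pure tensors.\<close>

lemma tensor_induct [consumes 4, case_names pure add]:
  assumes "cring R" and mods: "\<And>i. i < length Ms \<Longrightarrow> module R (Ms ! i)" and "Ms \<noteq> []"
    and x: "x \<in> carrier (tensor R Ms)"
    and pure: "\<And>xs. xs \<in> tuples Ms \<Longrightarrow> Q (pure_tensor R Ms xs)"
    and add: "\<And>x y. \<lbrakk>x \<in> carrier (tensor R Ms); y \<in> carrier (tensor R Ms); Q x; Q y\<rbrakk>
      \<Longrightarrow> Q (x \<oplus>\<^bsub>tensor R Ms\<^esub> y)"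
  shows "Q x"
proof -
  let ?T = "tensor R Ms"
  interpret t: module R ?T by (rule tensor_module[OF assms(1,2)])
  have pure': "Q (r \<odot>\<^bsub>?T\<^esub> pure_tensor R Ms xs)" if xs: "xs \<in> tuples Ms" and r: "r \<in> carrier R" for r xs
  proof -
    have 0: "0 < length Ms" using assms(3) by simp
    interpret m: module R "Ms ! 0" by (rule mods[OF 0])
    have x0: "xs ! 0 \<in> carrier (Ms ! 0)" using xs 0 by (simp add: tuples_iff)
    have "r \<odot>\<^bsub>?T\<^esub> pure_tensor R Ms (xs[0 := xs ! 0]) = pure_tensor R Ms (xs[0 := r \<odot>\<^bsub>Ms ! 0\<^esub> xs ! 0])"
      using linear_onD(3)[OF multilinearD(2)[OF pure_tensor_multilinear[OF assms(1,2)] xs 0] r x0] by simp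
    moreover have "xs[0 := r \<odot>\<^bsub>Ms ! 0\<^esub> xs ! 0] \<in> tuples Ms"
      using r x0 by (intro tuples_update[OF xs]) simp
    ultimately show ?thesis using pure by (metis list_update_id)
  qed
  \<comment> \<open>Unlike \<open>Q\<close>, this stronger property is stable under scalars.\<close>
  have "\<forall>r\<in>carrier R. Q (r \<odot>\<^bsub>?T\<^esub> x)"
  proof (rule spans_induct[OF t.module_axioms pure_tensor_spans[OF assms(1,2)] x])
    have xs: "map (\<lambda>M. \<zero>\<^bsub>M\<^esub>) Ms \<in> tuples Ms"
      using module.axioms(2)[OF mods]
      by (simp add: tuples_iff abelian_group_def abelian_monoid.zero_closed)
    have "Q (\<zero>\<^bsub>R\<^esub> \<odot>\<^bsub>?T\<^esub> pure_tensor R Ms (map (\<lambda>M. \<zero>\<^bsub>M\<^esub>) Ms))"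
      using pure'[OF xs] by simp
    then show "\<forall>r\<in>carrier R. Q (r \<odot>\<^bsub>?T\<^esub> \<zero>\<^bsub>?T\<^esub>)"
      using pure_tensor_closed[OF assms(1,2) xs] by simp
  qed (use pure' add in \<open>auto simp: t.smult_r_distr t.smult_assoc1[symmetric]\<close>)
  then have "Q (\<one>\<^bsub>R\<^esub> \<odot>\<^bsub>?T\<^esub> x)" by blast
  then show ?thesis using x by simp
qed

subsection \<open>Two factors\<close>

lemma tuples_two: "xs \<in> tuples [M, N] \<longleftrightarrow> (\<exists>x\<in>carrier M. \<exists>y\<in>carrier N. xs = [x, y])"
  unfolding tuples_def by (auto simp: set_Cons_def)

lemma multilinear_two:
  assumes "\<And>x. x \<in> carrier M \<Longrightarrow> linear_on R N P (p x)"
    and "\<And>y. y \<in> carrier N \<Longrightarrow> linear_on R M P (\<lambda>x. p x y)"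
  shows "multilinear R [M, N] P (\<lambda>xs. p (xs ! 0) (xs ! 1))"
  unfolding multilinear_def
  using assms linear_onD(1)[OF assms(1)] by (auto simp: less_Suc_eq tuples_two)

text \<open>\<open>tensor_lift\<close> is a definite description; for a bilinear \<open>p\<close> it denotes the linear map that it
  describes.\<close>

lemma tensor_lift_spec:
  assumes "module R M" and "module R N" and "module R P"
    and "\<And>x. x \<in> carrier M \<Longrightarrow> linear_on R N P (p x)"
    and "\<And>y. y \<in> carrier N \<Longrightarrow> linear_on R M P (\<lambda>x. p x y)"
  shows "linear_on R (tensor R [M, N]) P (tensor_lift (\<lambda>r. r) R M N P p)"
    and "\<lbrakk>x \<in> carrier M; y \<in> carrier N\<rbrakk>
      \<Longrightarrow> tensor_lift (\<lambda>r. r) R M N P p (pure_tensor R [M, N] [x, y]) = p x y"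
proof -
  have R: "cring R" using assms(1) by (simp add: module_def)
  have mods: "module R ([M, N] ! i)" if "i < length [M, N]" for i
    using that assms(1,2) by (auto simp: less_Suc_eq)
  let ?T = "tensor R [M, N]"
  have T: "module R ?T" by (rule tensor_module[OF R mods])
  obtain h where h: "linear_on R ?T P h"
    "\<And>xs. xs \<in> tuples [M, N] \<Longrightarrow> h (pure_tensor R [M, N] xs) = p (xs ! 0) (xs ! 1)"
    using tensor_universal[OF R mods assms(3) multilinear_two[OF assms(4,5)]] by blast
  have pc: "pure_tensor R [M, N] [x, y] \<in> carrier ?T" if "x \<in> carrier M" "y \<in> carrier N" for x y
    using that by (intro pure_tensor_closed[OF R mods]) (auto simp: tuples_two)
  define k where "k = (\<lambda>x\<in>carrier ?T. h x)"
  have k: "k \<in> linear_maps R ?T P"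
    "\<forall>x\<in>carrier M. \<forall>y\<in>carrier N. k (pure_tensor R [M, N] [x, y]) = p x y"
    using linear_on_restrict[OF T h(1)] h(2) pc by (auto simp: k_def tuples_two)
  have "tensor_lift (\<lambda>r. r) R M N P p = k"
    unfolding tensor_lift_def
  proof (rule the_equality)
    fix l assume l: "l \<in> linear_maps R ?T P \<and>
      (\<forall>x\<in>carrier M. \<forall>y\<in>carrier N. l (pure_tensor R [M, N] [x, y]) = p x y)"
    show "l = k"
    proof (rule extensionalityI[of _ "carrier ?T"])
      show "l \<in> extensional (carrier ?T)" "k \<in> extensional (carrier ?T)"
        using l k(1) by (auto simp: linear_maps_iff)
      fix x assume x: "x \<in> carrier ?T"
      show "l x = k x"
        by (rule linear_on_eq_on_spans[OF T assms(3) pure_tensor_spans[OF R mods] _ _ _ x])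
           (use l k in \<open>auto simp: linear_maps_iff tuples_two\<close>)
    qed
  qed (use k in blast)
  then show "linear_on R ?T P (tensor_lift (\<lambda>r. r) R M N P p)"
    "\<lbrakk>x \<in> carrier M; y \<in> carrier N\<rbrakk>
      \<Longrightarrow> tensor_lift (\<lambda>r. r) R M N P p (pure_tensor R [M, N] [x, y]) = p x y"
    using k by (auto simp: linear_maps_iff)
qed

subsection \<open>Products in an algebra\<close>

text \<open>The module underlying the \<open>R\<close>-algebra given by a ring homomorphism \<open>\<rho>: R \<rightarrow> E\<close>.\<close>

definition alg_module :: "'e ring \<Rightarrow> ('r \<Rightarrow> 'e) \<Rightarrow> ('r, 'e) module" where
  "alg_module E \<rho> =
    \<lparr>carrier = carrier E, monoid.mult = monoid.mult E, one = \<one>\<^bsub>E\<^esub>,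
     ring.zero = \<zero>\<^bsub>E\<^esub>, ring.add = ring.add E, smult = (\<lambda>a b. \<rho> a \<otimes>\<^bsub>E\<^esub> b)\<rparr>"

lemma alg_module_simps [simp]:
  "carrier (alg_module E \<rho>) = carrier E" "\<zero>\<^bsub>alg_module E \<rho>\<^esub> = \<zero>\<^bsub>E\<^esub>"
  "x \<oplus>\<^bsub>alg_module E \<rho>\<^esub> y = x \<oplus>\<^bsub>E\<^esub> y" "r \<odot>\<^bsub>alg_module E \<rho>\<^esub> x = \<rho> r \<otimes>\<^bsub>E\<^esub> x"
  by (simp_all add: alg_module_def)

lemma alg_module_module:
  assumes "cring R" and "cring E" and "\<rho> \<in> ring_hom R E"
  shows "module R (alg_module E \<rho>)"
proof -
  interpret r: cring R by fact
  interpret e: cring E by fact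
  note h = ring_hom_closed[OF assms(3)] ring_hom_mult[OF assms(3)] ring_hom_add[OF assms(3)]
    ring_hom_one[OF assms(3)]
  show ?thesis
  proof (rule moduleI)
    show "abelian_group (alg_module E \<rho>)"
      by (rule abelian_groupI) (auto simp: e.a_ac intro: bexI[of _ "\<ominus>\<^bsub>E\<^esub> x" for x] e.l_neg)
  qed (auto simp: assms(1) h e.l_distr e.r_distr e.m_assoc)
qed

lemma multilinear_finprod:
  assumes "cring E" and "cring R" and "\<rho> \<in> ring_hom R E"
    and mods: "\<And>i. i < length Ms \<Longrightarrow> module R (Ms ! i)"
    and g: "\<And>i. i < length Ms \<Longrightarrow> linear_on R (Ms ! i) (alg_module E \<rho>) (g i)"
  shows "multilinear R Ms (alg_module E \<rho>) (\<lambda>xs. \<Otimes>\<^bsub>E\<^esub>i\<in>{..<length Ms}. g i (xs ! i))"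
  unfolding multilinear_def
proof (intro ballI conjI allI impI)
  interpret e: cring E by fact
  fix xs assume xs: "xs \<in> tuples Ms"
  have gc: "g i x \<in> carrier E" if "i < length Ms" "x \<in> carrier (Ms ! i)" for i x
    using linear_onD(1)[OF g] that by simp
  have xi: "xs ! i \<in> carrier (Ms ! i)" if "i < length Ms" for i
    using xs that by (simp add: tuples_iff)
  have len: "length xs = length Ms" using xs by (simp add: tuples_iff)
  show "(\<Otimes>\<^bsub>E\<^esub>i\<in>{..<length Ms}. g i (xs ! i)) \<in> carrier (alg_module E \<rho>)"
    using gc xi by (auto intro!: e.finprod_closed)
  fix i assume i: "i < length Ms"
  define c where "c = (\<Otimes>\<^bsub>E\<^esub>j\<in>{..<length Ms} - {i}. g j (xs ! j))"
  have c: "c \<in> carrier E"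
    unfolding c_def using gc xi by (auto intro!: e.finprod_closed)
  have eq: "(\<Otimes>\<^bsub>E\<^esub>j\<in>{..<length Ms}. g j (xs[i := x] ! j)) = g i x \<otimes>\<^bsub>E\<^esub> c"
    if x: "x \<in> carrier (Ms ! i)" for x
  proof -
    have "{..<length Ms} = insert i ({..<length Ms} - {i})" using i by auto
    then have "(\<Otimes>\<^bsub>E\<^esub>j\<in>{..<length Ms}. g j (xs[i := x] ! j))
        = (\<Otimes>\<^bsub>E\<^esub>j\<in>insert i ({..<length Ms} - {i}). g j (xs[i := x] ! j))" by simp
    also have "\<dots> = g i (xs[i := x] ! i) \<otimes>\<^bsub>E\<^esub> (\<Otimes>\<^bsub>E\<^esub>j\<in>{..<length Ms} - {i}. g j (xs[i := x] ! j))"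
      using gc xi x i len by (intro e.finprod_insert) (auto simp: nth_list_update)
    also have "(\<Otimes>\<^bsub>E\<^esub>j\<in>{..<length Ms} - {i}. g j (xs[i := x] ! j)) = c"
      unfolding c_def using gc xi by (intro e.finprod_cong') (auto simp: nth_list_update)
    finally show ?thesis using i len by simp
  qed
  have "linear_on R (Ms ! i) (alg_module E \<rho>) (\<lambda>x. g i x \<otimes>\<^bsub>E\<^esub> c)"
  proof (rule linear_onI)
    fix x assume x: "x \<in> carrier (Ms ! i)"
    show "g i x \<otimes>\<^bsub>E\<^esub> c \<in> carrier (alg_module E \<rho>)" using gc[OF i x] c by simp
    show "g i (x \<oplus>\<^bsub>Ms ! i\<^esub> y) \<otimes>\<^bsub>E\<^esub> c = g i x \<otimes>\<^bsub>E\<^esub> c \<oplus>\<^bsub>alg_module E \<rho>\<^esub> g i y \<otimes>\<^bsub>E\<^esub> c"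
      if "y \<in> carrier (Ms ! i)" for y
      using linear_onD(2)[OF g[OF i] x that] gc[OF i x] gc[OF i that] c by (simp add: e.l_distr)
    show "g i (r \<odot>\<^bsub>Ms ! i\<^esub> x) \<otimes>\<^bsub>E\<^esub> c = r \<odot>\<^bsub>alg_module E \<rho>\<^esub> (g i x \<otimes>\<^bsub>E\<^esub> c)" if "r \<in> carrier R" for r
      using linear_onD(3)[OF g[OF i] that x] gc[OF i x] c ring_hom_closed[OF assms(3) that]
      by (simp add: e.m_assoc)
  qed
  then show "linear_on R (Ms ! i) (alg_module E \<rho>)
      (\<lambda>x. \<Otimes>\<^bsub>E\<^esub>j\<in>{..<length Ms}. g j (xs[i := x] ! j))"
    by (rule linear_on_cong[OF mods[OF i]]) (rule eq)
qed

section \<open>Differential forms\<close>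

text \<open>An affine chart: a homomorphism \<open>A \<rightarrow> B\<close> of commutative rings.\<close>

locale ring_morphism =
  fixes K :: "('c, 'a) ring_map"
  assumes base_cring: "cring (rm_base K)" and top_cring: "cring (rm_ring K)"
    and map_hom: "rm_map K \<in> ring_hom (rm_base K) (rm_ring K)"
begin

abbreviation "A \<equiv> rm_base K"
abbreviation "B \<equiv> rm_ring K"

sublocale A: cring A by (rule base_cring)
sublocale B: cring B by (rule top_cring)

lemma map_closed: "a \<in> carrier A \<Longrightarrow> rm_map K a \<in> carrier B"
  using map_hom by (rule ring_hom_closed)

subsection \<open>Kaehler differentials\<close>

lemma kaehler_rels_closed: "kaehler_rels K \<subseteq> carrier (free_module B (carrier B))"
proof -
  interpret fm: module B "free_module B (carrier B)" by (rule free_module_module[OF top_cring])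
  show ?thesis
    unfolding kaehler_rels_def Let_def
    using free_gen_closed[OF top_cring, of _ "carrier B"] map_closed by auto
qed

lemma kaehler_module: "module B (kaehler K)"
  unfolding kaehler_def kaehler_kernel_def Let_def
  by (intro quot_module_module gen_submodule_submodule free_module_module top_cring kaehler_rels_closed)

lemma diff_spans: "spans B (kaehler K) (diff K ` carrier B)"
proof -
  have "spans B (kaehler K)
      ((+>\<^bsub>free_module B (carrier B)\<^esub>) (kaehler_kernel K) ` free_gen B ` carrier B)"
    unfolding kaehler_def kaehler_kernel_def Let_def
    by (intro quot_proj_spans gen_submodule_submodule free_module_module free_gen_spans
        top_cring kaehler_rels_closed)
  then show ?thesis by (simp add: image_image diff_def Let_def)
qed

lemma diff_closed: "b \<in> carrier B \<Longrightarrow> diff K b \<in> carrier (kaehler K)"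
  using spans_closed[OF diff_spans] by blast

text \<open>\<open>\<Omega>\<^sup>1\<close> carries the universal \<open>A\<close>-derivation of \<open>B\<close>. Only the existence of the linear map
  is stated; uniqueness is \<open>diff_spans\<close>.\<close>

lemma kaehler_universal:
  assumes P: "module B P" and fc: "\<And>b. b \<in> carrier B \<Longrightarrow> f b \<in> carrier P"
    and add: "\<And>b c. \<lbrakk>b \<in> carrier B; c \<in> carrier B\<rbrakk> \<Longrightarrow> f (b \<oplus>\<^bsub>B\<^esub> c) = f b \<oplus>\<^bsub>P\<^esub> f c"
    and leibniz: "\<And>b c. \<lbrakk>b \<in> carrier B; c \<in> carrier B\<rbrakk>
      \<Longrightarrow> f (b \<otimes>\<^bsub>B\<^esub> c) = b \<odot>\<^bsub>P\<^esub> f c \<oplus>\<^bsub>P\<^esub> c \<odot>\<^bsub>P\<^esub> f b"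
    and const: "\<And>a. a \<in> carrier A \<Longrightarrow> f (rm_map K a) = \<zero>\<^bsub>P\<^esub>"
  shows "\<exists>h. linear_on B (kaehler K) P h \<and> (\<forall>b\<in>carrier B. h (diff K b) = f b)"
proof -
  let ?F = "free_module B (carrier B)"
  interpret fm: module B ?F by (rule free_module_module[OF top_cring])
  interpret p: module B P by fact
  note gen = free_gen_closed[OF top_cring, of _ "carrier B"]
  obtain k where k: "linear_on B ?F P k" "\<And>b. b \<in> carrier B \<Longrightarrow> k (free_gen B b) = f b"
    using free_module_lift[OF P, of "carrier B" f] fc by blast
  note minus = linear_on_minus[OF fm.module_axioms P k(1)]
  have "k z = \<zero>\<^bsub>P\<^esub>" if "z \<in> kaehler_rels K" for z
  proof -
    from that consider b c where
        "z = free_gen B (b \<oplus>\<^bsub>B\<^esub> c) \<ominus>\<^bsub>?F\<^esub> free_gen B b \<ominus>\<^bsub>?F\<^esub> free_gen B c"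
        "b \<in> carrier B" "c \<in> carrier B"
      | b c where
        "z = free_gen B (b \<otimes>\<^bsub>B\<^esub> c) \<ominus>\<^bsub>?F\<^esub> b \<odot>\<^bsub>?F\<^esub> free_gen B c \<ominus>\<^bsub>?F\<^esub> c \<odot>\<^bsub>?F\<^esub> free_gen B b"
        "b \<in> carrier B" "c \<in> carrier B"
      | a where "z = free_gen B (rm_map K a)" "a \<in> carrier A"
      unfolding kaehler_rels_def Let_def by blast
    then show ?thesis
    proof cases
      case 1
      then show ?thesis
        by (simp add: minus gen k(2) add fc p.minus_minus_eq_zero_iff)
    next
      case 2
      then show ?thesis
        by (simp add: minus gen k(2) leibniz fc linear_onD(3)[OF k(1)] p.minus_minus_eq_zero_iff)
    next
      case 3
      then show ?thesis by (simp add: k(2) const map_closed)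
    qed
  qed
  from quot_gen_lift[OF fm.module_axioms P kaehler_rels_closed k(1) this]
  obtain h where "linear_on B (quot_module ?F (gen_submodule B ?F (kaehler_rels K))) P h"
    "\<And>x. x \<in> carrier ?F \<Longrightarrow> h (gen_submodule B ?F (kaehler_rels K) +>\<^bsub>?F\<^esub> x) = k x" by blast
  then show ?thesis
    using k(2) gen unfolding kaehler_def kaehler_kernel_def diff_def Let_def
    by (intro exI[of _ h] conjI ballI) auto
qed

subsection \<open>The modules of higher forms\<close>

abbreviation "kaehlers n \<equiv> replicate n (kaehler K)"

lemma kaehlers_module: "i < length (kaehlers n) \<Longrightarrow> module B (kaehlers n ! i)"
  by (simp add: kaehler_module)

lemma kaehlers_tensor_module: "module B (tensor B (kaehlers n))"
  by (rule tensor_module[OF top_cring kaehlers_module])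

lemma kaehlers_pure_closed:
  "ws \<in> tuples (kaehlers n) \<Longrightarrow> pure_tensor B (kaehlers n) ws \<in> carrier (tensor B (kaehlers n))"
  by (rule pure_tensor_closed[OF top_cring kaehlers_module])

text \<open>The generators of the relations that define \<open>\<Omega>\<^bsup>(n)\<^esup>\<close>: a pure tensor plus its image under a
  transposition of two factors. Forms are antisymmetric but not alternating, so that \<open>2 \<omega> \<wedge> \<omega> = 0\<close>
  while \<open>\<omega> \<wedge> \<omega>\<close> may be nonzero.\<close>

definition swap_rels :: "nat \<Rightarrow> (('a \<Rightarrow> 'a) set list \<Rightarrow> 'a) set set" where
  "swap_rels n = {pure_tensor B (kaehlers n) ws \<oplus>\<^bsub>tensor B (kaehlers n)\<^esub>
     pure_tensor B (kaehlers n) (ws[i := ws ! j, j := ws ! i]) | ws i j.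
     ws \<in> tuples (kaehlers n) \<and> i < n \<and> j < n \<and> i \<noteq> j}"

lemma Omega_kernel_eq: "Omega_kernel K n = gen_submodule B (tensor B (kaehlers n)) (swap_rels n)"
  unfolding Omega_kernel_def swap_rels_def Let_def ..

lemma swap_closed:
  "\<lbrakk>ws \<in> tuples (kaehlers n); i < n; j < n\<rbrakk> \<Longrightarrow> ws[i := ws ! j, j := ws ! i] \<in> tuples (kaehlers n)"
  by (intro tuples_update) (auto simp: tuples_iff)

lemma swap_rels_closed: "swap_rels n \<subseteq> carrier (tensor B (kaehlers n))"
proof -
  interpret t: module B "tensor B (kaehlers n)" by (rule kaehlers_tensor_module)
  show ?thesis
    unfolding swap_rels_def
    using kaehlers_pure_closed swap_closed by blast
qed

lemma Omega_kernel_submodule: "submodule (Omega_kernel K n) B (tensor B (kaehlers n))"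
  unfolding Omega_kernel_eq by (rule gen_submodule_submodule[OF kaehlers_tensor_module swap_rels_closed])

lemma Omega_module: "module B (Omega K n)"
  unfolding Omega_def by (rule quot_module_module[OF kaehlers_tensor_module Omega_kernel_submodule])

lemma twedge_list_alt:
  "twedge_list K n ws = Omega_kernel K n +>\<^bsub>tensor B (kaehlers n)\<^esub> pure_tensor B (kaehlers n) ws"
  unfolding twedge_list_def Let_def ..

lemma Omega_proj_linear:
  "linear_on B (tensor B (kaehlers n)) (Omega K n) (\<lambda>x. Omega_kernel K n +>\<^bsub>tensor B (kaehlers n)\<^esub> x)"
  unfolding Omega_def by (rule quot_proj_linear[OF kaehlers_tensor_module Omega_kernel_submodule])

lemma twedge_list_multilinear: "multilinear B (kaehlers n) (Omega K n) (twedge_list K n)"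
  using multilinear_comp[OF pure_tensor_multilinear[OF top_cring kaehlers_module] Omega_proj_linear]
  unfolding twedge_list_alt[abs_def] .

lemma twedge_list_closed: "ws \<in> tuples (kaehlers n) \<Longrightarrow> twedge_list K n ws \<in> carrier (Omega K n)"
  by (rule multilinearD(1)[OF twedge_list_multilinear])

lemma twedge_list_swap:
  assumes "ws \<in> tuples (kaehlers n)" and "i < n" and "j < n" and "i \<noteq> j"
  shows "twedge_list K n ws \<oplus>\<^bsub>Omega K n\<^esub> twedge_list K n (ws[i := ws ! j, j := ws ! i]) = \<zero>\<^bsub>Omega K n\<^esub>"
proof -
  let ?T = "tensor B (kaehlers n)"
  let ?z = "pure_tensor B (kaehlers n) ws \<oplus>\<^bsub>?T\<^esub> pure_tensor B (kaehlers n) (ws[i := ws ! j, j := ws ! i])"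
  have "?z \<in> swap_rels n" unfolding swap_rels_def using assms by blast
  from quot_gen_rel[OF kaehlers_tensor_module swap_rels_closed this]
  have "Omega_kernel K n +>\<^bsub>?T\<^esub> ?z = \<zero>\<^bsub>Omega K n\<^esub>"
    unfolding Omega_def Omega_kernel_eq .
  then show ?thesis
    unfolding twedge_list_alt
    using linear_onD(2)[OF Omega_proj_linear] kaehlers_pure_closed assms(1)
      swap_closed[OF assms(1-3)] by metis
qed

lemma twedge_list_spans: "spans B (Omega K n) (twedge_list K n ` tuples (kaehlers n))"
proof -
  have "spans B (Omega K n) ((+>\<^bsub>tensor B (kaehlers n)\<^esub>) (Omega_kernel K n) `
      pure_tensor B (kaehlers n) ` tuples (kaehlers n))"
    unfolding Omega_def
    by (rule quot_proj_spans[OF kaehlers_tensor_module Omega_kernel_submodule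
          pure_tensor_spans[OF top_cring kaehlers_module]])
  then show ?thesis by (simp add: image_image twedge_list_alt)
qed

text \<open>The elements \<open>db\<^sub>1 \<and> \<dots> \<and> db\<^sub>n\<close>.\<close>

abbreviation "exact_forms n \<equiv> twedge_list K n ` map (diff K) ` {bs. length bs = n \<and> set bs \<subseteq> carrier B}"

lemma diffs_in_tuples:
  "\<lbrakk>length bs = n; set bs \<subseteq> carrier B\<rbrakk> \<Longrightarrow> map (diff K) bs \<in> tuples (kaehlers n)"
  by (auto simp: tuples_replicate diff_closed)

lemma exact_forms_span: "spans B (Omega K n) (exact_forms n)"
  unfolding spans_def
proof (intro conjI allI impI)
  show "exact_forms n \<subseteq> carrier (Omega K n)"
    using diffs_in_tuples twedge_list_closed by blast
  fix L assume L: "submodule L B (Omega K n) \<and> exact_forms n \<subseteq> L"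
  have "twedge_list K n ws \<in> L" if ws: "ws \<in> tuples (kaehlers n)" for ws
  proof (rule multilinear_in_submodule[OF kaehlers_module Omega_module twedge_list_multilinear _ _ _ ws])
    show "spans B (kaehlers n ! i) (diff K ` carrier B)" if "i < length (kaehlers n)" for i
      using that diff_spans by simp
    show "submodule L B (Omega K n)" using L by blast
    fix xs assume len: "length xs = length (kaehlers n)"
      and xs: "\<And>i. i < length (kaehlers n) \<Longrightarrow> xs ! i \<in> diff K ` carrier B"
    have "\<forall>i<n. \<exists>b\<in>carrier B. xs ! i = diff K b" using xs by auto
    then obtain b where b: "\<And>i. i < n \<Longrightarrow> b i \<in> carrier B" "\<And>i. i < n \<Longrightarrow> xs ! i = diff K (b i)"
      by metis
    have xs_eq: "xs = map (diff K) (map b [0..<n])"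
      using len b(2) by (intro nth_equalityI) auto
    have "map b [0..<n] \<in> {bs. length bs = n \<and> set bs \<subseteq> carrier B}" using b(1) by auto
    then have "twedge_list K n xs \<in> exact_forms n" unfolding xs_eq by (intro imageI)
    then show "twedge_list K n xs \<in> L" using L by blast
  qed
  then have "twedge_list K n ` tuples (kaehlers n) \<subseteq> L" by blast
  then show "carrier (Omega K n) \<subseteq> L"
    using twedge_list_spans[of n] conjunct1[OF L] unfolding spans_def by simp
qed

lemma Omega_universal:
  assumes P: "module B P" and f: "multilinear B (kaehlers n) P f"
    and swap: "\<And>ws i j. \<lbrakk>ws \<in> tuples (kaehlers n); i < n; j < n; i \<noteq> j\<rbrakk>
      \<Longrightarrow> f ws \<oplus>\<^bsub>P\<^esub> f (ws[i := ws ! j, j := ws ! i]) = \<zero>\<^bsub>P\<^esub>"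
  shows "\<exists>h. linear_on B (Omega K n) P h \<and> (\<forall>ws\<in>tuples (kaehlers n). h (twedge_list K n ws) = f ws)"
proof -
  let ?T = "tensor B (kaehlers n)"
  note pc = kaehlers_pure_closed
  obtain k where k: "linear_on B ?T P k"
    "\<And>ws. ws \<in> tuples (kaehlers n) \<Longrightarrow> k (pure_tensor B (kaehlers n) ws) = f ws"
    using tensor_universal[OF top_cring kaehlers_module P f] by blast
  have "k z = \<zero>\<^bsub>P\<^esub>" if z_rel: "z \<in> swap_rels n" for z
  proof -
    obtain ws i j where z: "z = pure_tensor B (kaehlers n) ws \<oplus>\<^bsub>?T\<^esub>
          pure_tensor B (kaehlers n) (ws[i := ws ! j, j := ws ! i])"
      and ws: "ws \<in> tuples (kaehlers n)" and ij: "i < n" "j < n" "i \<noteq> j"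
      using z_rel unfolding swap_rels_def by blast
    note ws' = swap_closed[OF ws ij(1,2)]
    show ?thesis
      unfolding z linear_onD(2)[OF k(1) pc[OF ws] pc[OF ws']] k(2)[OF ws] k(2)[OF ws']
      by (rule swap[OF ws ij])
  qed
  from quot_gen_lift[OF kaehlers_tensor_module P swap_rels_closed k(1) this]
  obtain h where "linear_on B (Omega K n) P h"
    "\<And>x. x \<in> carrier ?T \<Longrightarrow> h (Omega_kernel K n +>\<^bsub>?T\<^esub> x) = k x"
    unfolding Omega_def Omega_kernel_eq by blast
  then show ?thesis
    using k(2) pc by (intro exI[of _ h]) (simp add: twedge_list_alt)
qed

subsection \<open>The product of forms\<close>

lemma append_in_tuples:
  "\<lbrakk>us \<in> tuples (kaehlers m); vs \<in> tuples (kaehlers n)\<rbrakk> \<Longrightarrow> us @ vs \<in> tuples (kaehlers (m + n))"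
  by (auto simp: tuples_replicate)

text \<open>The product \<open>\<alpha> \<and> \<beta>\<close> exists because concatenation is multilinear and antisymmetric in the factors
  of either argument.\<close>

lemma twedge_spec:
  "twedge K m n \<in> bilinear_maps B (Omega K m) (Omega K n) (Omega K (m + n)) \<and>
     (\<forall>us\<in>tuples (kaehlers m). \<forall>vs\<in>tuples (kaehlers n).
        twedge K m n (twedge_list K m us) (twedge_list K n vs) = twedge_list K (m + n) (us @ vs))"
proof -
  have "\<exists>!p. p \<in> bilinear_maps B (Omega K m) (Omega K n) (Omega K (m + n)) \<and>
     (\<forall>us\<in>tuples (kaehlers m). \<forall>vs\<in>tuples (kaehlers n).
        p (twedge_list K m us) (twedge_list K n vs) = twedge_list K (m + n) (us @ vs))"
  proof (rule bilinear_lift[OF Omega_module Omega_module Omega_module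
      twedge_list_spans twedge_list_spans])
    let ?M = "Omega K (m + n)"
    note ml = multilinearD[OF twedge_list_multilinear[of "m + n"] append_in_tuples]
    fix vs assume vs: "vs \<in> tuples (kaehlers n)"
    show "\<exists>h. linear_on B (Omega K m) ?M h \<and>
        (\<forall>us\<in>tuples (kaehlers m). h (twedge_list K m us) = twedge_list K (m + n) (us @ vs))"
    proof (rule Omega_universal[OF Omega_module])
      show "multilinear B (kaehlers m) ?M (\<lambda>us. twedge_list K (m + n) (us @ vs))"
        unfolding multilinear_def
      proof (intro ballI conjI allI impI)
        fix us assume us: "us \<in> tuples (kaehlers m)"
        show "twedge_list K (m + n) (us @ vs) \<in> carrier ?M" by (rule ml(1)[OF us vs])
        fix i assume i: "i < length (kaehlers m)"
        then show "linear_on B (kaehlers m ! i) ?M (\<lambda>x. twedge_list K (m + n) (us[i := x] @ vs))"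
          using ml(2)[OF us vs, of i] us by (simp add: tuples_iff list_update_append)
      qed
      fix us i j assume us: "us \<in> tuples (kaehlers m)" and ij: "i < m" "j < m" "i \<noteq> j"
      then show "twedge_list K (m + n) (us @ vs) \<oplus>\<^bsub>?M\<^esub>
          twedge_list K (m + n) (us[i := us ! j, j := us ! i] @ vs) = \<zero>\<^bsub>?M\<^esub>"
        using twedge_list_swap[OF append_in_tuples[OF us vs], of i j]
        by (simp add: tuples_iff list_update_append nth_append)
    qed
  next
    let ?M = "Omega K (m + n)"
    note ml = multilinearD[OF twedge_list_multilinear[of "m + n"] append_in_tuples]
    fix us assume us: "us \<in> tuples (kaehlers m)"
    then have len: "length us = m" by (simp add: tuples_iff)
    show "\<exists>h. linear_on B (Omega K n) ?M h \<and>
        (\<forall>vs\<in>tuples (kaehlers n). h (twedge_list K n vs) = twedge_list K (m + n) (us @ vs))"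
    proof (rule Omega_universal[OF Omega_module])
      show "multilinear B (kaehlers n) ?M (\<lambda>vs. twedge_list K (m + n) (us @ vs))"
        unfolding multilinear_def
      proof (intro ballI conjI allI impI)
        fix vs assume vs: "vs \<in> tuples (kaehlers n)"
        show "twedge_list K (m + n) (us @ vs) \<in> carrier ?M" by (rule ml(1)[OF us vs])
        fix i assume i: "i < length (kaehlers n)"
        then show "linear_on B (kaehlers n ! i) ?M (\<lambda>x. twedge_list K (m + n) (us @ vs[i := x]))"
          using ml(2)[OF us vs, of "m + i"] len by (simp add: list_update_append)
      qed
      fix vs i j assume vs: "vs \<in> tuples (kaehlers n)" and ij: "i < n" "j < n" "i \<noteq> j"
      then show "twedge_list K (m + n) (us @ vs) \<oplus>\<^bsub>?M\<^esub>
          twedge_list K (m + n) (us @ vs[i := vs ! j, j := vs ! i]) = \<zero>\<^bsub>?M\<^esub>"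
        using twedge_list_swap[OF append_in_tuples[OF us vs], of "m + i" "m + j"] len
        by (simp add: list_update_append nth_append)
    qed
  qed
  from theI'[OF this] show ?thesis unfolding twedge_def .
qed

lemmas twedge_bilinear = bilinear_mapsD[OF Omega_module conjunct1[OF twedge_spec]]

end

section \<open>Ideals and quotient rings\<close>

text \<open>The ideal quotient \<open>(I : U)\<close>. It reduces statements on products of two generated ideals to
  products of generators.\<close>

lemma (in cring) colon_ideal:
  assumes "ideal I R" and U: "U \<subseteq> carrier R"
  shows "ideal {z \<in> carrier R. \<forall>t\<in>U. z \<otimes> t \<in> I} R"
proof -
  interpret I: ideal I R by fact
  show ?thesis
  proof (rule idealI)
    show "subgroup {z \<in> carrier R. \<forall>t\<in>U. z \<otimes> t \<in> I} (add_monoid R)"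
    proof (rule add.subgroupI)
      show "\<ominus> z \<in> {z \<in> carrier R. \<forall>t\<in>U. z \<otimes> t \<in> I}"
        if "z \<in> {z \<in> carrier R. \<forall>t\<in>U. z \<otimes> t \<in> I}" for z
        using that U by (auto simp: l_minus subset_iff)
    qed (use U in \<open>auto simp: l_distr subset_iff\<close>)
    fix a x assume a: "a \<in> {z \<in> carrier R. \<forall>t\<in>U. z \<otimes> t \<in> I}" and x: "x \<in> carrier R"
    then show "x \<otimes> a \<in> {z \<in> carrier R. \<forall>t\<in>U. z \<otimes> t \<in> I}"
      using U by (auto simp: m_assoc subset_iff I.I_l_closed)
    then show "a \<otimes> x \<in> {z \<in> carrier R. \<forall>t\<in>U. z \<otimes> t \<in> I}"
      using a x m_comm[of a x] by simp
  qed (rule ring_axioms)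
qed

lemma (in cring) genideal_mult_mem:
  assumes I: "ideal I R" and S: "S \<subseteq> carrier R" and T: "T \<subseteq> carrier R"
    and gen: "\<And>s t. \<lbrakk>s \<in> S; t \<in> T\<rbrakk> \<Longrightarrow> s \<otimes> t \<in> I"
    and "x \<in> Idl S" and "y \<in> Idl T"
  shows "x \<otimes> y \<in> I"
proof -
  have IS: "Idl S \<subseteq> carrier R" and IT: "Idl T \<subseteq> carrier R"
    using genideal_ideal[OF S] genideal_ideal[OF T] by (meson ideal.Icarr subsetI)+
  have 1: "Idl S \<subseteq> {z \<in> carrier R. \<forall>t\<in>T. z \<otimes> t \<in> I}"
    by (rule genideal_minimal[OF colon_ideal[OF I T]]) (use S gen in auto)
  have "t \<otimes> s \<in> I" if "s \<in> Idl S" "t \<in> T" for s t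
  proof -
    have "s \<otimes> t \<in> I" using 1 that by blast
    then show ?thesis using that IS T m_comm[of s t] by (simp add: subset_iff)
  qed
  then have "Idl T \<subseteq> {z \<in> carrier R. \<forall>s\<in>Idl S. z \<otimes> s \<in> I}"
    using T by (intro genideal_minimal[OF colon_ideal[OF I IS]]) blast
  then have "y \<otimes> x \<in> I" using assms(5,6) by blast
  then show ?thesis using assms(5,6) IS IT m_comm[of x y] by (simp add: subset_iff)
qed

lemma (in ring_hom_ring) genideal_vimage:
  assumes "G \<subseteq> carrier R" and "ideal I S" and "\<And>x. x \<in> G \<Longrightarrow> h x \<in> I" and "y \<in> Idl\<^bsub>R\<^esub> G"
  shows "h y \<in> I"
proof -
  have "Idl\<^bsub>R\<^esub> G \<subseteq> {r \<in> carrier R. h r \<in> I}"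
    by (rule R.genideal_minimal[OF ideal_vimage[OF assms(2)]]) (use assms(1,3) in auto)
  then show ?thesis using assms(4) by blast
qed

lemma (in ideal) quot_ring_carrier: "carrier (R Quot I) = (\<lambda>x. I +> x) ` carrier R"
  unfolding FactRing_def A_RCOSETS_def' by auto

lemma (in ideal) quot_genideal:
  assumes "G \<subseteq> carrier R"
  shows "(\<lambda>x. I +> x) ` (Idl G) = Idl\<^bsub>R Quot I\<^esub> ((\<lambda>x. I +> x) ` G)"
proof
  interpret q: ring_hom_ring R "R Quot I" "\<lambda>x. I +> x" by (rule rcos_ring_hom_ring)
  have G: "(\<lambda>x. I +> x) ` G \<subseteq> carrier (R Quot I)"
    using assms by (auto simp: quot_ring_carrier)
  show "(\<lambda>x. I +> x) ` (Idl G) \<subseteq> Idl\<^bsub>R Quot I\<^esub> ((\<lambda>x. I +> x) ` G)"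
    using q.genideal_vimage[OF assms q.S.genideal_ideal[OF G]] q.S.genideal_self[OF G] by blast
  show "Idl\<^bsub>R Quot I\<^esub> ((\<lambda>x. I +> x) ` G) \<subseteq> (\<lambda>x. I +> x) ` (Idl G)"
    by (intro q.S.genideal_minimal ring_ideal_imp_quot_ideal is_ideal genideal_ideal assms)
       (use genideal_self[OF assms] in blast)
qed

lemma (in ideal) quot_ring_lift:
  assumes "ring E" and h: "h \<in> ring_hom R E" and ker: "\<And>x. x \<in> I \<Longrightarrow> h x = \<zero>\<^bsub>E\<^esub>"
  shows "\<exists>h'. h' \<in> ring_hom (R Quot I) E \<and> (\<forall>x\<in>carrier R. h' (I +> x) = h x)"
proof -
  interpret e: ring E by fact
  interpret hom: ring_hom_ring R E h by (rule ring_hom_ringI2) (auto simp: h ring_axioms e.ring_axioms)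
  have eq: "h x = h y" if "x \<in> carrier R" "y \<in> carrier R" "I +> x = I +> y" for x y
  proof -
    have "x \<in> I +> y" using that a_rcos_self by metis
    then obtain i where "i \<in> I" "x = i \<oplus> y" by (auto simp: a_r_coset_def')
    then show ?thesis using that ker[of i] by (simp add: Icarr)
  qed
  define h' where "h' C = h (SOME x. x \<in> carrier R \<and> I +> x = C)" for C
  have h': "h' (I +> x) = h x" if "x \<in> carrier R" for x
    unfolding h'_def
  proof (rule someI2[of _ x])
    show "x \<in> carrier R \<and> I +> x = I +> x" using that by simp
    show "h y = h x" if "y \<in> carrier R \<and> I +> y = I +> x" for y
      using that \<open>x \<in> carrier R\<close> eq by blast
  qed
  interpret q: ring_hom_ring R "R Quot I" "\<lambda>x. I +> x" by (rule rcos_ring_hom_ring)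
  have "h' \<in> ring_hom (R Quot I) E"
  proof (rule ring_hom_memI)
    fix C assume "C \<in> carrier (R Quot I)"
    then obtain x where x: "x \<in> carrier R" "C = I +> x" by (auto simp: quot_ring_carrier)
    then show "h' C \<in> carrier E" by (simp add: h')
    fix C' assume "C' \<in> carrier (R Quot I)"
    then obtain y where y: "y \<in> carrier R" "C' = I +> y" by (auto simp: quot_ring_carrier)
    have "I +> (x \<otimes> y) = C \<otimes>\<^bsub>R Quot I\<^esub> C'" "I +> (x \<oplus> y) = C \<oplus>\<^bsub>R Quot I\<^esub> C'"
      using x y by (simp_all only: q.hom_mult q.hom_add)
    then show "h' (C \<otimes>\<^bsub>R Quot I\<^esub> C') = h' C \<otimes>\<^bsub>E\<^esub> h' C'"
      and "h' (C \<oplus>\<^bsub>R Quot I\<^esub> C') = h' C \<oplus>\<^bsub>E\<^esub> h' C'"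
      using x y h'[of "x \<otimes> y"] h'[of "x \<oplus> y"] by (simp_all add: h')
  next
    show "h' \<one>\<^bsub>R Quot I\<^esub> = \<one>\<^bsub>E\<^esub>"
      using h'[of "\<one>"] q.hom_one hom.hom_one by simp
  qed
  with h' show ?thesis by blast
qed

section \<open>The tensor power of an algebra\<close>

context ring_morphism
begin

lemma base_module_alg: "base_module K = alg_module B (rm_map K)"
  unfolding base_module_def alg_module_def Let_def ..

lemma base_module_module: "module A (base_module K)"
  unfolding base_module_alg by (rule alg_module_module[OF base_cring top_cring map_hom])

text \<open>The \<open>n + 1\<close> factors of the tensor power, and the tuple \<open>(1, \<dots>, 1)\<close> in them.\<close>

definition bases :: "nat \<Rightarrow> ('c, 'a) module list" where
  "bases n = replicate (n + 1) (base_module K)"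

definition ones :: "nat \<Rightarrow> 'a list" where
  "ones n = replicate (n + 1) \<one>\<^bsub>B\<^esub>"

lemma length_bases [simp]: "length (bases n) = Suc n"
  by (simp add: bases_def)

lemma nth_bases: "i \<le> n \<Longrightarrow> bases n ! i = base_module K"
  by (simp add: bases_def del: replicate_Suc)

lemma length_ones [simp]: "length (ones n) = Suc n"
  by (simp add: ones_def)

lemma nth_ones [simp]: "i \<le> n \<Longrightarrow> ones n ! i = \<one>\<^bsub>B\<^esub>"
  by (simp add: ones_def del: replicate_Suc)

abbreviation "tensors n \<equiv> tensor A (bases n)"
abbreviation "pure n \<equiv> pure_tensor A (bases n)"
abbreviation "power_ring \<equiv> tensor_power K"

lemma bases_module: "i < length (bases n) \<Longrightarrow> module A (bases n ! i)"
  by (simp add: nth_bases base_module_module)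

lemma tensors_module: "module A (tensors n)"
  by (rule tensor_module[OF base_cring bases_module])

lemma tuples_bases:
  "xs \<in> tuples (bases n) \<longleftrightarrow> length xs = Suc n \<and> (\<forall>i\<le>n. xs ! i \<in> carrier B)"
  by (auto simp: tuples_iff nth_bases less_Suc_eq_le base_module_alg)

lemma pure_closed: "xs \<in> tuples (bases n) \<Longrightarrow> pure n xs \<in> carrier (tensors n)"
  by (rule pure_tensor_closed[OF base_cring bases_module])

lemma pure_multilinear: "multilinear A (bases n) (tensors n) (pure n)"
  by (rule pure_tensor_multilinear[OF base_cring bases_module])

lemma pure_spans: "spans A (tensors n) (pure n ` tuples (bases n))"
  by (rule pure_tensor_spans[OF base_cring bases_module])

lemma tensors_induct [consumes 1, case_names pure add]:
  assumes "x \<in> carrier (tensors n)"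
    and "\<And>xs. xs \<in> tuples (bases n) \<Longrightarrow> Q (pure n xs)"
    and "\<And>x y. \<lbrakk>x \<in> carrier (tensors n); y \<in> carrier (tensors n); Q x; Q y\<rbrakk> \<Longrightarrow> Q (x \<oplus>\<^bsub>tensors n\<^esub> y)"
  shows "Q x"
proof (rule tensor_induct[OF base_cring bases_module _ assms(1)])
  show "bases n \<noteq> []" by (simp add: bases_def)
qed (use assms(2,3) in auto)

abbreviation "mult_list xs ys \<equiv> map2 (\<lambda>x y. x \<otimes>\<^bsub>B\<^esub> y) xs ys"

lemma mult_list_tuple:
  "\<lbrakk>xs \<in> tuples (bases n); ys \<in> tuples (bases n)\<rbrakk> \<Longrightarrow> mult_list xs ys \<in> tuples (bases n)"
  unfolding tuples_bases by auto

lemma mult_list_comm: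
  assumes "xs \<in> tuples (bases n)" and "ys \<in> tuples (bases n)"
  shows "mult_list xs ys = mult_list ys xs"
  using assms unfolding tuples_bases
  by (intro nth_equalityI) (auto simp: less_Suc_eq_le intro: B.m_comm)

lemma mult_list_assoc:
  assumes "xs \<in> tuples (bases n)" and "ys \<in> tuples (bases n)" and "zs \<in> tuples (bases n)"
  shows "mult_list (mult_list xs ys) zs = mult_list xs (mult_list ys zs)"
  using assms unfolding tuples_bases
  by (intro nth_equalityI) (auto simp: less_Suc_eq_le intro: B.m_assoc)

lemma mult_list_linear:
  assumes xs: "xs \<in> tuples (bases n)" and ys: "ys \<in> tuples (bases n)" and i: "i < length (bases n)"
  shows "linear_on A (bases n ! i) (tensors n) (\<lambda>x. pure n (mult_list (xs[i := x]) ys))"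
proof -
  have len: "length xs = Suc n" "length ys = Suc n" using xs ys by (simp_all add: tuples_bases)
  have "mult_list (xs[i := x]) ys = (mult_list xs ys)[i := x \<otimes>\<^bsub>B\<^esub> ys ! i]" for x
    using len i by (intro nth_equalityI) (auto simp: nth_list_update)
  moreover have "linear_on A (bases n ! i) (bases n ! i) (\<lambda>x. x \<otimes>\<^bsub>B\<^esub> ys ! i)"
  proof -
    have y: "ys ! i \<in> carrier B" using ys i by (simp add: tuples_bases)
    have "linear_on A (base_module K) (base_module K) (\<lambda>x. x \<otimes>\<^bsub>B\<^esub> ys ! i)"
      using y by (intro linear_onI) (auto simp: base_module_alg B.l_distr B.m_assoc map_closed)
    then show ?thesis using i by (simp add: nth_bases)
  qed
  ultimately show ?thesis
    using linear_on_comp[OF _ multilinearD(2)[OF pure_multilinear mult_list_tuple[OF xs ys] i]] by simp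
qed

text \<open>The multiplication of the tensor power is again a definite description. It exists since
  factorwise multiplication is multilinear in each of the two tuples.\<close>

lemma power_mult_spec:
  "monoid.mult (power_ring n) \<in> bilinear_maps A (tensors n) (tensors n) (tensors n) \<and>
     (\<forall>xs\<in>tuples (bases n). \<forall>ys\<in>tuples (bases n).
        monoid.mult (power_ring n) (pure n xs) (pure n ys) = pure n (mult_list xs ys))"
proof -
  have lift: "\<exists>h. linear_on A (tensors n) (tensors n) h \<and>
      (\<forall>xs\<in>tuples (bases n). h (pure n xs) = pure n (mult_list xs ys))"
    if ys: "ys \<in> tuples (bases n)" for ys
    by (rule tensor_universal[OF base_cring bases_module tensors_module])
       (auto simp: multilinear_def pure_closed mult_list_tuple ys mult_list_linear[OF _ ys])
  have "\<exists>!p. p \<in> bilinear_maps A (tensors n) (tensors n) (tensors n) \<and>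
     (\<forall>xs\<in>tuples (bases n). \<forall>ys\<in>tuples (bases n). p (pure n xs) (pure n ys) = pure n (mult_list xs ys))"
  proof (rule bilinear_lift[OF tensors_module tensors_module tensors_module pure_spans pure_spans lift])
    show "\<exists>h. linear_on A (tensors n) (tensors n) h \<and>
        (\<forall>ys\<in>tuples (bases n). h (pure n ys) = pure n (mult_list xs ys))"
      if xs: "xs \<in> tuples (bases n)" for xs
      using lift[OF xs] mult_list_comm[OF xs] by metis
  qed
  from theI'[OF this] show ?thesis
    unfolding tensor_power_def Let_def monoid.simps bases_def .
qed

lemma power_simps [simp]:
  "carrier (power_ring n) = carrier (tensors n)" "\<zero>\<^bsub>power_ring n\<^esub> = \<zero>\<^bsub>tensors n\<^esub>"
  "ring.add (power_ring n) = ring.add (tensors n)" "\<one>\<^bsub>power_ring n\<^esub> = pure n (ones n)"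
  unfolding tensor_power_def Let_def bases_def ones_def by simp_all

lemmas power_bilinear = bilinear_mapsD[OF tensors_module conjunct1[OF power_mult_spec]]

lemma power_mult_pure:
  "\<lbrakk>xs \<in> tuples (bases n); ys \<in> tuples (bases n)\<rbrakk>
     \<Longrightarrow> pure n xs \<otimes>\<^bsub>power_ring n\<^esub> pure n ys = pure n (mult_list xs ys)"
  using power_mult_spec by blast

lemma ones_tuple: "ones n \<in> tuples (bases n)"
  unfolding tuples_bases by simp

lemma power_ring_cring: "cring (power_ring n)"
proof -
  let ?P = "power_ring n"
  interpret t: module A "tensors n" by (rule tensors_module)
  have closed: "x \<otimes>\<^bsub>?P\<^esub> y \<in> carrier (tensors n)"
    if "x \<in> carrier (tensors n)" "y \<in> carrier (tensors n)" for x y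
    using linear_onD(1)[OF power_bilinear(1)[OF that(1)] that(2)] .
  have ld: "(x \<oplus>\<^bsub>tensors n\<^esub> x') \<otimes>\<^bsub>?P\<^esub> y = x \<otimes>\<^bsub>?P\<^esub> y \<oplus>\<^bsub>tensors n\<^esub> x' \<otimes>\<^bsub>?P\<^esub> y"
    and rd: "y \<otimes>\<^bsub>?P\<^esub> (x \<oplus>\<^bsub>tensors n\<^esub> x') = y \<otimes>\<^bsub>?P\<^esub> x \<oplus>\<^bsub>tensors n\<^esub> y \<otimes>\<^bsub>?P\<^esub> x'"
    if "x \<in> carrier (tensors n)" "x' \<in> carrier (tensors n)" "y \<in> carrier (tensors n)" for x x' y
    using linear_onD(2)[OF power_bilinear(1)[OF that(3)] that(1,2)]
      linear_onD(2)[OF power_bilinear(2)[OF that(3)] that(1,2)] by simp_all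
  have comm1: "pure n xs \<otimes>\<^bsub>?P\<^esub> y = y \<otimes>\<^bsub>?P\<^esub> pure n xs"
    if "xs \<in> tuples (bases n)" "y \<in> carrier (tensors n)" for xs y
    using that(2)
  proof (induction rule: tensors_induct)
    case (pure ys)
    then show ?case using that(1) mult_list_comm by (simp only: power_mult_pure)
  next
    case (add x y)
    then show ?case using pure_closed[OF that(1)] by (simp only: ld rd)
  qed
  have comm: "x \<otimes>\<^bsub>?P\<^esub> y = y \<otimes>\<^bsub>?P\<^esub> x"
    if "x \<in> carrier (tensors n)" "y \<in> carrier (tensors n)" for x y
    using that(1)
  proof (induction rule: tensors_induct)
    case (pure ys)
    then show ?case using that(2) by (rule comm1)
  next
    case (add x y')
    then show ?case using that(2) by (simp only: ld rd)
  qed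
  have assoc1: "pure n xs \<otimes>\<^bsub>?P\<^esub> pure n ys \<otimes>\<^bsub>?P\<^esub> z = pure n xs \<otimes>\<^bsub>?P\<^esub> (pure n ys \<otimes>\<^bsub>?P\<^esub> z)"
    if "xs \<in> tuples (bases n)" "ys \<in> tuples (bases n)" "z \<in> carrier (tensors n)" for xs ys z
    using that(3)
  proof (induction rule: tensors_induct)
    case (pure zs)
    then show ?case
      using that by (simp only: power_mult_pure mult_list_tuple mult_list_assoc)
  next
    case (add x y)
    then show ?case using pure_closed[OF that(1)] pure_closed[OF that(2)] by (simp only: rd closed)
  qed
  have assoc2: "pure n xs \<otimes>\<^bsub>?P\<^esub> y \<otimes>\<^bsub>?P\<^esub> z = pure n xs \<otimes>\<^bsub>?P\<^esub> (y \<otimes>\<^bsub>?P\<^esub> z)"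
    if "xs \<in> tuples (bases n)" "y \<in> carrier (tensors n)" "z \<in> carrier (tensors n)" for xs y z
    using that(2)
  proof (induction rule: tensors_induct)
    case (pure zs)
    then show ?case using that by (intro assoc1)
  next
    case (add x y)
    then show ?case using pure_closed[OF that(1)] that(3) by (simp only: ld rd closed)
  qed
  have assoc: "x \<otimes>\<^bsub>?P\<^esub> y \<otimes>\<^bsub>?P\<^esub> z = x \<otimes>\<^bsub>?P\<^esub> (y \<otimes>\<^bsub>?P\<^esub> z)"
    if "x \<in> carrier (tensors n)" "y \<in> carrier (tensors n)" "z \<in> carrier (tensors n)" for x y z
    using that(1)
  proof (induction rule: tensors_induct)
    case (pure zs)
    then show ?case using that by (intro assoc2)
  next
    case (add x y)
    then show ?case using that(2,3) by (simp only: ld closed)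
  qed
  have one: "pure n (ones n) \<otimes>\<^bsub>?P\<^esub> x = x" if "x \<in> carrier (tensors n)" for x
    using that
  proof (induction rule: tensors_induct)
    case (pure xs)
    have "mult_list (ones n) xs = xs"
      using pure unfolding tuples_bases by (intro nth_equalityI) (auto simp: less_Suc_eq_le)
    then show ?case using pure ones_tuple by (simp only: power_mult_pure)
  next
    case (add x y)
    then show ?case using pure_closed[OF ones_tuple] by (simp only: rd)
  qed
  show ?thesis
  proof (rule cringI)
    show "abelian_group ?P"
    proof (rule abelian_groupI)
      show "\<exists>y\<in>carrier ?P. y \<oplus>\<^bsub>?P\<^esub> x = \<zero>\<^bsub>?P\<^esub>" if "x \<in> carrier ?P" for x
        using that t.M.l_neg[of x] by (intro bexI[of _ "\<ominus>\<^bsub>tensors n\<^esub> x"]) simp_all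
    qed (simp_all add: t.M.a_ac)
    show "comm_monoid ?P"
      by (rule comm_monoidI, unfold power_simps)
         (fact closed, fact pure_closed[OF ones_tuple], fact assoc, fact one, fact comm)
  qed (simp add: ld)
qed

subsection \<open>The factors\<close>

lemma at_factor_pure: "at_factor K n i b = pure n ((ones n)[i := b])"
  unfolding at_factor_def bases_def ones_def ..

lemma at_factor_tuple: "b \<in> carrier B \<Longrightarrow> (ones n)[i := b] \<in> tuples (bases n)"
  by (cases "i \<le> n") (auto simp: tuples_bases nth_list_update)

lemma at_factor_linear:
  assumes "i \<le> n"
  shows "linear_on A (base_module K) (tensors n) (at_factor K n i)"
  using multilinearD(2)[OF pure_multilinear ones_tuple, of i n] assms
  unfolding at_factor_pure[abs_def] by (simp add: nth_bases)

lemma at_factor_ring_hom: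
  assumes i: "i \<le> n"
  shows "at_factor K n i \<in> ring_hom B (power_ring n)"
proof (rule ring_hom_memI)
  fix b assume b: "b \<in> carrier B"
  show "at_factor K n i b \<in> carrier (power_ring n)"
    unfolding at_factor_pure power_simps by (rule pure_closed[OF at_factor_tuple[OF b]])
  fix c assume c: "c \<in> carrier B"
  show "at_factor K n i (b \<oplus>\<^bsub>B\<^esub> c) = at_factor K n i b \<oplus>\<^bsub>power_ring n\<^esub> at_factor K n i c"
    using linear_onD(2)[OF at_factor_linear[OF i]] b c by (simp add: base_module_alg)
  have "mult_list ((ones n)[i := b]) ((ones n)[i := c]) = (ones n)[i := b \<otimes>\<^bsub>B\<^esub> c]"
    using b c i by (intro nth_equalityI) (auto simp: nth_list_update less_Suc_eq_le)
  then show "at_factor K n i (b \<otimes>\<^bsub>B\<^esub> c) = at_factor K n i b \<otimes>\<^bsub>power_ring n\<^esub> at_factor K n i c"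
    unfolding at_factor_pure using power_mult_pure[OF at_factor_tuple[OF b] at_factor_tuple[OF c], of n i i]
    by simp
next
  have "(ones n)[i := \<one>\<^bsub>B\<^esub>] = ones n"
    using i by (intro nth_equalityI) (auto simp: nth_list_update less_Suc_eq_le)
  then show "at_factor K n i \<one>\<^bsub>B\<^esub> = \<one>\<^bsub>power_ring n\<^esub>"
    unfolding at_factor_pure power_simps by simp
qed

lemma at_factor_scalar:
  assumes i: "i \<le> n" and a: "a \<in> carrier A"
  shows "at_factor K n i (rm_map K a) = a \<odot>\<^bsub>tensors n\<^esub> \<one>\<^bsub>power_ring n\<^esub>"
proof -
  have "at_factor K n i (a \<odot>\<^bsub>base_module K\<^esub> \<one>\<^bsub>B\<^esub>) = a \<odot>\<^bsub>tensors n\<^esub> at_factor K n i \<one>\<^bsub>B\<^esub>"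
    by (rule linear_onD(3)[OF at_factor_linear[OF i] a]) (simp add: base_module_alg)
  then show ?thesis
    using ring_hom_one[OF at_factor_ring_hom[OF i]] map_closed[OF a] by (simp add: base_module_alg)
qed

lemma pure_eq_finprod:
  assumes xs: "xs \<in> tuples (bases n)"
  shows "pure n xs = (\<Otimes>\<^bsub>power_ring n\<^esub>i\<in>{..n}. at_factor K n i (xs ! i))"
proof -
  interpret p: cring "power_ring n" by (rule power_ring_cring)
  have len: "length xs = Suc n" and xB: "\<And>i. i \<le> n \<Longrightarrow> xs ! i \<in> carrier B"
    using xs by (auto simp: tuples_bases)
  have fc: "at_factor K n i (xs ! i) \<in> carrier (power_ring n)" if "i \<le> n" for i
    using ring_hom_closed[OF at_factor_ring_hom] xB that by blast
  have "(\<Otimes>\<^bsub>power_ring n\<^esub>i\<in>{..<k}. at_factor K n i (xs ! i)) = pure n (take k xs @ drop k (ones n))"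
    if "k \<le> Suc n" for k
    using that
  proof (induction k)
    case 0
    then show ?case by simp
  next
    case (Suc k)
    have tk: "take k xs @ drop k (ones n) \<in> tuples (bases n)"
      using len xB Suc.prems by (auto simp: tuples_bases nth_append)
    have "(\<Otimes>\<^bsub>power_ring n\<^esub>i\<in>{..<Suc k}. at_factor K n i (xs ! i)) =
        at_factor K n k (xs ! k) \<otimes>\<^bsub>power_ring n\<^esub> (\<Otimes>\<^bsub>power_ring n\<^esub>i\<in>{..<k}. at_factor K n i (xs ! i))"
      unfolding lessThan_Suc using Suc.prems fc by (intro p.finprod_insert) auto
    also have "\<dots> = at_factor K n k (xs ! k) \<otimes>\<^bsub>power_ring n\<^esub> pure n (take k xs @ drop k (ones n))"
      using Suc by simp
    also have "\<dots> = pure n (mult_list ((ones n)[k := xs ! k]) (take k xs @ drop k (ones n)))"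
      unfolding at_factor_pure using Suc.prems xB by (intro power_mult_pure at_factor_tuple tk) auto
    also have "mult_list ((ones n)[k := xs ! k]) (take k xs @ drop k (ones n)) =
        take (Suc k) xs @ drop (Suc k) (ones n)"
    proof (rule nth_equalityI)
      fix i assume "i < length (mult_list ((ones n)[k := xs ! k]) (take k xs @ drop k (ones n)))"
      then have i: "i \<le> n" using len Suc.prems by simp
      consider "i < k" | "i = k" | "k < i" by linarith
      then show "mult_list ((ones n)[k := xs ! k]) (take k xs @ drop k (ones n)) ! i =
          (take (Suc k) xs @ drop (Suc k) (ones n)) ! i"
        using i len xB[of i] Suc.prems by cases (simp_all add: nth_append nth_list_update)
    qed (use len Suc.prems in simp)
    finally show ?case .
  qed
  from this[of "Suc n"] show ?thesis using len by (simp add: lessThan_Suc_atMost)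
qed

text \<open>\<open>B \<otimes>\<^sub>A \<dots> \<otimes>\<^sub>A B\<close> is the coproduct of \<open>n + 1\<close> copies of the \<open>A\<close>-algebra \<open>B\<close>: existence here,
  uniqueness in \<open>power_ring_hom_unique\<close>.\<close>

lemma tensor_power_universal:
  fixes E :: "'e ring"
  assumes E: "cring E" and e: "\<And>i. i \<le> n \<Longrightarrow> e i \<in> ring_hom B E"
    and scalar: "\<And>i a. \<lbrakk>i \<le> n; a \<in> carrier A\<rbrakk> \<Longrightarrow> e i (rm_map K a) = e 0 (rm_map K a)"
  shows "\<exists>h. h \<in> ring_hom (power_ring n) E \<and> (\<forall>i\<le>n. \<forall>b\<in>carrier B. h (at_factor K n i b) = e i b)"
proof -
  interpret e: cring E by fact
  interpret p: cring "power_ring n" by (rule power_ring_cring)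
  let ?\<rho> = "\<lambda>a. e 0 (rm_map K a)" and ?f = "\<lambda>xs. \<Otimes>\<^bsub>E\<^esub>i\<in>{..n}. e i (xs ! i)"
  note eD = ring_hom_closed[OF e] ring_hom_mult[OF e] ring_hom_add[OF e] ring_hom_one[OF e]
  have \<rho>: "?\<rho> \<in> ring_hom A E"
    using ring_hom_trans[OF map_hom e[of 0]] by (simp add: comp_def)
  have P: "module A (alg_module E ?\<rho>)"
    by (rule alg_module_module[OF base_cring E \<rho>])
  have lin: "linear_on A (bases n ! i) (alg_module E ?\<rho>) (e i)" if "i < length (bases n)" for i
  proof -
    have i: "i \<le> n" using that by simp
    have "linear_on A (base_module K) (alg_module E ?\<rho>) (e i)"
      by (rule linear_onI) (simp_all add: base_module_alg eD[OF i] map_closed scalar[OF i])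
    then show ?thesis using i by (simp add: nth_bases)
  qed
  have "multilinear A (bases n) (alg_module E ?\<rho>) ?f"
    using multilinear_finprod[OF E base_cring \<rho> bases_module lin] by (simp add: lessThan_Suc_atMost)
  from tensor_universal[OF base_cring bases_module P this]
  obtain h where h: "linear_on A (tensors n) (alg_module E ?\<rho>) h"
    "\<And>xs. xs \<in> tuples (bases n) \<Longrightarrow> h (pure n xs) = ?f xs" by blast
  have ec: "e i (xs ! i) \<in> carrier E" if "xs \<in> tuples (bases n)" "i \<le> n" for xs i
    using that eD(1)[of i "xs ! i"] by (auto simp: tuples_bases)
  have hc: "h x \<in> carrier E" if "x \<in> carrier (tensors n)" for x
    using linear_onD(1)[OF h(1) that] by simp
  have hadd: "h (x \<oplus>\<^bsub>tensors n\<^esub> y) = h x \<oplus>\<^bsub>E\<^esub> h y" if "x \<in> carrier (tensors n)" "y \<in> carrier (tensors n)" for x y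
    using linear_onD(2)[OF h(1) that] by simp
  have mult1: "h (pure n xs \<otimes>\<^bsub>power_ring n\<^esub> y) = h (pure n xs) \<otimes>\<^bsub>E\<^esub> h y"
    if "xs \<in> tuples (bases n)" "y \<in> carrier (tensors n)" for xs y
    using that(2)
  proof (induction rule: tensors_induct)
    case (pure ys)
    have "?f (mult_list xs ys) = (\<Otimes>\<^bsub>E\<^esub>i\<in>{..n}. e i (xs ! i) \<otimes>\<^bsub>E\<^esub> e i (ys ! i))"
      using that(1) pure ec[OF that(1)] ec[OF pure]
      by (intro e.finprod_cong') (auto simp: tuples_bases eD(2) less_Suc_eq_le)
    also have "\<dots> = ?f xs \<otimes>\<^bsub>E\<^esub> ?f ys"
      using ec[OF that(1)] ec[OF pure] by (intro e.finprod_multf) auto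
    finally show ?case
      by (simp only: power_mult_pure[OF that(1) pure] h(2)[OF mult_list_tuple[OF that(1) pure]]
          h(2)[OF that(1)] h(2)[OF pure])
  next
    case (add x y)
    then show ?case
      using pure_closed[OF that(1)] p.r_distr[of x y "pure n xs"] p.m_closed[of "pure n xs"]
      by (simp add: hadd hc e.r_distr)
  qed
  have "h \<in> ring_hom (power_ring n) E"
  proof (rule ring_hom_memI)
    fix x assume x: "x \<in> carrier (power_ring n)"
    then show "h x \<in> carrier E" by (simp add: hc)
    fix y assume y: "y \<in> carrier (power_ring n)"
    then show "h (x \<oplus>\<^bsub>power_ring n\<^esub> y) = h x \<oplus>\<^bsub>E\<^esub> h y" using x by (simp add: hadd)
    have "x \<in> carrier (tensors n)" using x by simp
    then show "h (x \<otimes>\<^bsub>power_ring n\<^esub> y) = h x \<otimes>\<^bsub>E\<^esub> h y"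
    proof (induction rule: tensors_induct)
      case (pure xs)
      then show ?case using y by (simp add: mult1)
    next
      case (add x x')
      then show ?case
        using y p.l_distr[of x x' y] p.m_closed[of _ y] by (simp add: hadd hc e.l_distr)
    qed
  next
    have "?f (ones n) = (\<Otimes>\<^bsub>E\<^esub>i\<in>{..n}. \<one>\<^bsub>E\<^esub>)"
      by (intro e.finprod_cong') (auto simp: eD less_Suc_eq_le)
    then show "h \<one>\<^bsub>power_ring n\<^esub> = \<one>\<^bsub>E\<^esub>" by (simp only: power_simps h(2)[OF ones_tuple] e.finprod_one)
  qed
  moreover have "h (at_factor K n i b) = e i b" if i: "i \<le> n" and b: "b \<in> carrier B" for i b
  proof -
    have "?f ((ones n)[i := b]) = (\<Otimes>\<^bsub>E\<^esub>j\<in>{..n}. if i = j then e i b else \<one>\<^bsub>E\<^esub>)"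
      using i b by (intro e.finprod_cong') (auto simp: nth_list_update eD less_Suc_eq_le)
    also have "\<dots> = e i b"
      using i b eD(1)[OF i b] by (intro e.finprod_singleton) auto
    finally show ?thesis
      by (simp only: at_factor_pure h(2)[OF at_factor_tuple[OF b]])
  qed
  ultimately show ?thesis by blast
qed

lemma power_ring_hom_unique:
  assumes E: "cring E" and h: "h \<in> ring_hom (power_ring n) E" and k: "k \<in> ring_hom (power_ring n) E"
    and eq: "\<And>i b. \<lbrakk>i \<le> n; b \<in> carrier B\<rbrakk> \<Longrightarrow> h (at_factor K n i b) = k (at_factor K n i b)"
    and x: "x \<in> carrier (power_ring n)"
  shows "h x = k x"
proof -
  interpret h: ring_hom_cring "power_ring n" E h
    by (intro ring_hom_cring.intro ring_hom_cring_axioms.intro power_ring_cring E h)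
  interpret k: ring_hom_cring "power_ring n" E k
    by (intro ring_hom_cring.intro ring_hom_cring_axioms.intro power_ring_cring E k)
  have "x \<in> carrier (tensors n)" using x by simp
  then show ?thesis
  proof (induction rule: tensors_induct)
    case (pure xs)
    have xB: "xs ! i \<in> carrier B" if "i \<le> n" for i
      using pure that by (auto simp: tuples_bases)
    have ac: "at_factor K n i (xs ! i) \<in> carrier (power_ring n)" if "i \<le> n" for i
      using ring_hom_closed[OF at_factor_ring_hom, of i n] xB[OF that] that by simp
    have "(\<Otimes>\<^bsub>E\<^esub>i\<in>{..n}. h (at_factor K n i (xs ! i))) =
        (\<Otimes>\<^bsub>E\<^esub>i\<in>{..n}. k (at_factor K n i (xs ! i)))"
      using eq xB ac by (intro h.S.finprod_cong') (auto simp: less_Suc_eq_le)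
    then show ?case
      unfolding pure_eq_finprod[OF pure]
      using ac h.hom_finprod[of "\<lambda>i. at_factor K n i (xs ! i)" "{..n}"]
        k.hom_finprod[of "\<lambda>i. at_factor K n i (xs ! i)" "{..n}"]
      by (simp add: Pi_def comp_def)
  next
    case (add x y)
    then show ?case using h.hom_add[of x y] k.hom_add[of x y] by simp
  qed
qed

end

section \<open>The coordinate rings of first-order neighbourhoods\<close>

lemma submodule_as_module:
  assumes "module R M" and "submodule H R M" and "carrier M' = H" and "\<zero>\<^bsub>M'\<^esub> = \<zero>\<^bsub>M\<^esub>"
    and "ring.add M' = ring.add M" and "\<And>r x. r \<odot>\<^bsub>M'\<^esub> x = r \<odot>\<^bsub>M\<^esub> x"
  shows "module R M'"
proof -
  interpret m: module R M by fact
  note H = submoduleD[OF assms(1,2)]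
  have Hc: "x \<in> carrier M" if "x \<in> H" for x using H(1) that by blast
  show ?thesis
  proof (rule moduleI)
    show "abelian_group M'"
    proof (rule abelian_groupI)
      show "\<exists>y\<in>carrier M'. y \<oplus>\<^bsub>M'\<^esub> x = \<zero>\<^bsub>M'\<^esub>" if "x \<in> carrier M'" for x
        using that H(5)[of "\<zero>\<^bsub>M\<^esub>" x] H(2) m.M.l_neg[of x]
        by (intro bexI[of _ "\<zero>\<^bsub>M\<^esub> \<ominus>\<^bsub>M\<^esub> x"]) (simp_all add: assms(3-5) a_minus_def Hc)
    qed (simp_all add: assms(3-5) H Hc m.M.a_ac)
  qed (simp_all add: assms(3-6) H Hc m.R.is_cring m.smult_l_distr m.smult_r_distr m.smult_assoc1)
qed

context ring_morphism
begin

abbreviation "dring \<equiv> Delta_ring K"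
abbreviation "cls \<equiv> Delta_class K"

text \<open>The function \<open>b(x\<^sub>i)\<close> on \<open>\<Delta>\<^bsup>(n)\<^esup>\<close>, the difference \<open>b(x\<^sub>s) - b(x\<^sub>r)\<close>, and the ideal of functions
  that vanish where \<open>x\<^sub>r = x\<^sub>s\<close>.\<close>

abbreviation "coord n i b \<equiv> cls n (at_factor K n i b)"
abbreviation "del n r s b \<equiv> cls n (dd K n r s b)"
abbreviation "Jbar n r s \<equiv> cls n ` J K n r s"

lemma at_factor_closed: "\<lbrakk>i \<le> n; b \<in> carrier B\<rbrakk> \<Longrightarrow> at_factor K n i b \<in> carrier (power_ring n)"
  by (rule ring_hom_closed[OF at_factor_ring_hom])

lemma dd_closed: "\<lbrakk>r \<le> n; s \<le> n; b \<in> carrier B\<rbrakk> \<Longrightarrow> dd K n r s b \<in> carrier (power_ring n)"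
proof -
  assume a: "r \<le> n" "s \<le> n" "b \<in> carrier B"
  interpret p: cring "power_ring n" by (rule power_ring_cring)
  show ?thesis unfolding dd_def by (intro p.minus_closed at_factor_closed a)
qed

lemma dd_image_closed: "\<lbrakk>r \<le> n; s \<le> n\<rbrakk> \<Longrightarrow> dd K n r s ` carrier B \<subseteq> carrier (power_ring n)"
  using dd_closed by blast

lemma J_ideal:
  assumes "r \<le> n" and "s \<le> n"
  shows "ideal (J K n r s) (power_ring n)"
proof -
  interpret p: cring "power_ring n" by (rule power_ring_cring)
  show ?thesis unfolding J_def by (rule p.genideal_ideal[OF dd_image_closed[OF assms]])
qed

abbreviation "J_squares n \<equiv> (\<Union>s\<in>{0..n}. \<Union>r\<in>{0..<s}. J K n r s \<cdot>\<^bsub>power_ring n\<^esub> J K n r s)"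

lemma J_squares_closed: "J_squares n \<subseteq> carrier (power_ring n)"
proof -
  interpret p: cring "power_ring n" by (rule power_ring_cring)
  have "J K n r s \<cdot>\<^bsub>power_ring n\<^esub> J K n r s \<subseteq> carrier (power_ring n)" if "s \<le> n" "r < s" for r s
    using that by (intro p.ideal_prod_in_carrier J_ideal) auto
  then show ?thesis by fastforce
qed

lemma J2_ideal: "ideal (J2 K n) (power_ring n)"
proof -
  interpret p: cring "power_ring n" by (rule power_ring_cring)
  show ?thesis unfolding J2_def by (rule p.genideal_ideal[OF J_squares_closed])
qed

lemma cls_def': "cls n = (\<lambda>x. J2 K n +>\<^bsub>power_ring n\<^esub> x)"
  by (rule ext) (simp add: Delta_class_def)

lemma dring_cring: "cring (dring n)"
  unfolding Delta_ring_def by (rule ideal.quotient_is_cring[OF J2_ideal power_ring_cring])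

lemma cls_hom: "cls n \<in> ring_hom (power_ring n) (dring n)"
  unfolding cls_def' Delta_ring_def by (rule ideal.rcos_ring_hom[OF J2_ideal])

lemma cls_ring_hom_cring: "ring_hom_cring (power_ring n) (dring n) (cls n)"
  by (intro ring_hom_cring.intro ring_hom_cring_axioms.intro power_ring_cring dring_cring cls_hom)

lemma dring_carrier: "carrier (dring n) = cls n ` carrier (power_ring n)"
  unfolding cls_def' Delta_ring_def by (rule ideal.quot_ring_carrier[OF J2_ideal])

lemma coord_hom: "i \<le> n \<Longrightarrow> coord n i \<in> ring_hom B (dring n)"
  using ring_hom_trans[OF at_factor_ring_hom cls_hom, of i n] by (simp add: comp_def)

lemmas coord_closed = ring_hom_closed[OF coord_hom]

lemma coord_scalar:
  "\<lbrakk>i \<le> n; a \<in> carrier A\<rbrakk> \<Longrightarrow> coord n i (rm_map K a) = coord n 0 (rm_map K a)"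
  by (simp add: at_factor_scalar)

lemma del_eq:
  assumes "r \<le> n" and "s \<le> n" and "b \<in> carrier B"
  shows "del n r s b = coord n s b \<ominus>\<^bsub>dring n\<^esub> coord n r b"
proof -
  interpret h: ring_hom_cring "power_ring n" "dring n" "cls n" by (rule cls_ring_hom_cring)
  show ?thesis
    using at_factor_closed[OF assms(1,3)] at_factor_closed[OF assms(2,3)]
    unfolding dd_def a_minus_def by (simp only: h.hom_add h.hom_a_inv h.R.a_inv_closed)
qed

lemma del_closed: "\<lbrakk>r \<le> n; s \<le> n; b \<in> carrier B\<rbrakk> \<Longrightarrow> del n r s b \<in> carrier (dring n)"
  using dd_closed unfolding dring_carrier by blast

lemma Jbar_eq:
  assumes "r \<le> n" and "s \<le> n"
  shows "Jbar n r s = Idl\<^bsub>dring n\<^esub> (del n r s ` carrier B)"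
  using ideal.quot_genideal[OF J2_ideal dd_image_closed[OF assms]]
  unfolding cls_def'[symmetric] Delta_ring_def[symmetric] J_def[symmetric] image_image .

lemma del_image_closed: "\<lbrakk>r \<le> n; s \<le> n\<rbrakk> \<Longrightarrow> del n r s ` carrier B \<subseteq> carrier (dring n)"
  using del_closed by blast

lemma Jbar_ideal:
  assumes "r \<le> n" and "s \<le> n"
  shows "ideal (Jbar n r s) (dring n)"
proof -
  interpret d: cring "dring n" by (rule dring_cring)
  show ?thesis unfolding Jbar_eq[OF assms] by (rule d.genideal_ideal[OF del_image_closed[OF assms]])
qed

lemma del_in_Jbar:
  assumes "r \<le> n" and "s \<le> n" and "b \<in> carrier B"
  shows "del n r s b \<in> Jbar n r s"
proof -
  interpret d: cring "dring n" by (rule dring_cring)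
  show ?thesis
    unfolding Jbar_eq[OF assms(1,2)] using d.genideal_self[OF del_image_closed[OF assms(1,2)]] assms(3)
    by blast
qed

lemma Jbar_mult_zero:
  assumes "r < s" and "s \<le> n" and "x \<in> Jbar n r s" and "y \<in> Jbar n r s"
  shows "x \<otimes>\<^bsub>dring n\<^esub> y = \<zero>\<^bsub>dring n\<^esub>"
proof -
  interpret h: ring_hom_cring "power_ring n" "dring n" "cls n" by (rule cls_ring_hom_cring)
  interpret i: ideal "J2 K n" "power_ring n" by (rule J2_ideal)
  interpret j: ideal "J K n r s" "power_ring n" using assms by (intro J_ideal) auto
  obtain a b where ab: "a \<in> J K n r s" "b \<in> J K n r s" "x = cls n a" "y = cls n b"
    using assms(3,4) by blast
  have "a \<otimes>\<^bsub>power_ring n\<^esub> b \<in> J_squares n"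
    using assms(1,2) ideal_prod.prod[OF ab(1,2), of "power_ring n"] by fastforce
  then have "a \<otimes>\<^bsub>power_ring n\<^esub> b \<in> J2 K n"
    unfolding J2_def using h.R.genideal_self[OF J_squares_closed] by blast
  then have "cls n (a \<otimes>\<^bsub>power_ring n\<^esub> b) = \<zero>\<^bsub>dring n\<^esub>"
    unfolding cls_def' Delta_ring_def FactRing_def by (simp add: i.a_rcos_const)
  moreover have "cls n (a \<otimes>\<^bsub>power_ring n\<^esub> b) = cls n a \<otimes>\<^bsub>dring n\<^esub> cls n b"
    using ab(1,2) j.Icarr by (intro h.hom_mult) auto
  ultimately show ?thesis using ab by simp
qed

subsection \<open>The universal property\<close>

text \<open>Any \<open>n + 1\<close> homomorphisms \<open>B \<rightarrow> E\<close> of \<open>A\<close>-algebras that are pairwise infinitely near to first order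
  (\<open>square\<close>) define an \<open>E\<close>-valued point of \<open>\<Delta>\<^bsup>(n)\<^esup>\<close>. The structure of \<open>A\<close>-algebra on \<open>E\<close> is the one
  given by \<open>e 0\<close>.\<close>

lemma Delta_universal:
  fixes E :: "'e ring"
  assumes E: "cring E" and e: "\<And>i. i \<le> n \<Longrightarrow> e i \<in> ring_hom B E"
    and scalar: "\<And>i a. \<lbrakk>i \<le> n; a \<in> carrier A\<rbrakk> \<Longrightarrow> e i (rm_map K a) = e 0 (rm_map K a)"
    and square: "\<And>r s b c. \<lbrakk>r < s; s \<le> n; b \<in> carrier B; c \<in> carrier B\<rbrakk>
      \<Longrightarrow> (e s b \<ominus>\<^bsub>E\<^esub> e r b) \<otimes>\<^bsub>E\<^esub> (e s c \<ominus>\<^bsub>E\<^esub> e r c) = \<zero>\<^bsub>E\<^esub>"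
  shows "\<exists>h. h \<in> ring_hom (dring n) E \<and> (\<forall>i\<le>n. \<forall>b\<in>carrier B. h (coord n i b) = e i b)"
proof -
  interpret e: cring E by fact
  obtain h where h: "h \<in> ring_hom (power_ring n) E"
    "\<And>i b. \<lbrakk>i \<le> n; b \<in> carrier B\<rbrakk> \<Longrightarrow> h (at_factor K n i b) = e i b"
    using tensor_power_universal[of E n e, OF E e scalar] by blast
  interpret h: ring_hom_cring "power_ring n" E h
    by (intro ring_hom_cring.intro ring_hom_cring_axioms.intro power_ring_cring E h)
  have ec: "e i b \<in> carrier E" if "i \<le> n" "b \<in> carrier B" for i b
    using ring_hom_closed[OF e] that by blast
  have hdd: "h (dd K n r s b) = e s b \<ominus>\<^bsub>E\<^esub> e r b" if "r \<le> n" "s \<le> n" "b \<in> carrier B" for r s b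
    using at_factor_closed[OF that(1,3)] at_factor_closed[OF that(2,3)]
    unfolding dd_def a_minus_def
    by (simp only: h.hom_add h.hom_a_inv h.R.a_inv_closed h(2) that)
  have hprod: "h x = \<zero>\<^bsub>E\<^esub>" if rs: "r < s" "s \<le> n" and "x \<in> J K n r s \<cdot>\<^bsub>power_ring n\<^esub> J K n r s" for r s x
    using that(3)
  proof (induction rule: ideal_prod.induct)
    case (prod i j)
    let ?S = "(\<lambda>b. e s b \<ominus>\<^bsub>E\<^esub> e r b) ` carrier B"
    have S: "?S \<subseteq> carrier E" using ec rs by auto
    have rn: "r \<le> n" using rs by simp
    interpret JJ: ideal "J K n r s" "power_ring n" using rs by (intro J_ideal) auto
    have mem: "h x \<in> Idl\<^bsub>E\<^esub> ?S" if "x \<in> J K n r s" for x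
      using that unfolding J_def
      by (rule h.ring.genideal_vimage[OF dd_image_closed[OF rn rs(2)] e.genideal_ideal[OF S], rotated])
         (use e.genideal_self[OF S] hdd[OF rn rs(2)] in auto)
    have "h i \<otimes>\<^bsub>E\<^esub> h j \<in> {\<zero>\<^bsub>E\<^esub>}"
      by (rule e.genideal_mult_mem[OF e.zeroideal S S _ mem[OF prod(1)] mem[OF prod(2)]])
         (use square[OF rs] in auto)
    then show ?case using JJ.Icarr prod by simp
  next
    case (sum s1 s2)
    interpret JJ: ideal "J K n r s" "power_ring n" using rs by (intro J_ideal) auto
    have "s1 \<in> carrier (power_ring n)" "s2 \<in> carrier (power_ring n)"
      using sum h.R.ideal_prod_in_carrier[OF JJ.ideal_axioms JJ.ideal_axioms] by auto
    then show ?case using sum h.hom_add[of s1 s2] by simp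
  qed
  have "h x = \<zero>\<^bsub>E\<^esub>" if "x \<in> J2 K n" for x
  proof -
    have "h x \<in> {\<zero>\<^bsub>E\<^esub>}"
      using that unfolding J2_def
      by (rule h.ring.genideal_vimage[OF J_squares_closed e.zeroideal, rotated])
         (use hprod in auto)
    then show ?thesis by simp
  qed
  from ideal.quot_ring_lift[OF J2_ideal e.ring_axioms h(1) this]
  obtain h' where "h' \<in> ring_hom (dring n) E" "\<And>x. x \<in> carrier (power_ring n) \<Longrightarrow> h' (cls n x) = h x"
    unfolding Delta_ring_def cls_def' by blast
  then show ?thesis using h(2) at_factor_closed by (intro exI[of _ h']) simp
qed

lemma Delta_hom_unique:
  assumes E: "cring E" and h: "h \<in> ring_hom (dring n) E" and k: "k \<in> ring_hom (dring n) E"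
    and eq: "\<And>i b. \<lbrakk>i \<le> n; b \<in> carrier B\<rbrakk> \<Longrightarrow> h (coord n i b) = k (coord n i b)"
    and x: "x \<in> carrier (dring n)"
  shows "h x = k x"
proof -
  obtain y where y: "y \<in> carrier (power_ring n)" "x = cls n y" using x unfolding dring_carrier by blast
  have "(h \<circ> cls n) y = (k \<circ> cls n) y"
    by (rule power_ring_hom_unique[OF E ring_hom_trans[OF cls_hom h] ring_hom_trans[OF cls_hom k] _ y(1)])
       (simp add: eq)
  then show ?thesis by (simp add: y(2))
qed

text \<open>Relabelling the points, \<open>f \<mapsto> f(x\<^sub>k, \<dots>, x\<^bsub>k+m\<^esub>)\<close>.\<close>

lemma Delta_shift_spec:
  assumes kN: "k + m \<le> N"
  shows "Delta_shift K m N k \<in> ring_hom (dring m) (dring N)"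
    and "\<lbrakk>i \<le> m; b \<in> carrier B\<rbrakk> \<Longrightarrow> Delta_shift K m N k (coord m i b) = coord N (k + i) b"
proof -
  interpret dm: cring "dring m" by (rule dring_cring)
  interpret dN: cring "dring N" by (rule dring_cring)
  have "\<exists>h. h \<in> ring_hom (dring m) (dring N) \<and>
      (\<forall>i\<le>m. \<forall>b\<in>carrier B. h (coord m i b) = coord N (k + i) b)"
  proof (rule Delta_universal[OF dring_cring])
    show "coord N (k + i) \<in> ring_hom B (dring N)" if "i \<le> m" for i
      using that kN by (intro coord_hom) simp
    show "coord N (k + i) (rm_map K a) = coord N (k + 0) (rm_map K a)" if "i \<le> m" "a \<in> carrier A" for i a
      using that kN coord_scalar[of "k + i" N a] coord_scalar[of k N a] by simp
    show "(coord N (k + s) b \<ominus>\<^bsub>dring N\<^esub> coord N (k + r) b) \<otimes>\<^bsub>dring N\<^esub>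
        (coord N (k + s) c \<ominus>\<^bsub>dring N\<^esub> coord N (k + r) c) = \<zero>\<^bsub>dring N\<^esub>"
      if "r < s" "s \<le> m" "b \<in> carrier B" "c \<in> carrier B" for r s b c
      using that kN Jbar_mult_zero[of "k + r" "k + s" N, OF _ _ del_in_Jbar del_in_Jbar, of b c]
      by (simp add: del_eq)
  qed
  then obtain h where h: "h \<in> ring_hom (dring m) (dring N)"
    "\<And>i b. \<lbrakk>i \<le> m; b \<in> carrier B\<rbrakk> \<Longrightarrow> h (coord m i b) = coord N (k + i) b" by blast
  define h' where "h' = (\<lambda>x\<in>carrier (dring m). h x)"
  have "h' \<in> ring_hom (dring m) (dring N)"
    unfolding h'_def using h(1) dm.ring_hom_restrict[OF h(1), of "\<lambda>x\<in>carrier (dring m). h x"] by simp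
  moreover have "h' (coord m i b) = coord N (k + i) b" if "i \<le> m" "b \<in> carrier B" for i b
    using h(2)[OF that] coord_closed[OF that] by (simp add: h'_def)
  ultimately have h': "h' \<in> ring_hom (dring m) (dring N) \<inter> extensional (carrier (dring m)) \<and>
      (\<forall>i\<le>m. \<forall>b\<in>carrier B. h' (coord m i b) = coord N (k + i) b)"
    by (simp add: h'_def)
  have "Delta_shift K m N k = h'"
    unfolding Delta_shift_def
  proof (rule the_equality)
    fix g assume g: "g \<in> ring_hom (dring m) (dring N) \<inter> extensional (carrier (dring m)) \<and>
      (\<forall>i\<le>m. \<forall>b\<in>carrier B. g (coord m i b) = coord N (k + i) b)"
    show "g = h'"
    proof (rule extensionalityI[of _ "carrier (dring m)"])
      show "g x = h' x" if "x \<in> carrier (dring m)" for x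
        by (rule Delta_hom_unique[OF dring_cring[of N] _ _ _ that]) (use g h' in auto)
    qed (use g h' in auto)
  qed (rule h')
  then show "Delta_shift K m N k \<in> ring_hom (dring m) (dring N)"
    and "\<lbrakk>i \<le> m; b \<in> carrier B\<rbrakk> \<Longrightarrow> Delta_shift K m N k (coord m i b) = coord N (k + i) b"
    using h' by auto
qed

lemma Delta_shift_hom_cring: "k + m \<le> N \<Longrightarrow> ring_hom_cring (dring m) (dring N) (Delta_shift K m N k)"
  by (intro ring_hom_cring.intro ring_hom_cring_axioms.intro dring_cring Delta_shift_spec(1))

lemma Delta_shift_del:
  assumes "k + m \<le> N" and "r \<le> m" and "s \<le> m" and "b \<in> carrier B"
  shows "Delta_shift K m N k (del m r s b) = del N (k + r) (k + s) b"
proof -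
  interpret h: ring_hom_cring "dring m" "dring N" "Delta_shift K m N k"
    by (rule Delta_shift_hom_cring[OF assms(1)])
  show ?thesis
    using assms coord_closed[of r m b] coord_closed[of s m b]
    by (simp add: del_eq a_minus_def Delta_shift_spec(2))
qed

lemma Delta_shift_Jbar:
  assumes "k + m \<le> N" and "r \<le> m" and "s \<le> m" and "x \<in> Jbar m r s"
  shows "Delta_shift K m N k x \<in> Jbar N (k + r) (k + s)"
proof -
  interpret h: ring_hom_cring "dring m" "dring N" "Delta_shift K m N k"
    by (rule Delta_shift_hom_cring[OF assms(1)])
  have rs: "k + r \<le> N" "k + s \<le> N" using assms(1-3) by simp_all
  show ?thesis
    using assms(4) unfolding Jbar_eq[OF assms(2,3)]
    by (rule h.ring.genideal_vimage[OF del_image_closed[OF assms(2,3)] Jbar_ideal[OF rs], rotated])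
       (use Delta_shift_del[OF assms(1-3)] del_in_Jbar[OF rs] in auto)
qed

subsection \<open>The module of combinatorial forms\<close>

abbreviation "dmod n \<equiv> alg_module (dring n) (coord n 0)"

lemma dmod_module: "module B (dmod n)"
  by (rule alg_module_module[OF top_cring dring_cring coord_hom]) simp

lemma Psi_carrier:
  "carrier (Psi K n) = {f \<in> carrier (dring n). \<forall>r s. r < s \<and> s \<le> n \<longrightarrow> f \<in> Jbar n r s}"
  unfolding Psi_def Let_def by simp

lemma Psi_ops [simp]:
  "\<zero>\<^bsub>Psi K n\<^esub> = \<zero>\<^bsub>dring n\<^esub>" "ring.add (Psi K n) = ring.add (dring n)"
  "b \<odot>\<^bsub>Psi K n\<^esub> f = coord n 0 b \<otimes>\<^bsub>dring n\<^esub> f"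
  unfolding Psi_def Let_def by simp_all

lemma Psi_closed: "f \<in> carrier (Psi K n) \<Longrightarrow> f \<in> carrier (dring n)"
  by (simp add: Psi_carrier)

lemma PsiD: "\<lbrakk>f \<in> carrier (Psi K n); r < s; s \<le> n\<rbrakk> \<Longrightarrow> f \<in> Jbar n r s"
  by (simp add: Psi_carrier)

lemma PsiI:
  "\<lbrakk>f \<in> carrier (dring n); \<And>r s. \<lbrakk>r < s; s \<le> n\<rbrakk> \<Longrightarrow> f \<in> Jbar n r s\<rbrakk> \<Longrightarrow> f \<in> carrier (Psi K n)"
  by (simp add: Psi_carrier)

lemma Psi_submodule: "submodule (carrier (Psi K n)) B (dmod n)"
proof (rule submodule_intro[OF dmod_module])
  interpret d: cring "dring n" by (rule dring_cring)
  show "carrier (Psi K n) \<subseteq> carrier (dmod n)" by (auto simp: Psi_carrier)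
  have J: "ideal (Jbar n r s) (dring n)" if "r < s" "s \<le> n" for r s
    using that by (intro Jbar_ideal) auto
  show "\<zero>\<^bsub>dmod n\<^esub> \<in> carrier (Psi K n)"
    using additive_subgroup.zero_closed[OF ideal.axioms(1)[OF J]] by (intro PsiI) auto
  show "x \<oplus>\<^bsub>dmod n\<^esub> y \<in> carrier (Psi K n)"
    if xy: "x \<in> carrier (Psi K n)" "y \<in> carrier (Psi K n)" for x y
    unfolding alg_module_simps
  proof (rule PsiI)
    show "x \<oplus>\<^bsub>dring n\<^esub> y \<in> Jbar n r s" if "r < s" "s \<le> n" for r s
      by (rule additive_subgroup.a_closed[OF ideal.axioms(1)[OF J[OF that]] PsiD[OF xy(1) that] PsiD[OF xy(2) that]])
  qed (use Psi_closed xy in simp)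
  show "b \<odot>\<^bsub>dmod n\<^esub> x \<in> carrier (Psi K n)" if x: "x \<in> carrier (Psi K n)" and b: "b \<in> carrier B" for b x
    unfolding alg_module_simps
  proof (rule PsiI)
    show "coord n 0 b \<otimes>\<^bsub>dring n\<^esub> x \<in> Jbar n r s" if "r < s" "s \<le> n" for r s
      by (rule ideal.I_l_closed[OF J[OF that] PsiD[OF x that] coord_closed[OF _ b]]) simp
  qed (use Psi_closed[OF x] coord_closed[OF _ b] in simp)
qed

lemma Psi_module: "module B (Psi K n)"
  by (rule submodule_as_module[OF dmod_module Psi_submodule]) (simp_all add: alg_module_def)

end

section \<open>The map from differential to combinatorial forms\<close>

text \<open>Two consequences of \<open>(x' - x)(y' - y) = 0\<close>: the difference of products obeys the Leibniz rule, and
  if also \<open>xy = x'y' = 0\<close>, the mixed products are opposite.\<close>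

lemma (in cring) square_zero_leibniz:
  assumes "x \<in> carrier R" and "y \<in> carrier R" and "x' \<in> carrier R" and "y' \<in> carrier R"
    and "(x' \<ominus> x) \<otimes> (y' \<ominus> y) = \<zero>"
  shows "x' \<otimes> y' \<ominus> x \<otimes> y = x \<otimes> (y' \<ominus> y) \<oplus> y \<otimes> (x' \<ominus> x)"
proof -
  have "x' \<otimes> y' \<ominus> x \<otimes> y = x \<otimes> (y' \<ominus> y) \<oplus> y \<otimes> (x' \<ominus> x) \<oplus> (x' \<ominus> x) \<otimes> (y' \<ominus> y)"
    using assms(1-4) by algebra
  then show ?thesis using assms by simp
qed

lemma (in cring) square_zero_anti:
  assumes "x \<in> carrier R" and "y \<in> carrier R" and "x' \<in> carrier R" and "y' \<in> carrier R"
    and "x \<otimes> y = \<zero>" and "x' \<otimes> y' = \<zero>" and "(x' \<ominus> x) \<otimes> (y' \<ominus> y) = \<zero>"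
  shows "x \<otimes> y' \<oplus> y \<otimes> x' = \<zero>"
proof -
  have "x \<otimes> y' \<oplus> y \<otimes> x' = x \<otimes> y \<oplus> x' \<otimes> y' \<ominus> (x' \<ominus> x) \<otimes> (y' \<ominus> y)"
    using assms(1-4) by algebra
  then show ?thesis using assms by (simp add: a_minus_def)
qed

lemma (in comm_monoid) finprod_split:
  assumes "finite I" and "i \<in> I" and "f \<in> I \<rightarrow> carrier G"
  shows "finprod G f I = f i \<otimes> finprod G f (I - {i})"
proof -
  have "I = insert i (I - {i})" using assms(2) by blast
  then have "finprod G f I = finprod G f (insert i (I - {i}))" by simp
  also have "\<dots> = f i \<otimes> finprod G f (I - {i})"
    using assms by (intro finprod_insert) auto
  finally show ?thesis .
qed

context ring_morphism
begin

lemma del_diff: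
  assumes "p \<le> n" and "r \<le> n" and "s \<le> n" and "b \<in> carrier B"
  shows "del n r s b = del n p s b \<ominus>\<^bsub>dring n\<^esub> del n p r b"
proof -
  interpret d: cring "dring n" by (rule dring_cring)
  have "coord n p b \<in> carrier (dring n)" "coord n r b \<in> carrier (dring n)" "coord n s b \<in> carrier (dring n)"
    using assms by (simp_all add: coord_closed)
  then show ?thesis
    unfolding del_eq[OF assms(1,3,4)] del_eq[OF assms(1,2,4)] del_eq[OF assms(2,3,4)] by algebra
qed

lemma del_mult_zero:
  "\<lbrakk>r < s; s \<le> n; b \<in> carrier B; c \<in> carrier B\<rbrakk> \<Longrightarrow> del n r s b \<otimes>\<^bsub>dring n\<^esub> del n r s c = \<zero>\<^bsub>dring n\<^esub>"
  by (intro Jbar_mult_zero[of r s n] del_in_Jbar) auto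

text \<open>Modulo \<open>J\<^bsub>0s\<^esub>\<^sup>2\<close>, the difference \<open>b(x\<^sub>s) - b(x\<^sub>0)\<close> is a derivation in \<open>b\<close>, and so it defines a
  linear map on \<open>\<Omega>\<^sup>1\<close>.\<close>

lemma del_derivation:
  assumes s: "0 < s" "s \<le> n"
  shows "\<exists>h. linear_on B (kaehler K) (dmod n) h \<and> (\<forall>b\<in>carrier B. h (diff K b) = del n 0 s b)"
proof (rule kaehler_universal[OF dmod_module])
  interpret d: cring "dring n" by (rule dring_cring)
  note h0 = ring_hom_mult[OF coord_hom[of 0 n]] ring_hom_add[OF coord_hom[of 0 n]]
    and hs = ring_hom_mult[OF coord_hom[OF s(2)]] ring_hom_add[OF coord_hom[OF s(2)]]
  have del: "del n 0 s b = coord n s b \<ominus>\<^bsub>dring n\<^esub> coord n 0 b" if "b \<in> carrier B" for b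
    by (rule del_eq) (use s that in auto)
  have c: "coord n 0 b \<in> carrier (dring n)" "coord n s b \<in> carrier (dring n)" if "b \<in> carrier B" for b
    using coord_closed[of 0 n b] coord_closed[OF s(2) that] that by simp_all
  show "del n 0 s b \<in> carrier (dmod n)" if "b \<in> carrier B" for b
    using del_closed[of 0 n s b] s that by simp
  show "del n 0 s (rm_map K a) = \<zero>\<^bsub>dmod n\<^esub>" if "a \<in> carrier A" for a
    using coord_scalar[OF s(2) that] c(1)[OF map_closed[OF that]]
    by (simp add: del map_closed that a_minus_def d.r_neg)
  fix b b' assume b: "b \<in> carrier B" and b': "b' \<in> carrier B"
  show "del n 0 s (b \<oplus>\<^bsub>B\<^esub> b') = del n 0 s b \<oplus>\<^bsub>dmod n\<^esub> del n 0 s b'"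
    unfolding alg_module_simps del[OF b] del[OF b'] del[OF B.a_closed[OF b b']]
      h0(2)[OF le0 b b'] hs(2)[OF b b']
    using c[OF b] c[OF b'] by algebra
  have "(coord n s b \<ominus>\<^bsub>dring n\<^esub> coord n 0 b) \<otimes>\<^bsub>dring n\<^esub> (coord n s b' \<ominus>\<^bsub>dring n\<^esub> coord n 0 b')
      = \<zero>\<^bsub>dring n\<^esub>"
    using del_mult_zero[OF s b b'] unfolding del[OF b] del[OF b'] .
  from d.square_zero_leibniz[OF c(1)[OF b] c(1)[OF b'] c(2)[OF b] c(2)[OF b'] this]
  show "del n 0 s (b \<otimes>\<^bsub>B\<^esub> b') = b \<odot>\<^bsub>dmod n\<^esub> del n 0 s b' \<oplus>\<^bsub>dmod n\<^esub> b' \<odot>\<^bsub>dmod n\<^esub> del n 0 s b"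
    unfolding alg_module_simps del[OF b] del[OF b'] del[OF B.m_closed[OF b b']]
      h0(1)[OF le0 b b'] hs(1)[OF b b'] .
qed

text \<open>Together with \<open>J\<^bsub>0r\<^esub>\<^sup>2 = J\<^bsub>0s\<^esub>\<^sup>2 = 0\<close>, the relation \<open>J\<^bsub>rs\<^esub>\<^sup>2 = 0\<close> makes the products
  \<open>d\<^bsup>0,r\<^esup>b \<cdot> d\<^bsup>0,s\<^esup>c\<close> antisymmetric in \<open>b\<close> and \<open>c\<close>.\<close>

lemma del_anti:
  assumes "0 < r" and "r < s" and "s \<le> n" and "b \<in> carrier B" and "c \<in> carrier B"
  shows "del n 0 r b \<otimes>\<^bsub>dring n\<^esub> del n 0 s c \<oplus>\<^bsub>dring n\<^esub> del n 0 r c \<otimes>\<^bsub>dring n\<^esub> del n 0 s b = \<zero>\<^bsub>dring n\<^esub>"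
proof -
  interpret d: cring "dring n" by (rule dring_cring)
  have rn: "r \<le> n" using assms by simp
  show ?thesis
  proof (rule d.square_zero_anti)
    show "(del n 0 s b \<ominus>\<^bsub>dring n\<^esub> del n 0 r b) \<otimes>\<^bsub>dring n\<^esub> (del n 0 s c \<ominus>\<^bsub>dring n\<^esub> del n 0 r c) = \<zero>\<^bsub>dring n\<^esub>"
      using del_mult_zero[OF assms(2-5)] del_diff[OF le0 rn assms(3,4)] del_diff[OF le0 rn assms(3,5)] by simp
  qed (use assms in \<open>simp_all add: del_closed del_mult_zero\<close>)
qed

lemma kaehler_anti:
  assumes rs: "0 < r" "r < s" "s \<le> n"
    and h: "linear_on B (kaehler K) (dmod n) h" "\<And>b. b \<in> carrier B \<Longrightarrow> h (diff K b) = del n 0 r b"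
    and k: "linear_on B (kaehler K) (dmod n) k" "\<And>b. b \<in> carrier B \<Longrightarrow> k (diff K b) = del n 0 s b"
    and v: "v \<in> carrier (kaehler K)" and w: "w \<in> carrier (kaehler K)"
  shows "h v \<otimes>\<^bsub>dring n\<^esub> k w \<oplus>\<^bsub>dring n\<^esub> h w \<otimes>\<^bsub>dring n\<^esub> k v = \<zero>\<^bsub>dring n\<^esub>"
proof -
  interpret d: cring "dring n" by (rule dring_cring)
  have hc: "h u \<in> carrier (dring n)" and kc: "k u \<in> carrier (dring n)" if "u \<in> carrier (kaehler K)" for u
    using linear_onD(1)[OF h(1) that] linear_onD(1)[OF k(1) that] by simp_all
  have lin: "linear_on B (kaehler K) (dmod n)
      (\<lambda>w. h v \<otimes>\<^bsub>dring n\<^esub> k w \<oplus>\<^bsub>dring n\<^esub> h w \<otimes>\<^bsub>dring n\<^esub> k v)" if v: "v \<in> carrier (kaehler K)" for v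
  proof (rule linear_onI)
    fix w assume w: "w \<in> carrier (kaehler K)"
    show "h v \<otimes>\<^bsub>dring n\<^esub> k w \<oplus>\<^bsub>dring n\<^esub> h w \<otimes>\<^bsub>dring n\<^esub> k v \<in> carrier (dmod n)"
      using v w by (simp add: hc kc)
    show "h v \<otimes>\<^bsub>dring n\<^esub> k (w \<oplus>\<^bsub>kaehler K\<^esub> u) \<oplus>\<^bsub>dring n\<^esub> h (w \<oplus>\<^bsub>kaehler K\<^esub> u) \<otimes>\<^bsub>dring n\<^esub> k v =
        h v \<otimes>\<^bsub>dring n\<^esub> k w \<oplus>\<^bsub>dring n\<^esub> h w \<otimes>\<^bsub>dring n\<^esub> k v \<oplus>\<^bsub>dmod n\<^esub>
        (h v \<otimes>\<^bsub>dring n\<^esub> k u \<oplus>\<^bsub>dring n\<^esub> h u \<otimes>\<^bsub>dring n\<^esub> k v)" if u: "u \<in> carrier (kaehler K)" for u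
      unfolding linear_onD(2)[OF h(1) w u] linear_onD(2)[OF k(1) w u] alg_module_simps
      using hc[OF v] hc[OF w] hc[OF u] kc[OF v] kc[OF w] kc[OF u] by algebra
    show "h v \<otimes>\<^bsub>dring n\<^esub> k (b \<odot>\<^bsub>kaehler K\<^esub> w) \<oplus>\<^bsub>dring n\<^esub> h (b \<odot>\<^bsub>kaehler K\<^esub> w) \<otimes>\<^bsub>dring n\<^esub> k v =
        b \<odot>\<^bsub>dmod n\<^esub> (h v \<otimes>\<^bsub>dring n\<^esub> k w \<oplus>\<^bsub>dring n\<^esub> h w \<otimes>\<^bsub>dring n\<^esub> k v)" if b: "b \<in> carrier B" for b
      unfolding linear_onD(3)[OF h(1) b w] linear_onD(3)[OF k(1) b w] alg_module_simps
      using hc[OF v] hc[OF w] kc[OF v] kc[OF w] coord_closed[OF le0 b, of n] by algebra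
  qed
  have zero: "linear_on B (kaehler K) (dmod n) (\<lambda>_. \<zero>\<^bsub>dring n\<^esub>)"
    using linear_on_zero_map[OF dmod_module] by simp
  have base: "h (diff K b) \<otimes>\<^bsub>dring n\<^esub> k w \<oplus>\<^bsub>dring n\<^esub> h w \<otimes>\<^bsub>dring n\<^esub> k (diff K b) = \<zero>\<^bsub>dring n\<^esub>"
    if b: "b \<in> carrier B" and w: "w \<in> carrier (kaehler K)" for b w
  proof (rule linear_on_eq_on_spans[OF kaehler_module dmod_module diff_spans lin[OF diff_closed[OF b]] zero _ w])
    fix g assume "g \<in> diff K ` carrier B"
    then obtain c where c: "c \<in> carrier B" "g = diff K c" by blast
    show "h (diff K b) \<otimes>\<^bsub>dring n\<^esub> k g \<oplus>\<^bsub>dring n\<^esub> h g \<otimes>\<^bsub>dring n\<^esub> k (diff K b) = \<zero>\<^bsub>dring n\<^esub>"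
      using del_anti[OF rs b c(1)] by (simp only: c(2) h(2) k(2) b c(1))
  qed
  have "h v \<otimes>\<^bsub>dring n\<^esub> k w \<oplus>\<^bsub>dring n\<^esub> h w \<otimes>\<^bsub>dring n\<^esub> k v =
      h w \<otimes>\<^bsub>dring n\<^esub> k v \<oplus>\<^bsub>dring n\<^esub> h v \<otimes>\<^bsub>dring n\<^esub> k w"
    using hc[OF v] hc[OF w] kc[OF v] kc[OF w] by (intro d.a_comm) simp_all
  also have "\<dots> = \<zero>\<^bsub>dring n\<^esub>"
  proof (rule linear_on_eq_on_spans[OF kaehler_module dmod_module diff_spans lin[OF w] zero _ v])
    fix g assume "g \<in> diff K ` carrier B"
    then obtain b where b: "b \<in> carrier B" "g = diff K b" by blast
    show "h w \<otimes>\<^bsub>dring n\<^esub> k g \<oplus>\<^bsub>dring n\<^esub> h g \<otimes>\<^bsub>dring n\<^esub> k w = \<zero>\<^bsub>dring n\<^esub>"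
      using base[OF b(1) w] hc[OF w] kc[OF w] hc[OF diff_closed[OF b(1)]] kc[OF diff_closed[OF b(1)]]
      unfolding b(2) by (simp add: d.a_comm)
  qed
  finally show ?thesis .
qed

text \<open>The prescribed value \<open>d\<^bsup>0,1\<^esup>b\<^sub>1 \<cdots> d\<^bsup>0,n\<^esup>b\<^sub>n\<close> of \<open>\<nu>\<^sub>n\<close>. List positions start at \<open>0\<close>, so position \<open>i\<close>
  belongs to the point \<open>x\<^bsub>i+1\<^esub>\<close>.\<close>

definition nu_value :: "nat \<Rightarrow> 'a list \<Rightarrow> ('c, 'a) delta_fun" where
  "nu_value n bs = (\<Otimes>\<^bsub>dring n\<^esub>i\<in>{..<n}. del n 0 (Suc i) (bs ! i))"

lemma nu_value_factor:
  "\<lbrakk>length bs = n; set bs \<subseteq> carrier B; i < n\<rbrakk> \<Longrightarrow> del n 0 (Suc i) (bs ! i) \<in> carrier (dring n)"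
  by (intro del_closed) (auto simp: subset_iff)

lemma nu_value_eq:
  assumes "length bs = n" and "set bs \<subseteq> carrier B"
  shows "cls n (\<Otimes>\<^bsub>tensor_power K n\<^esub>i\<in>{1..n}. dd K n 0 i (bs ! (i - 1))) = nu_value n bs"
proof -
  interpret h: ring_hom_cring "power_ring n" "dring n" "cls n" by (rule cls_ring_hom_cring)
  have bc: "bs ! i \<in> carrier B" if "i < n" for i using assms that by (auto simp: subset_iff)
  have ddc: "dd K n 0 i (bs ! (i - 1)) \<in> carrier (power_ring n)" if "i \<in> {1..n}" for i
    by (rule dd_closed) (use that bc in auto)
  have "cls n (\<Otimes>\<^bsub>power_ring n\<^esub>i\<in>{1..n}. dd K n 0 i (bs ! (i - 1))) =
      (\<Otimes>\<^bsub>dring n\<^esub>i\<in>{1..n}. del n 0 i (bs ! (i - 1)))"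
    using h.hom_finprod[of "\<lambda>i. dd K n 0 i (bs ! (i - 1))" "{1..n}"] ddc by (simp add: Pi_def comp_def)
  also have "\<dots> = (\<Otimes>\<^bsub>dring n\<^esub>i\<in>Suc ` {..<n}. del n 0 i (bs ! (i - 1)))"
    by (simp only: image_Suc_lessThan)
  also have "\<dots> = nu_value n bs"
    unfolding nu_value_def
    using nu_value_factor[OF assms] by (subst h.S.finprod_reindex) auto
  finally show ?thesis .
qed

lemma nu_value_closed:
  assumes "length bs = n" and "set bs \<subseteq> carrier B"
  shows "nu_value n bs \<in> carrier (dring n)"
proof -
  interpret d: cring "dring n" by (rule dring_cring)
  show ?thesis unfolding nu_value_def using nu_value_factor[OF assms] by (intro d.finprod_closed) auto
qed

text \<open>The factor \<open>d\<^bsup>0,s\<^esup>b\<close> vanishes for \<open>x\<^sub>0 = x\<^sub>s\<close>, and \<open>d\<^bsup>0,r\<^esup>b \<cdot> d\<^bsup>0,s\<^esup>c = d\<^bsup>0,r\<^esup>b \<cdot> d\<^bsup>r,s\<^esup>c\<close> vanishes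
  for \<open>x\<^sub>r = x\<^sub>s\<close>.\<close>

lemma nu_value_Psi:
  assumes len: "length bs = n" and bs: "set bs \<subseteq> carrier B"
  shows "nu_value n bs \<in> carrier (Psi K n)"
proof (rule PsiI[OF nu_value_closed[OF assms]])
  interpret d: cring "dring n" by (rule dring_cring)
  fix r s assume rs: "r < s" "s \<le> n"
  have rn: "r \<le> n" using rs by simp
  interpret J: ideal "Jbar n r s" "dring n" by (rule Jbar_ideal[OF rn rs(2)])
  note fc = nu_value_factor[OF assms]
  let ?f = "\<lambda>i. del n 0 (Suc i) (bs ! i)"
  have bc: "bs ! i \<in> carrier B" if "i < n" for i using assms that by (auto simp: subset_iff)
  have s: "Suc (s - 1) = s" "s - 1 < n" using rs by simp_all
  have rest: "finprod (dring n) ?f I \<in> carrier (dring n)" if "I \<subseteq> {..<n}" for I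
    using that fc by (intro d.finprod_closed) auto
  have split: "nu_value n bs = ?f (s - 1) \<otimes>\<^bsub>dring n\<^esub> finprod (dring n) ?f ({..<n} - {s - 1})"
    unfolding nu_value_def using s fc by (intro d.finprod_split) auto
  show "nu_value n bs \<in> Jbar n r s"
  proof (cases "r = 0")
    case True
    have "?f (s - 1) \<in> Jbar n r s"
      unfolding s(1) True using del_in_Jbar[OF le0 rs(2) bc[OF s(2)]] .
    then show ?thesis unfolding split by (rule J.I_r_closed) (rule rest, blast)
  next
    case False
    have r: "Suc (r - 1) = r" "r - 1 < n" "r - 1 \<noteq> s - 1" using rs False by simp_all
    define c where "c = finprod (dring n) ?f ({..<n} - {s - 1} - {r - 1})"
    have c: "c \<in> carrier (dring n)" unfolding c_def by (rule rest) blast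
    have split2: "finprod (dring n) ?f ({..<n} - {s - 1}) = ?f (r - 1) \<otimes>\<^bsub>dring n\<^esub> c"
      unfolding c_def using r fc by (intro d.finprod_split) auto
    let ?y = "del n 0 r (bs ! (r - 1))" and ?z = "del n r s (bs ! (s - 1))" and ?y' = "del n 0 r (bs ! (s - 1))"
    have cl: "?y \<in> carrier (dring n)" "?z \<in> carrier (dring n)" "?y' \<in> carrier (dring n)"
      "del n 0 s (bs ! (s - 1)) \<in> carrier (dring n)"
      using rs rn bc[OF r(2)] bc[OF s(2)] by (simp_all add: del_closed)
    have "del n 0 s (bs ! (s - 1)) = ?z \<oplus>\<^bsub>dring n\<^esub> ?y'"
      unfolding del_diff[OF le0 rn rs(2) bc[OF s(2)]] using cl by algebra
    then have "nu_value n bs = ?z \<otimes>\<^bsub>dring n\<^esub> (?y \<otimes>\<^bsub>dring n\<^esub> c) \<oplus>\<^bsub>dring n\<^esub> (?y' \<otimes>\<^bsub>dring n\<^esub> ?y) \<otimes>\<^bsub>dring n\<^esub> c"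
      unfolding split split2 s(1) r(1) using cl c by (simp add: d.l_distr d.m_assoc)
    also have "?y' \<otimes>\<^bsub>dring n\<^esub> ?y = \<zero>\<^bsub>dring n\<^esub>"
      using False rn bc[OF r(2)] bc[OF s(2)] by (intro del_mult_zero) auto
    also have "?z \<otimes>\<^bsub>dring n\<^esub> (?y \<otimes>\<^bsub>dring n\<^esub> c) \<oplus>\<^bsub>dring n\<^esub> \<zero>\<^bsub>dring n\<^esub> \<otimes>\<^bsub>dring n\<^esub> c = ?z \<otimes>\<^bsub>dring n\<^esub> (?y \<otimes>\<^bsub>dring n\<^esub> c)"
      using cl c by simp
    finally show ?thesis
      using J.I_r_closed[OF del_in_Jbar[OF rn rs(2) bc[OF s(2)]]] cl c by simp
  qed
qed

text \<open>The map \<open>\<omega>\<^sub>0 \<otimes> \<dots> \<otimes> \<omega>\<^bsub>n-1\<^esub> \<mapsto> \<Prod> g\<^sub>i(\<omega>\<^sub>i)\<close>, where \<open>g\<^sub>i\<close> is the linear map on \<open>\<Omega>\<^sup>1\<close> with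
  \<open>db \<mapsto> d\<^bsup>0,i+1\<^esup>b\<close>, kills the relations of \<open>\<Omega>\<^bsup>(n)\<^esup>\<close>.\<close>

lemma nu_exists:
  "\<exists>h. linear_on B (Omega K n) (Psi K n) h \<and>
     (\<forall>bs. length bs = n \<and> set bs \<subseteq> carrier B \<longrightarrow> h (twedge_list K n (map (diff K) bs)) = nu_value n bs)"
proof -
  interpret d: cring "dring n" by (rule dring_cring)
  have "\<forall>i\<in>{..<n}. \<exists>h. linear_on B (kaehler K) (dmod n) h \<and> (\<forall>b\<in>carrier B. h (diff K b) = del n 0 (Suc i) b)"
    using del_derivation by auto
  from bchoice[OF this] obtain g where g: "\<And>i. i < n \<Longrightarrow> linear_on B (kaehler K) (dmod n) (g i)"
    "\<And>i b. \<lbrakk>i < n; b \<in> carrier B\<rbrakk> \<Longrightarrow> g i (diff K b) = del n 0 (Suc i) b" by auto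
  let ?f = "\<lambda>ws. \<Otimes>\<^bsub>dring n\<^esub>i\<in>{..<n}. g i (ws ! i)"
  have gc: "g i w \<in> carrier (dring n)" if "i < n" "w \<in> carrier (kaehler K)" for i w
    using linear_onD(1)[OF g(1)[OF that(1)] that(2)] by simp
  have anti_less: "g i v \<otimes>\<^bsub>dring n\<^esub> g j w \<oplus>\<^bsub>dring n\<^esub> g i w \<otimes>\<^bsub>dring n\<^esub> g j v = \<zero>\<^bsub>dring n\<^esub>"
    if "i < j" "j < n" "v \<in> carrier (kaehler K)" "w \<in> carrier (kaehler K)" for i j v w
    by (rule kaehler_anti[of "Suc i" "Suc j" n "g i" "g j", OF _ _ _ g(1) g(2) g(1) g(2)]) (use that in auto)
  have anti: "g i v \<otimes>\<^bsub>dring n\<^esub> g j w \<oplus>\<^bsub>dring n\<^esub> g i w \<otimes>\<^bsub>dring n\<^esub> g j v = \<zero>\<^bsub>dring n\<^esub>"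
    if ij: "i \<noteq> j" "i < n" "j < n" and vw: "v \<in> carrier (kaehler K)" "w \<in> carrier (kaehler K)" for i j v w
  proof (cases "i < j")
    case True
    then show ?thesis using anti_less that by blast
  next
    case False
    then have "g j w \<otimes>\<^bsub>dring n\<^esub> g i v \<oplus>\<^bsub>dring n\<^esub> g j v \<otimes>\<^bsub>dring n\<^esub> g i w = \<zero>\<^bsub>dring n\<^esub>"
      using anti_less[of j i w v] that by simp
    then show ?thesis
      using gc[OF ij(2)] gc[OF ij(3)] vw d.m_comm[of "g j w" "g i v"] d.m_comm[of "g j v" "g i w"] by simp
  qed
  have split: "?f ws = g i (ws ! i) \<otimes>\<^bsub>dring n\<^esub> g j (ws ! j) \<otimes>\<^bsub>dring n\<^esub>
      (\<Otimes>\<^bsub>dring n\<^esub>l\<in>{..<n} - {i} - {j}. g l (ws ! l))"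
    if ws: "ws \<in> tuples (kaehlers n)" and ij: "i \<noteq> j" "i < n" "j < n" for ws i j
  proof -
    have wc: "g l (ws ! l) \<in> carrier (dring n)" if "l < n" for l
      using gc[OF that] ws that by (simp add: tuples_iff)
    have "?f ws = g i (ws ! i) \<otimes>\<^bsub>dring n\<^esub> (\<Otimes>\<^bsub>dring n\<^esub>l\<in>{..<n} - {i}. g l (ws ! l))"
      using ij wc by (intro d.finprod_split) auto
    also have "(\<Otimes>\<^bsub>dring n\<^esub>l\<in>{..<n} - {i}. g l (ws ! l)) =
        g j (ws ! j) \<otimes>\<^bsub>dring n\<^esub> (\<Otimes>\<^bsub>dring n\<^esub>l\<in>{..<n} - {i} - {j}. g l (ws ! l))"
      using ij wc by (intro d.finprod_split) auto
    finally show ?thesis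
      using ij wc d.finprod_closed[of "\<lambda>l. g l (ws ! l)" "{..<n} - {i} - {j}"] by (simp add: d.m_assoc Pi_def)
  qed
  have ml: "multilinear B (kaehlers n) (dmod n) ?f"
    using multilinear_finprod[OF dring_cring top_cring coord_hom kaehlers_module, of 0 n n g] g(1) by simp
  have swap: "?f ws \<oplus>\<^bsub>dmod n\<^esub> ?f (ws[i := ws ! j, j := ws ! i]) = \<zero>\<^bsub>dmod n\<^esub>"
    if ws: "ws \<in> tuples (kaehlers n)" and i: "i < n" and j: "j < n" and ij: "i \<noteq> j" for ws i j
  proof -
    let ?ws = "ws[i := ws ! j, j := ws ! i]" and ?I = "{..<n} - {i} - {j}"
    have len: "length ws = n" and wi: "\<And>l. l < n \<Longrightarrow> ws ! l \<in> carrier (kaehler K)"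
      using ws by (auto simp: tuples_iff)
    define c where "c = (\<Otimes>\<^bsub>dring n\<^esub>l\<in>?I. g l (ws ! l))"
    have c: "c \<in> carrier (dring n)"
      unfolding c_def using gc wi by (intro d.finprod_closed) auto
    have "(\<Otimes>\<^bsub>dring n\<^esub>l\<in>?I. g l (?ws ! l)) = c"
      unfolding c_def using gc wi by (intro d.finprod_cong') auto
    then have "?f ws \<oplus>\<^bsub>dring n\<^esub> ?f ?ws =
        g i (ws ! i) \<otimes>\<^bsub>dring n\<^esub> g j (ws ! j) \<otimes>\<^bsub>dring n\<^esub> c \<oplus>\<^bsub>dring n\<^esub>
        g i (ws ! j) \<otimes>\<^bsub>dring n\<^esub> g j (ws ! i) \<otimes>\<^bsub>dring n\<^esub> c"
      unfolding split[OF ws ij i j] split[OF swap_closed[OF ws i j] ij i j] c_def[symmetric]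
      using len i j ij by (simp add: nth_list_update)
    also have "\<dots> = \<zero>\<^bsub>dring n\<^esub>"
      using anti[OF ij i j wi[OF i] wi[OF j]] c gc[OF i wi[OF i]] gc[OF i wi[OF j]] gc[OF j wi[OF i]] gc[OF j wi[OF j]]
      by (simp add: d.l_distr[symmetric])
    finally show ?thesis by simp
  qed
  obtain h where h: "linear_on B (Omega K n) (dmod n) h"
    "\<And>ws. ws \<in> tuples (kaehlers n) \<Longrightarrow> h (twedge_list K n ws) = ?f ws"
    using Omega_universal[OF dmod_module ml swap] by blast
  have val: "h (twedge_list K n (map (diff K) bs)) = nu_value n bs"
    if bs: "length bs = n" "set bs \<subseteq> carrier B" for bs
    unfolding h(2)[OF diffs_in_tuples[OF bs]] nu_value_def
    using bs g(2) nu_value_factor[OF bs] by (intro d.finprod_cong') (auto simp: subset_iff)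
  have "submodule {x \<in> carrier (Omega K n). h x \<in> carrier (Psi K n)} B (Omega K n)"
    by (rule linear_on_vimage[OF Omega_module dmod_module h(1) Psi_submodule])
  have "exact_forms n \<subseteq> {x \<in> carrier (Omega K n). h x \<in> carrier (Psi K n)}"
    using val nu_value_Psi spans_closed[OF exact_forms_span] by auto
  have Psi: "h x \<in> carrier (Psi K n)" if "x \<in> carrier (Omega K n)" for x
  proof -
    have "x \<in> {x \<in> carrier (Omega K n). h x \<in> carrier (Psi K n)}"
      by (rule spans_minimal[OF exact_forms_span _ _ that]) fact+
    then show ?thesis by simp
  qed
  have "linear_on B (Omega K n) (Psi K n) h"
    by (rule linear_onI) (simp_all add: Psi linear_onD(2,3)[OF h(1)])
  then show ?thesis using val by (intro exI[of _ h]) simp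
qed

text \<open>\<open>nu\<close> is the linear map that its definite description asks for.\<close>

lemma nu_spec:
  shows nu_linear: "linear_on B (Omega K n) (Psi K n) (nu K n)"
    and nu_exact: "\<lbrakk>length bs = n; set bs \<subseteq> carrier B\<rbrakk>
      \<Longrightarrow> nu K n (twedge_list K n (map (diff K) bs)) = nu_value n bs"
proof -
  from nu_exists[of n] obtain h where h: "linear_on B (Omega K n) (Psi K n) h"
    "\<forall>bs. length bs = n \<and> set bs \<subseteq> carrier B \<longrightarrow> h (twedge_list K n (map (diff K) bs)) = nu_value n bs"
    by (elim exE conjE)
  define h' where "h' = (\<lambda>x\<in>carrier (Omega K n). h x)"
  let ?P = "\<lambda>h. h \<in> linear_maps B (Omega K n) (Psi K n) \<and>
       (\<forall>bs. length bs = n \<and> set bs \<subseteq> carrier B \<longrightarrow> h (twedge_list K n (map (diff K) bs)) =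
          cls n (\<Otimes>\<^bsub>tensor_power K n\<^esub>i\<in>{1..n}. dd K n 0 i (bs ! (i - 1))))"
  have "?P h'"
  proof (intro conjI allI impI)
    show "h' \<in> linear_maps B (Omega K n) (Psi K n)"
      unfolding h'_def by (rule linear_on_restrict[OF Omega_module h(1)])
    fix bs assume "length bs = n \<and> set bs \<subseteq> carrier B"
    then have bs: "length bs = n" "set bs \<subseteq> carrier B" by simp_all
    show "h' (twedge_list K n (map (diff K) bs)) =
        cls n (\<Otimes>\<^bsub>tensor_power K n\<^esub>i\<in>{1..n}. dd K n 0 i (bs ! (i - 1)))"
      unfolding nu_value_eq[OF bs] h'_def
      using h(2) bs twedge_list_closed[OF diffs_in_tuples[OF bs]] by simp
  qed
  moreover have "k = h'" if "?P k" for k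
  proof (rule extensionalityI[of _ "carrier (Omega K n)"])
    show "k x = h' x" if "x \<in> carrier (Omega K n)" for x
    proof (rule linear_on_eq_on_spans[OF Omega_module Psi_module exact_forms_span _ _ _ that])
      show "linear_on B (Omega K n) (Psi K n) k" "linear_on B (Omega K n) (Psi K n) h'"
        using \<open>?P k\<close> \<open>?P h'\<close> by (simp_all add: linear_maps_iff)
      show "k g = h' g" if "g \<in> exact_forms n" for g
        using that \<open>?P k\<close> \<open>?P h'\<close> by auto
    qed
  qed (use that \<open>?P h'\<close> in \<open>simp_all add: linear_maps_iff\<close>)
  ultimately have P: "?P (nu K n)" unfolding nu_def by (rule theI)
  show "linear_on B (Omega K n) (Psi K n) (nu K n)"
    using conjunct1[OF P] by (simp only: linear_maps_iff)
  assume bs: "length bs = n" "set bs \<subseteq> carrier B"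
  show "nu K n (twedge_list K n (map (diff K) bs)) = nu_value n bs"
    using mp[OF spec[OF conjunct2[OF P]] conjI[OF bs]] unfolding nu_value_eq[OF bs] .
qed

section \<open>The product of combinatorial forms\<close>

text \<open>A function that vanishes for \<open>x\<^sub>r = x\<^sub>p\<close> times one that vanishes for \<open>x\<^sub>p = x\<^sub>s\<close> vanishes for
  \<open>x\<^sub>r = x\<^sub>s\<close>, because \<open>d\<^bsup>p,s\<^esup>c = d\<^bsup>r,s\<^esup>c - d\<^bsup>r,p\<^esup>c\<close> and \<open>d\<^bsup>r,p\<^esup>b \<cdot> d\<^bsup>r,p\<^esup>c = 0\<close>.\<close>

lemma Jbar_mult:
  assumes "r < p" and "p < s" and "s \<le> n" and "x \<in> Jbar n r p" and "y \<in> Jbar n p s"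
  shows "x \<otimes>\<^bsub>dring n\<^esub> y \<in> Jbar n r s"
proof -
  interpret d: cring "dring n" by (rule dring_cring)
  have le: "r \<le> n" "p \<le> n" using assms(1-3) by simp_all
  interpret J: ideal "Jbar n r s" "dring n" by (rule Jbar_ideal[OF le(1) assms(3)])
  have gen: "del n r p b \<otimes>\<^bsub>dring n\<^esub> del n p s c \<in> Jbar n r s" if bc: "b \<in> carrier B" "c \<in> carrier B" for b c
  proof -
    have cl: "del n r p b \<in> carrier (dring n)" "del n r p c \<in> carrier (dring n)" "del n r s c \<in> carrier (dring n)"
      using le assms(3) bc by (simp_all add: del_closed)
    have "del n r p b \<otimes>\<^bsub>dring n\<^esub> del n p s c =
        del n r p b \<otimes>\<^bsub>dring n\<^esub> del n r s c \<ominus>\<^bsub>dring n\<^esub> del n r p b \<otimes>\<^bsub>dring n\<^esub> del n r p c"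
      unfolding del_diff[OF le assms(3) bc(2)] using cl by algebra
    also have "\<dots> = del n r p b \<otimes>\<^bsub>dring n\<^esub> del n r s c"
      using del_mult_zero[OF assms(1) le(2) bc] cl by (simp add: a_minus_def)
    finally show ?thesis
      using J.I_l_closed[OF del_in_Jbar[OF le(1) assms(3) bc(2)] cl(1)] by simp
  qed
  show ?thesis
  proof (rule d.genideal_mult_mem[OF J.ideal_axioms del_image_closed[OF le] del_image_closed[OF le(2) assms(3)]])
    show "x \<in> Idl\<^bsub>dring n\<^esub> (del n r p ` carrier B)" using assms(4) unfolding Jbar_eq[OF le] .
    show "y \<in> Idl\<^bsub>dring n\<^esub> (del n p s ` carrier B)" using assms(5) unfolding Jbar_eq[OF le(2) assms(3)] .
    fix u v assume "u \<in> del n r p ` carrier B" and "v \<in> del n p s ` carrier B"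
    then show "u \<otimes>\<^bsub>dring n\<^esub> v \<in> Jbar n r s" by (elim imageE) (simp only: gen)
  qed
qed

lemma star_Psi:
  assumes f: "f \<in> carrier (Psi K m)" and g: "g \<in> carrier (Psi K n)"
  shows "star K m n f g \<in> carrier (Psi K (m + n))"
proof (rule PsiI)
  let ?N = "m + n"
  interpret d: cring "dring ?N" by (rule dring_cring)
  interpret h0: ring_hom_cring "dring m" "dring ?N" "Delta_shift K m ?N 0"
    by (rule Delta_shift_hom_cring) simp
  interpret hm: ring_hom_cring "dring n" "dring ?N" "Delta_shift K n ?N m"
    by (rule Delta_shift_hom_cring) simp
  have fc: "Delta_shift K m ?N 0 f \<in> carrier (dring ?N)" and gc: "Delta_shift K n ?N m g \<in> carrier (dring ?N)"
    using Psi_closed[OF f] Psi_closed[OF g] by simp_all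
  show "star K m n f g \<in> carrier (dring ?N)"
    unfolding star_def using fc gc by simp
  have fJ: "Delta_shift K m ?N 0 f \<in> Jbar ?N r s" if "r < s" "s \<le> m" for r s
    using Delta_shift_Jbar[of 0 m ?N r s, OF _ _ _ PsiD[OF f that]] that by simp
  have gJ: "Delta_shift K n ?N m g \<in> Jbar ?N r s" if "m \<le> r" "r < s" "s \<le> ?N" for r s
    using Delta_shift_Jbar[of m n ?N "r - m" "s - m", OF _ _ _ PsiD[OF g]] that by simp
  fix r s assume rs: "r < s" "s \<le> ?N"
  have rN: "r \<le> ?N" using rs by simp
  interpret J: ideal "Jbar ?N r s" "dring ?N" by (rule Jbar_ideal[OF rN rs(2)])
  consider "s \<le> m" | "m \<le> r" | "r < m" "m < s" by linarith
  then show "star K m n f g \<in> Jbar ?N r s"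
  proof cases
    case 1
    then show ?thesis unfolding star_def by (rule J.I_r_closed[OF fJ[OF rs(1)] gc])
  next
    case 2
    then show ?thesis unfolding star_def by (rule J.I_l_closed[OF gJ[OF _ rs] fc])
  next
    case 3
    then show ?thesis unfolding star_def using rs(2) by (intro Jbar_mult[of r m s] fJ gJ) auto
  qed
qed

text \<open>A combinatorial form in \<open>x\<^sub>0, \<dots>, x\<^sub>m\<close> does not distinguish \<open>b(x\<^sub>0)\<close> from \<open>b(x\<^sub>m)\<close>.\<close>

lemma shift_mult_del_zero:
  assumes "1 \<le> m" and f: "f \<in> carrier (Psi K m)" and b: "b \<in> carrier B"
  shows "Delta_shift K m (m + n) 0 f \<otimes>\<^bsub>dring (m + n)\<^esub> del (m + n) 0 m b = \<zero>\<^bsub>dring (m + n)\<^esub>"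
proof (rule Jbar_mult_zero[of 0 m])
  show "Delta_shift K m (m + n) 0 f \<in> Jbar (m + n) 0 m"
    using Delta_shift_Jbar[of 0 m "m + n" 0 m, OF _ _ _ PsiD[OF f]] assms(1) by simp
qed (use assms in \<open>auto intro!: del_in_Jbar\<close>)

text \<open>Scalars act on \<open>g\<close> through \<open>x\<^sub>m\<close> but on \<open>f * g\<close> through \<open>x\<^sub>0\<close>; the difference is killed by \<open>f\<close>.\<close>

lemma star_linear_right:
  assumes m: "1 \<le> m" and f: "f \<in> carrier (Psi K m)"
  shows "linear_on B (Psi K n) (Psi K (m + n)) (star K m n f)"
proof (rule linear_onI)
  let ?N = "m + n"
  interpret d: cring "dring ?N" by (rule dring_cring)
  interpret h0: ring_hom_cring "dring m" "dring ?N" "Delta_shift K m ?N 0"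
    by (rule Delta_shift_hom_cring) simp
  interpret hm: ring_hom_cring "dring n" "dring ?N" "Delta_shift K n ?N m"
    by (rule Delta_shift_hom_cring) simp
  let ?f = "Delta_shift K m ?N 0 f" and ?h = "Delta_shift K n ?N m"
  have fc: "?f \<in> carrier (dring ?N)" using Psi_closed[OF f] by simp
  fix g assume g: "g \<in> carrier (Psi K n)"
  have gc: "?h g \<in> carrier (dring ?N)" using Psi_closed[OF g] by simp
  show "star K m n f g \<in> carrier (Psi K ?N)" by (rule star_Psi[OF f g])
  show "star K m n f (g \<oplus>\<^bsub>Psi K n\<^esub> g') = star K m n f g \<oplus>\<^bsub>Psi K ?N\<^esub> star K m n f g'"
    if "g' \<in> carrier (Psi K n)" for g'
    using fc Psi_closed[OF g] Psi_closed[OF that] unfolding star_def by (simp add: d.r_distr)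
  fix b assume b: "b \<in> carrier B"
  have c: "coord ?N 0 b \<in> carrier (dring ?N)" "coord ?N m b \<in> carrier (dring ?N)" "coord n 0 b \<in> carrier (dring n)"
    using b by (simp_all add: coord_closed)
  have "?f \<otimes>\<^bsub>dring ?N\<^esub> coord ?N m b = ?f \<otimes>\<^bsub>dring ?N\<^esub> coord ?N 0 b \<oplus>\<^bsub>dring ?N\<^esub> ?f \<otimes>\<^bsub>dring ?N\<^esub> del ?N 0 m b"
    unfolding del_eq[OF le0 le_add1 b] using fc c by algebra
  also have "\<dots> = ?f \<otimes>\<^bsub>dring ?N\<^esub> coord ?N 0 b"
    using shift_mult_del_zero[OF m f b, of n] fc c by simp
  finally have swap: "?f \<otimes>\<^bsub>dring ?N\<^esub> coord ?N m b = ?f \<otimes>\<^bsub>dring ?N\<^esub> coord ?N 0 b" .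
  have "?h (coord n 0 b \<otimes>\<^bsub>dring n\<^esub> g) = coord ?N m b \<otimes>\<^bsub>dring ?N\<^esub> ?h g"
    using c Psi_closed[OF g] Delta_shift_spec(2)[of m n ?N 0 b] b by simp
  then have "star K m n f (b \<odot>\<^bsub>Psi K n\<^esub> g) = ?f \<otimes>\<^bsub>dring ?N\<^esub> coord ?N m b \<otimes>\<^bsub>dring ?N\<^esub> ?h g"
    unfolding star_def using fc c gc by (simp add: d.m_assoc)
  also have "\<dots> = coord ?N 0 b \<otimes>\<^bsub>dring ?N\<^esub> (?f \<otimes>\<^bsub>dring ?N\<^esub> ?h g)"
    unfolding swap using fc c gc by (simp add: d.m_ac)
  finally show "star K m n f (b \<odot>\<^bsub>Psi K n\<^esub> g) = b \<odot>\<^bsub>Psi K ?N\<^esub> star K m n f g"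
    by (simp add: star_def)
qed

lemma star_linear_left:
  assumes g: "g \<in> carrier (Psi K n)"
  shows "linear_on B (Psi K m) (Psi K (m + n)) (\<lambda>f. star K m n f g)"
proof (rule linear_onI)
  let ?N = "m + n"
  interpret d: cring "dring ?N" by (rule dring_cring)
  interpret h0: ring_hom_cring "dring m" "dring ?N" "Delta_shift K m ?N 0"
    by (rule Delta_shift_hom_cring) simp
  interpret hm: ring_hom_cring "dring n" "dring ?N" "Delta_shift K n ?N m"
    by (rule Delta_shift_hom_cring) simp
  have gc: "Delta_shift K n ?N m g \<in> carrier (dring ?N)" using Psi_closed[OF g] by simp
  fix f assume f: "f \<in> carrier (Psi K m)"
  have fc: "Delta_shift K m ?N 0 f \<in> carrier (dring ?N)" using Psi_closed[OF f] by simp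
  show "star K m n f g \<in> carrier (Psi K ?N)" by (rule star_Psi[OF f g])
  show "star K m n (f \<oplus>\<^bsub>Psi K m\<^esub> f') g = star K m n f g \<oplus>\<^bsub>Psi K ?N\<^esub> star K m n f' g"
    if "f' \<in> carrier (Psi K m)" for f'
    using gc Psi_closed[OF f] Psi_closed[OF that] unfolding star_def by (simp add: d.l_distr)
  fix b assume b: "b \<in> carrier B"
  have c: "coord ?N 0 b \<in> carrier (dring ?N)" "coord m 0 b \<in> carrier (dring m)"
    using b by (simp_all add: coord_closed)
  have "Delta_shift K m ?N 0 (coord m 0 b \<otimes>\<^bsub>dring m\<^esub> f) =
      coord ?N 0 b \<otimes>\<^bsub>dring ?N\<^esub> Delta_shift K m ?N 0 f"
    using c Psi_closed[OF f] Delta_shift_spec(2)[of 0 m ?N 0 b] b by simp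
  then show "star K m n (b \<odot>\<^bsub>Psi K m\<^esub> f) g = b \<odot>\<^bsub>Psi K ?N\<^esub> star K m n f g"
    unfolding star_def using fc gc c by (simp add: d.m_assoc)
qed

section \<open>Compatibility of the products\<close>

lemma shift_nu_value:
  assumes kN: "k + n \<le> N" and bs: "length bs = n" "set bs \<subseteq> carrier B"
  shows "Delta_shift K n N k (nu_value n bs) = (\<Otimes>\<^bsub>dring N\<^esub>i\<in>{..<n}. del N k (k + Suc i) (bs ! i))"
proof -
  interpret h: ring_hom_cring "dring n" "dring N" "Delta_shift K n N k"
    by (rule Delta_shift_hom_cring[OF kN])
  have bc: "bs ! i \<in> carrier B" if "i < n" for i using bs that by (auto simp: subset_iff)
  have "Delta_shift K n N k (nu_value n bs) =
      (\<Otimes>\<^bsub>dring N\<^esub>i\<in>{..<n}. Delta_shift K n N k (del n 0 (Suc i) (bs ! i)))"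
    unfolding nu_value_def
    using h.hom_finprod[of "\<lambda>i. del n 0 (Suc i) (bs ! i)" "{..<n}"] nu_value_factor[OF bs]
    by (simp add: Pi_def comp_def)
  also have "\<dots> = (\<Otimes>\<^bsub>dring N\<^esub>i\<in>{..<n}. del N k (k + Suc i) (bs ! i))"
    using bc kN Delta_shift_del[OF kN le0]
    by (intro h.S.finprod_cong') (auto intro!: del_closed)
  finally show ?thesis .
qed

text \<open>Replacing the base point \<open>x\<^sub>m\<close> by \<open>x\<^sub>0\<close> changes a factor by \<open>d\<^bsup>0,m\<^esup>c\<close>, which is killed by
  the first form.\<close>

lemma star_nu_value:
  assumes m: "1 \<le> m" and bs: "length bs = m" "set bs \<subseteq> carrier B"
    and cs: "length cs = n" "set cs \<subseteq> carrier B"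
  shows "star K m n (nu_value m bs) (nu_value n cs) = nu_value (m + n) (bs @ cs)"
proof -
  let ?N = "m + n"
  interpret d: cring "dring ?N" by (rule dring_cring)
  interpret h: ring_hom_cring "dring m" "dring ?N" "Delta_shift K m ?N 0"
    by (rule Delta_shift_hom_cring) simp
  let ?P = "Delta_shift K m ?N 0 (nu_value m bs)"
  let ?F = "\<lambda>i. del ?N 0 (Suc i) ((bs @ cs) ! i)"
  let ?G = "\<lambda>j. del ?N m (m + Suc j) (cs ! j)"
  have P: "?P \<in> carrier (dring ?N)" using nu_value_closed[OF bs] by simp
  have cc: "cs ! j \<in> carrier B" if "j < n" for j using cs that by (auto simp: subset_iff)
  have F: "?F i \<in> carrier (dring ?N)" if "i < ?N" for i
    by (rule nu_value_factor) (use bs cs that in auto)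
  have G: "?G j \<in> carrier (dring ?N)" if "j < n" for j
    using cc[OF that] that by (intro del_closed) auto
  have step: "?P \<otimes>\<^bsub>dring ?N\<^esub> ?G j = ?P \<otimes>\<^bsub>dring ?N\<^esub> ?F (m + j)" if j: "j < n" for j
  proof -
    have le: "m + Suc j \<le> ?N" using j by simp
    have F_eq: "?F (m + j) = del ?N 0 (m + Suc j) (cs ! j)" using bs by (simp add: nth_append)
    have z: "?P \<otimes>\<^bsub>dring ?N\<^esub> del ?N 0 m (cs ! j) = \<zero>\<^bsub>dring ?N\<^esub>"
      by (rule shift_mult_del_zero[OF m nu_value_Psi[OF bs] cc[OF j]])
    have dc: "del ?N 0 m (cs ! j) \<in> carrier (dring ?N)" "del ?N 0 (m + Suc j) (cs ! j) \<in> carrier (dring ?N)"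
      using cc[OF j] le by (simp_all add: del_closed)
    have "?P \<otimes>\<^bsub>dring ?N\<^esub> ?G j =
        ?P \<otimes>\<^bsub>dring ?N\<^esub> del ?N 0 (m + Suc j) (cs ! j) \<ominus>\<^bsub>dring ?N\<^esub> ?P \<otimes>\<^bsub>dring ?N\<^esub> del ?N 0 m (cs ! j)"
      unfolding del_diff[OF le0 le_add1 le cc[OF j]] using P dc by algebra
    then show ?thesis unfolding z F_eq using P dc by (simp add: a_minus_def)
  qed
  have "?P \<otimes>\<^bsub>dring ?N\<^esub> (\<Otimes>\<^bsub>dring ?N\<^esub>j\<in>{..<k}. ?G j) = (\<Otimes>\<^bsub>dring ?N\<^esub>i\<in>{..<m + k}. ?F i)" if "k \<le> n" for k
    using that
  proof (induction k)
    case 0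
    have "(\<Otimes>\<^bsub>dring ?N\<^esub>i\<in>{..<m}. del ?N 0 (0 + Suc i) (bs ! i)) = (\<Otimes>\<^bsub>dring ?N\<^esub>i\<in>{..<m}. ?F i)"
    proof (rule d.finprod_cong'[OF refl])
      show "?F \<in> {..<m} \<rightarrow> carrier (dring ?N)"
        by (intro funcsetI F) simp
    qed (use bs in \<open>simp add: nth_append\<close>)
    then show ?case using shift_nu_value[of 0 m ?N, OF _ bs] P by simp
  next
    case (Suc k)
    let ?Q = "\<Otimes>\<^bsub>dring ?N\<^esub>j\<in>{..<k}. ?G j"
    have k: "k < n" using Suc.prems by simp
    have Q: "?Q \<in> carrier (dring ?N)" using G k by (intro d.finprod_closed) auto
    have Gk: "?G k \<in> carrier (dring ?N)" and Fk: "?F (m + k) \<in> carrier (dring ?N)"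
      using G[OF k] F[of "m + k"] k by auto
    have "(\<Otimes>\<^bsub>dring ?N\<^esub>j\<in>{..<Suc k}. ?G j) = ?G k \<otimes>\<^bsub>dring ?N\<^esub> ?Q"
      unfolding lessThan_Suc using G k by (intro d.finprod_insert) auto
    then have "?P \<otimes>\<^bsub>dring ?N\<^esub> (\<Otimes>\<^bsub>dring ?N\<^esub>j\<in>{..<Suc k}. ?G j) = ?P \<otimes>\<^bsub>dring ?N\<^esub> ?G k \<otimes>\<^bsub>dring ?N\<^esub> ?Q"
      using P Q Gk by (simp only: d.m_assoc)
    also have "\<dots> = ?F (m + k) \<otimes>\<^bsub>dring ?N\<^esub> (?P \<otimes>\<^bsub>dring ?N\<^esub> ?Q)"
      unfolding step[OF k] using P Q Fk by (simp only: d.m_ac d.m_closed)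
    also have "\<dots> = ?F (m + k) \<otimes>\<^bsub>dring ?N\<^esub> (\<Otimes>\<^bsub>dring ?N\<^esub>i\<in>{..<m + k}. ?F i)"
      using Suc by simp
    also have "\<dots> = (\<Otimes>\<^bsub>dring ?N\<^esub>i\<in>{..<Suc (m + k)}. ?F i)"
      unfolding lessThan_Suc using F k by (intro d.finprod_insert[symmetric]) auto
    finally show ?case by simp
  qed
  from this[OF order_refl] show ?thesis
    using shift_nu_value[of m n ?N, OF _ cs] unfolding star_def nu_value_def[of ?N] by simp
qed

lemmas nu_closed = linear_onD(1)[OF nu_linear]

lemma star_nu:
  assumes m: "1 \<le> m" and \<alpha>: "\<alpha> \<in> carrier (Omega K m)" and \<beta>: "\<beta> \<in> carrier (Omega K n)"
  shows "star K m n (nu K m \<alpha>) (nu K n \<beta>) = nu K (m + n) (twedge K m n \<alpha> \<beta>)"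
proof -
  note lin_l = linear_on_comp[OF nu_linear star_linear_left[OF nu_closed]]
    linear_on_comp[OF twedge_bilinear(2) nu_linear]
  note lin_r = linear_on_comp[OF nu_linear star_linear_right[OF m nu_closed]]
    linear_on_comp[OF twedge_bilinear(1) nu_linear]
  note eq = linear_on_eq_on_spans[OF Omega_module Psi_module exact_forms_span]
  have exact: "g \<in> carrier (Omega K k)" if "g \<in> exact_forms k" for g k
    by (rule spans_closed[OF exact_forms_span that])
  have 1: "star K m n (nu K m \<alpha>) (nu K n \<beta>) = nu K (m + n) (twedge K m n \<alpha> \<beta>)"
    if \<alpha>: "\<alpha> \<in> exact_forms m" and \<beta>: "\<beta> \<in> exact_forms n" for \<alpha> \<beta>
  proof -
    obtain bs where bs: "\<alpha> = twedge_list K m (map (diff K) bs)" "length bs = m" "set bs \<subseteq> carrier B"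
      using \<alpha> by auto
    obtain cs where cs: "\<beta> = twedge_list K n (map (diff K) cs)" "length cs = n" "set cs \<subseteq> carrier B"
      using \<beta> by auto
    have "twedge K m n \<alpha> \<beta> = twedge_list K (m + n) (map (diff K) (bs @ cs))"
      using twedge_spec[of m n] diffs_in_tuples[OF bs(2,3)] diffs_in_tuples[OF cs(2,3)]
      unfolding bs(1) cs(1) by simp
    then show ?thesis
      using star_nu_value[OF m bs(2,3) cs(2,3)] nu_exact[of "bs @ cs" "m + n"] bs cs
      by (simp add: nu_exact)
  qed
  have 2: "star K m n (nu K m \<alpha>) (nu K n \<beta>) = nu K (m + n) (twedge K m n \<alpha> \<beta>)"
    if "\<alpha> \<in> exact_forms m" for \<alpha>
    by (rule eq[OF lin_r(1)[OF exact[OF that]] lin_r(2)[OF exact[OF that]] 1[OF that] \<beta>])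
  show ?thesis
    by (rule eq[OF lin_l(1)[OF \<beta>] lin_l(2)[OF \<beta>] 2 \<alpha>])
qed

abbreviation "Omega_tensor m n \<equiv> tensor B [Omega K m, Omega K n]"
abbreviation "Psi_tensor m n \<equiv> tensor B [Psi K m, Psi K n]"

lemma twedge_tensor_spec:
  shows twedge_tensor_linear: "linear_on B (Omega_tensor m n) (Omega K (m + n)) (twedge_tensor K m n)"
    and twedge_tensor_pure: "\<lbrakk>\<alpha> \<in> carrier (Omega K m); \<beta> \<in> carrier (Omega K n)\<rbrakk>
      \<Longrightarrow> twedge_tensor K m n (pure_tensor B [Omega K m, Omega K n] [\<alpha>, \<beta>]) = twedge K m n \<alpha> \<beta>"
  unfolding twedge_tensor_def
  using tensor_lift_spec[OF Omega_module Omega_module Omega_module twedge_bilinear] by blast+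

lemma star_tensor_spec:
  assumes "1 \<le> m"
  shows star_tensor_linear: "linear_on B (Psi_tensor m n) (Psi K (m + n)) (star_tensor K m n)"
    and star_tensor_pure: "\<lbrakk>f \<in> carrier (Psi K m); g \<in> carrier (Psi K n)\<rbrakk>
      \<Longrightarrow> star_tensor K m n (pure_tensor B [Psi K m, Psi K n] [f, g]) = star K m n f g"
  unfolding star_tensor_def
  using tensor_lift_spec[OF Psi_module Psi_module Psi_module star_linear_right[OF assms] star_linear_left]
  by blast+

lemma Psis_module: "i < length [Psi K m, Psi K n] \<Longrightarrow> module B ([Psi K m, Psi K n] ! i)"
  by (auto simp: less_Suc_eq Psi_module)

lemma Omegas_module: "i < length [Omega K m, Omega K n] \<Longrightarrow> module B ([Omega K m, Omega K n] ! i)"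
  by (auto simp: less_Suc_eq Omega_module)

lemma pure_tensor_linear:
  assumes f: "f \<in> carrier (Psi K m)" and g: "g \<in> carrier (Psi K n)"
  shows "linear_on B (Psi K n) (Psi_tensor m n) (\<lambda>y. pure_tensor B [Psi K m, Psi K n] [f, y])"
    and "linear_on B (Psi K m) (Psi_tensor m n) (\<lambda>x. pure_tensor B [Psi K m, Psi K n] [x, g])"
proof -
  have fg: "[f, g] \<in> tuples [Psi K m, Psi K n]" using f g by (simp add: tuples_two)
  note ml = multilinearD(2)[OF pure_tensor_multilinear[OF top_cring Psis_module] fg]
  show "linear_on B (Psi K n) (Psi_tensor m n) (\<lambda>y. pure_tensor B [Psi K m, Psi K n] [f, y])"
    using ml[of 1] by simp
  show "linear_on B (Psi K m) (Psi_tensor m n) (\<lambda>x. pure_tensor B [Psi K m, Psi K n] [x, g])"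
    using ml[of 0] by simp
qed

lemma nu_tensor_spec:
  shows nu_tensor_linear: "linear_on B (Omega_tensor m n) (Psi_tensor m n) (nu_tensor K m n)"
    and nu_tensor_pure: "\<lbrakk>\<alpha> \<in> carrier (Omega K m); \<beta> \<in> carrier (Omega K n)\<rbrakk>
      \<Longrightarrow> nu_tensor K m n (pure_tensor B [Omega K m, Omega K n] [\<alpha>, \<beta>]) =
          pure_tensor B [Psi K m, Psi K n] [nu K m \<alpha>, nu K n \<beta>]"
proof -
  \<comment> \<open>A value for the argument that the conclusions of \<open>pure_tensor_linear\<close> do not mention.\<close>
  have Psi0: "\<zero>\<^bsub>dring k\<^esub> \<in> carrier (Psi K k)" for k
    using submoduleD(2)[OF dmod_module Psi_submodule] by simp
  have r: "linear_on B (Omega K n) (Psi_tensor m n) (\<lambda>\<beta>. pure_tensor B [Psi K m, Psi K n] [nu K m \<alpha>, nu K n \<beta>])"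
    if "\<alpha> \<in> carrier (Omega K m)" for \<alpha>
    by (rule linear_on_comp[OF nu_linear pure_tensor_linear(1)[OF nu_closed[OF that] Psi0]])
  have l: "linear_on B (Omega K m) (Psi_tensor m n) (\<lambda>\<alpha>. pure_tensor B [Psi K m, Psi K n] [nu K m \<alpha>, nu K n \<beta>])"
    if "\<beta> \<in> carrier (Omega K n)" for \<beta>
    by (rule linear_on_comp[OF nu_linear pure_tensor_linear(2)[OF Psi0 nu_closed[OF that]]])
  note spec = tensor_lift_spec[OF Omega_module Omega_module tensor_module[OF top_cring Psis_module] r l]
  show "linear_on B (Omega_tensor m n) (Psi_tensor m n) (nu_tensor K m n)"
    unfolding nu_tensor_def by (rule spec(1))
  show "\<lbrakk>\<alpha> \<in> carrier (Omega K m); \<beta> \<in> carrier (Omega K n)\<rbrakk>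
      \<Longrightarrow> nu_tensor K m n (pure_tensor B [Omega K m, Omega K n] [\<alpha>, \<beta>]) =
          pure_tensor B [Psi K m, Psi K n] [nu K m \<alpha>, nu K n \<beta>]"
    unfolding nu_tensor_def by (rule spec(2))
qed

lemma star_nu_tensor:
  assumes m: "1 \<le> m" and \<tau>: "\<tau> \<in> carrier (Omega_tensor m n)"
  shows "star_tensor K m n (nu_tensor K m n \<tau>) = nu K (m + n) (twedge_tensor K m n \<tau>)"
proof (rule linear_on_eq_on_spans[OF tensor_module[OF top_cring Omegas_module] Psi_module
      pure_tensor_spans[OF top_cring Omegas_module]
      linear_on_comp[OF nu_tensor_linear star_tensor_linear[OF m]]
      linear_on_comp[OF twedge_tensor_linear nu_linear] _ \<tau>])
  fix g assume "g \<in> pure_tensor B [Omega K m, Omega K n] ` tuples [Omega K m, Omega K n]"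
  then obtain \<alpha> \<beta> where g: "g = pure_tensor B [Omega K m, Omega K n] [\<alpha>, \<beta>]"
    and \<alpha>: "\<alpha> \<in> carrier (Omega K m)" and \<beta>: "\<beta> \<in> carrier (Omega K n)"
    by (auto simp: tuples_two)
  show "star_tensor K m n (nu_tensor K m n g) = nu K (m + n) (twedge_tensor K m n g)"
    unfolding g nu_tensor_pure[OF \<alpha> \<beta>] twedge_tensor_pure[OF \<alpha> \<beta>]
      star_tensor_pure[OF m nu_closed[OF \<alpha>] nu_closed[OF \<beta>]]
    by (rule star_nu[OF m \<alpha> \<beta>])
qed

end

section \<open>Charts of a relative scheme\<close>

lemma chart_ring_morphism:
  assumes F: "rel_scheme F" and c: "c \<in> charts F W"
  shows "ring_morphism (chart_ring F c)"
proof -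
  obtain U V where UV: "c = (U, V)" by (cases c)
  have pre: "presheaf_of_rings (src F)" "presheaf_of_rings (tgt F)" and mor: "morphism_of_ringed_spaces F"
    using F unfolding rel_scheme_def scheme_def sheaf_of_rings_def by auto
  have U: "openin (rtop (src F)) U" and V: "openin (rtop (tgt F)) V" and sub: "U \<subseteq> preim F V"
    using c unfolding UV charts_def affine_open_def by auto
  have P: "openin (rtop (src F)) (preim F V)"
    using mor V unfolding morphism_of_ringed_spaces_def preim_def continuous_map_def by auto
  have co: "comorphism F V \<in> ring_hom (sec (tgt F) V) (sec (src F) (preim F V))"
    using mor V unfolding morphism_of_ringed_spaces_def by blast
  have re: "res (src F) (preim F V) U \<in> ring_hom (sec (src F) (preim F V)) (sec (src F) U)"
    by (rule mp[OF spec[OF spec[OF conjunct1[OF conjunct2[OF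
            pre(1)[unfolded presheaf_of_rings_def]]]]]])
       (intro conjI P U sub)
  have "(\<lambda>a. res (src F) (preim F V) U (comorphism F V a)) \<in> ring_hom (sec (tgt F) V) (sec (src F) U)"
    using ring_hom_trans[OF co re] by (simp add: comp_def)
  moreover have "cring (sec (src F) U)" and "cring (sec (tgt F) V)"
    by (rule mp[OF spec[OF conjunct1[OF pre(1)[unfolded presheaf_of_rings_def]]] U],
        rule mp[OF spec[OF conjunct1[OF pre(2)[unfolded presheaf_of_rings_def]]] V])
  ultimately show ?thesis
    unfolding UV chart_ring_def by (simp add: ring_morphism_def)
qed

theorem proposition1p14:
  fixes F :: "('p, 'a, 'q, 'c) rel_space" and m n :: nat and W :: "'p set"
  assumes "rel_scheme F" and "separated F"
    and "1 \<le> m" and "1 \<le> n"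
    and "openin (rtop (src F)) W"
  shows "(\<forall>\<alpha>\<in>Omega_sections F W m. \<forall>\<beta>\<in>Omega_sections F W n.
            on_charts2 F W (\<lambda>K. star K m n)
              (on_charts F W (\<lambda>K. nu K m) \<alpha>) (on_charts F W (\<lambda>K. nu K n) \<beta>) =
            on_charts F W (\<lambda>K. nu K (m + n)) (on_charts2 F W (\<lambda>K. twedge K m n) \<alpha> \<beta>)) \<and>
         (\<forall>\<tau>\<in>Omega_tensor_sections F W m n.
            on_charts F W (\<lambda>K. star_tensor K m n) (on_charts F W (\<lambda>K. nu_tensor K m n) \<tau>) =
            on_charts F W (\<lambda>K. nu K (m + n)) (on_charts F W (\<lambda>K. twedge_tensor K m n) \<tau>))"
proof (intro conjI ballI)
  fix \<alpha> \<beta> assume "\<alpha> \<in> Omega_sections F W m" and "\<beta> \<in> Omega_sections F W n"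
  then have sec: "\<alpha> c \<in> carrier (Omega (chart_ring F c) m)" "\<beta> c \<in> carrier (Omega (chart_ring F c) n)"
    if "c \<in> charts F W" for c
    using that unfolding Omega_sections_def glued_sections_def by auto
  have "star (chart_ring F c) m n (nu (chart_ring F c) m (\<alpha> c)) (nu (chart_ring F c) n (\<beta> c)) =
      nu (chart_ring F c) (m + n) (twedge (chart_ring F c) m n (\<alpha> c) (\<beta> c))"
    if "c \<in> charts F W" for c
    by (rule ring_morphism.star_nu[OF chart_ring_morphism[OF assms(1) that] assms(3) sec[OF that]])
  then show "on_charts2 F W (\<lambda>K. star K m n)
        (on_charts F W (\<lambda>K. nu K m) \<alpha>) (on_charts F W (\<lambda>K. nu K n) \<beta>) =
      on_charts F W (\<lambda>K. nu K (m + n)) (on_charts2 F W (\<lambda>K. twedge K m n) \<alpha> \<beta>)"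
    unfolding on_charts_def on_charts2_def by (intro restrict_ext) simp
next
  fix \<tau> assume "\<tau> \<in> Omega_tensor_sections F W m n"
  then have sec: "\<tau> c \<in> carrier (tensor (rm_ring (chart_ring F c))
      [Omega (chart_ring F c) m, Omega (chart_ring F c) n])" if "c \<in> charts F W" for c
    using that unfolding Omega_tensor_sections_def glued_sections_def by auto
  have "star_tensor (chart_ring F c) m n (nu_tensor (chart_ring F c) m n (\<tau> c)) =
      nu (chart_ring F c) (m + n) (twedge_tensor (chart_ring F c) m n (\<tau> c))"
    if "c \<in> charts F W" for c
    by (rule ring_morphism.star_nu_tensor[OF chart_ring_morphism[OF assms(1) that] assms(3) sec[OF that]])
  then show "on_charts F W (\<lambda>K. star_tensor K m n) (on_charts F W (\<lambda>K. nu_tensor K m n) \<tau>) =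
      on_charts F W (\<lambda>K. nu K (m + n)) (on_charts F W (\<lambda>K. twedge_tensor K m n) \<tau>)"
    unfolding on_charts_def by (intro restrict_ext) simp
qed

end
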